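(* Assume the coefficients are centered with unit variance and $X$ is uniform on $[0,2\pi]$. Then $\mathbb P$-almost surely, as $n\to\infty$, the process $(g_n(t))_{t\in[0,2\pi]}$, $g_n(t):=f_n(X+t/n)$, considered under $\mathbb P_X$, converges in distribution in $\mathcal C^1([0,2\pi])$ (with the $\mathcal C^1$ topology) to a centered stationary Gaussian process $(g_\infty(t))_{t\in[0,2\pi]}$ with covariance $\mathbb E_X[g_\infty(t)g_\infty(s)]=\frac{\sin(t-s)}{t-s}$ (equal to $1$ when $t=s$).
   Context: On a probability space $(\Omega,\mathcal F,\mathbb P)$ let $(a_k)_{k\ge1}$ and $(b_k)_{k\ge1}$ be random variables such that all the $a_k,b_k$ are mutually independent with a common distribution. For $n\ge1$ and $t\in\mathbb R$ let $f_n(t)=\frac{1}{\sqrt n}\sum_{k=1}^n \big(a_k\cos(kt)+b_k\sin(kt)\big)$. The random variable $X$ is independent of all the coefficients (product space $\Omega\times[0,2\pi]$ with $\mathbb P\otimes\mathbb P_X$); $\mathbb E_X,\mathbb P_X$ denote expectation/probability with respect to $X$ only, the coefficients being fixed. "$\mathbb P$-almost surely, under $\mathbb P_X$, $Z_n$ converges in law" means: for $\mathbb P$-a.e. $\omega$, the law of $Z_n(\omega,\cdot)$ under $\mathbb P_X$ converges. *)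

theory Defs
  imports "HOL-Analysis.Analysis" "HOL-Probability.Probability"
begin

text \<open>Clamping onto [0,2 pi]; used to encode C^1([0,2 pi]) isometrically (up to equivalent norm)
  as a closed subspace of pairs of bounded continuous functions on the real line.\<close>
definition clamp02pi :: "real \<Rightarrow> real" where
  "clamp02pi t = max 0 (min (2 * pi) t)"

type_synonym C1code = "(real \<Rightarrow>\<^sub>C real) \<times> (real \<Rightarrow>\<^sub>C real)"

definition C1_on_02pi :: "(real \<Rightarrow> real) \<Rightarrow> (real \<Rightarrow> real) \<Rightarrow> bool" where
  "C1_on_02pi g g' \<longleftrightarrow>
     (\<forall>t\<in>{0..2*pi}. (g has_real_derivative g' t) (at t within {0..2*pi}))
     \<and> continuous_on {0..2*pi} g'"

text \<open>Code of a C^1 function: (g restricted to [0,2pi], g' restricted to [0,2pi]),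
  extended constantly outside. The C^1 topology corresponds to the product sup-norm topology.\<close>
definition C1pair :: "(real \<Rightarrow> real) \<Rightarrow> (real \<Rightarrow> real) \<Rightarrow> C1code" where
  "C1pair g g' = (Bcontfun (\<lambda>t. g (clamp02pi t)), Bcontfun (\<lambda>t. g' (clamp02pi t)))"

definition C1space :: "C1code set" where
  "C1space = {C1pair g g' | g g'. C1_on_02pi g g'}"

definition C1emb :: "(real \<Rightarrow> real) \<Rightarrow> C1code" where
  "C1emb g = C1pair g (deriv g)"

definition weak_conv_metric :: "(nat \<Rightarrow> 'a::metric_space measure) \<Rightarrow> 'a measure \<Rightarrow> bool" where
  "weak_conv_metric Mn M \<longleftrightarrow>
     (\<forall>F :: 'a \<Rightarrow> real. continuous_on UNIV F \<and> bounded (range F) \<longrightarrow>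
        (\<lambda>n. integral\<^sup>L (Mn n) F) \<longlonglongrightarrow> integral\<^sup>L M F)"

definition sinc_cov :: "real \<Rightarrow> real" where
  "sinc_cov x = (if x = 0 then 1 else sin x / x)"

definition centered_normal :: "real \<Rightarrow> real measure" where
  "centered_normal v = (if v = 0 then return borel 0 else density lborel (normal_density 0 (sqrt v)))"

definition centered_gaussian_C1_law :: "(real \<Rightarrow> real \<Rightarrow> real) \<Rightarrow> C1code measure \<Rightarrow> bool" where
  "centered_gaussian_C1_law K mu \<longleftrightarrow>
     sets mu = sets borel \<and> prob_space mu \<and> emeasure mu C1space = 1 \<and>
     (\<forall>T (c :: real \<Rightarrow> real). finite T \<and> T \<subseteq> {0..2*pi} \<longrightarrow>
        distr mu borel (\<lambda>p. \<Sum>t\<in>T. c t * apply_bcontfun (fst p) t)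
          = centered_normal (\<Sum>s\<in>T. \<Sum>u\<in>T. c s * c u * K s u))"

definition fn_rand :: "(nat \<Rightarrow> 'a \<Rightarrow> real) \<Rightarrow> (nat \<Rightarrow> 'a \<Rightarrow> real) \<Rightarrow> nat \<Rightarrow> 'a \<Rightarrow> real \<Rightarrow> real" where
  "fn_rand a b n \<omega> t = 1 / sqrt (real n) * (\<Sum>k=1..n. a k \<omega> * cos (real k * t) + b k \<omega> * sin (real k * t))"

end

theory Submission
  imports Defs "HOL-Real_Asymp.Real_Asymp"
begin

text \<open>The process \<open>g_n\<close> is a power series in \<open>t\<close> whose Taylor coefficients at \<open>0\<close> are
  $Y_{n,j}(X) = n^{-1/2} \sum_{k \le n} \mathrm{Re}\,((a_k - i b_k)(i k/n)^j e^{ikX})$. By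
  orthogonality their second moments under \<open>X\<close> are at most $\frac{1}{2n}\sum_k (a_k^2 + b_k^2)$,
  which is almost surely bounded uniformly in \<open>j\<close> and \<open>n\<close>. Hence, up to small probability, the
  sequence $(Y_{n,j})_j$ lies in a compact cube $|y_j| \le 2^j R$, on which the map from Taylor
  coefficients to $C^1$ functions is continuous. Convergence in law in $C^1$ thus reduces, by
  Stone--Weierstrass for trigonometric polynomials on this cube, to convergence of the
  characteristic functions of countably many finite linear forms
  $\sum_j d_j Y_{n,j} = n^{-1/2}\sum_k \mathrm{Re}\,((a_k - i b_k) q(k/n) e^{ikX})$, with
  \<open>q\<close> a polynomial.

  For bounded coefficients the mean square distance of such a characteristic function to its
  Gaussian limit is $O(n^{-1/2})$, which gives almost sure convergence along fourth powers, and then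
  along all \<open>n\<close> by interpolation. The general case follows by truncating the coefficients, the
  remainder being controlled in $L^2$ by a one-sided law of large numbers. The limiting Taylor
  coefficients are built explicitly from independent normal variables, by a Cholesky factorisation
  of the Hilbert matrix.\<close>

subsection \<open>Trigonometric sums under the uniform law\<close>

text \<open>The frequencies \<open>k / n\<close> never exceed 1, so differentiating
  \<open>g_n\<close> in \<open>t\<close> does not enlarge its mean square. Taylor coefficients of
  all orders are therefore controlled at once and take the place of a modulus of continuity. The
  cube weights \<open>2^j\<close> are a compromise: they make the Chebyshev bounds summable over
  \<open>j\<close>, while the factorials of the Taylor series still absorb them. The limit law is
  constructed beforehand, so integrals are compared directly with those of the limit. The obstacle
  is that only second moments are available, whereas the fluctuation estimate for the random
  characteristic function rests on a third-order expansion, hence on bounded coefficients. Its rate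
  has two sources of equal order: \<open>2 n\<close> cubic Taylor errors of size
  \<open>n^(-3/2)\<close>, and the mean correlation of the weights at two independent points, of
  size \<open>n^(-1/2)\<close>. For the truncation remainder an upper bound up to a factor 2
  suffices, because its second moment tends to 0.\<close>

definition unifX :: "real measure" where
  "unifX = uniform_measure lborel {0..2*pi}"

lemma prob_space_unifX: "prob_space unifX"
  unfolding unifX_def by (rule prob_space_uniform_measure) auto

interpretation unifX: prob_space unifX by (rule prob_space_unifX)

lemma sets_unifX [measurable_cong, simp]: "sets unifX = sets borel"
  by (simp add: unifX_def)

lemma space_unifX [simp]: "space unifX = UNIV"
  by (simp add: unifX_def)

lemma integral_unifX:
  fixes f :: "real \<Rightarrow> 'b::{banach, second_countable_topology}"
  assumes [measurable]: "f \<in> borel_measurable borel"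
  shows "integral\<^sup>L unifX f = (LINT x:{0..2*pi}|lborel. f x) /\<^sub>R (2*pi)"
proof -
  have u: "unifX = density lborel (\<lambda>x. ennreal (indicator {0..2*pi} x / (2*pi)))"
    unfolding unifX_def uniform_measure_def
    by (rule arg_cong[where f="density lborel"]) (auto simp: fun_eq_iff divide_ennreal[where r=1, simplified] indicator_def)
  show ?thesis
  proof -
    have "integral\<^sup>L unifX f = (LINT x|lborel. (indicator {0..2*pi} x / (2*pi)) *\<^sub>R f x)"
      unfolding u by (rule integral_density) auto
    also have "\<dots> = (LINT x|lborel. (1 / (2*pi)) *\<^sub>R (indicator {0..2*pi} x *\<^sub>R f x))"
      by (simp add: field_simps)
    also have "\<dots> = (LINT x:{0..2*pi}|lborel. f x) /\<^sub>R (2*pi)"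
      unfolding set_lebesgue_integral_def by (subst integral_scaleR_right) (simp add: inverse_eq_divide)
    finally show ?thesis .
  qed
qed

lemma integral_unifX_cis:
  "(LINT x|unifX. cis (of_int m * x)) = (if m = 0 then 1 else 0)"
proof (cases "m = 0")
  case True
  then show ?thesis by (simp add: unifX.prob_space[simplified])
next
  case False
  have c: "continuous_on UNIV (\<lambda>x. cis (of_int m * x))"
    by (intro continuous_intros)
  have "(LINT x:{0..2*pi}|lborel. cis (of_int m * x)) =
      cis (of_int m * (2*pi)) / (\<i> * of_int m) - cis (of_int m * 0) / (\<i> * of_int m)"
    unfolding set_lebesgue_integral_def
  proof (rule integral_FTC_Icc)
    fix x :: real assume "0 \<le> x"
    show "((\<lambda>x. cis (of_int m * x) / (\<i> * of_int m)) has_vector_derivative cis (of_int m * x)) (at x within {0..2 * pi})"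
      proof -
      have "((\<lambda>w. exp (\<i> * of_int m * w) / (\<i> * of_int m)) has_field_derivative exp (\<i> * of_int m * of_real x)) (at (of_real x))"
        by (auto intro!: derivative_eq_intros simp: False)
      from has_vector_derivative_real_field[OF this, of "{0..2*pi}"] show ?thesis
        by (simp add: cis_conv_exp mult.assoc)
    qed
  qed (use c in \<open>auto intro: continuous_on_subset\<close>)
  also have "cis (of_int m * (2*pi)) = 1"
    using cis_multiple_2pi[of "of_int m"] by (simp add: mult_ac)
  finally have "(LINT x:{0..2*pi}|lborel. cis (of_int m * x)) = 0" by simp
  then show ?thesis
    using False by (subst integral_unifX) (auto intro!: borel_measurable_continuous_onI c)
qed

lemma measurable_cis_lin [measurable]: "(\<lambda>x. cis (c * x)) \<in> borel_measurable borel"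
  by (intro borel_measurable_continuous_onI continuous_intros)

lemma integrable_unifX_bounded:
  fixes f :: "real \<Rightarrow> 'b::{banach, second_countable_topology}"
  assumes "f \<in> borel_measurable borel" "\<And>x. norm (f x) \<le> B"
  shows "integrable unifX f"
  by (rule unifX.integrable_const_bound[where B=B]) (use assms in \<open>auto simp: unifX_def\<close>)

lemma integral_unifX_Re_cis_mult:
  assumes "k \<ge> 1" "l \<ge> 1"
  shows "(LINT x|unifX. Re (z * cis (real k * x)) * Re (w * cis (real l * x)))
       = (if k = l then Re (z * cnj w) / 2 else 0)"
proof -
  have e: "Re (z * cis (real k * x)) * Re (w * cis (real l * x)) =
     Re (z * w / 2 * cis (of_int (int k + int l) * x) + z * cnj w / 2 * cis (of_int (int k - int l) * x))" for x
  proof -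
    have c1: "cis (of_int (int k + int l) * x) = cis (real k * x) * cis (real l * x)"
      by (simp add: cis_mult distrib_right)
    have c2: "cis (of_int (int k - int l) * x) = cis (real k * x) * cnj (cis (real l * x))"
      by (simp add: cis_mult cis_cnj left_diff_distrib)
    have "Re u * Re v = Re (u * v / 2 + u * cnj v / 2)" for u v by (simp add: field_simps)
    from this[of "z * cis (real k * x)" "w * cis (real l * x)"] show ?thesis
      by (simp only: c1 c2 complex_cnj_mult) (simp only: mult_ac times_divide_eq_left times_divide_eq_right)
  qed
  have i: "integrable unifX (\<lambda>x. c * cis (of_int m * x))" for c m
    by (rule integrable_unifX_bounded[where B="cmod c"]) (auto simp: norm_mult)
  have "(LINT x|unifX. Re (z * cis (real k * x)) * Re (w * cis (real l * x))) =
     Re (LINT x|unifX. z * w / 2 * cis (of_int (int k + int l) * x) + z * cnj w / 2 * cis (of_int (int k - int l) * x))"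
    unfolding e by (intro integral_Re Bochner_Integration.integrable_add i)
  also have "\<dots> = Re (z * w / 2 * (LINT x|unifX. cis (of_int (int k + int l) * x)) + z * cnj w / 2 * (LINT x|unifX. cis (of_int (int k - int l) * x)))"
    by (subst Bochner_Integration.integral_add) (auto simp: i simp del: of_int_add of_int_diff)
  \<comment> \<open>As \<open>k, l \<ge> 1\<close>, the frequency \<open>k + l\<close> never
    vanishes, so only the difference frequency can contribute.\<close>
  also have "\<dots> = (if k = l then Re (z * cnj w) / 2 else 0)"
    unfolding integral_unifX_cis using assms by auto
  finally show ?thesis .
qed

definition trig :: "(nat \<Rightarrow> complex) \<Rightarrow> nat \<Rightarrow> real \<Rightarrow> real" where
  "trig z n x = (\<Sum>k=1..n. Re (z k * cis (real k * x)))"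

lemma continuous_trig [continuous_intros]: "continuous_on S (trig z n)"
  unfolding trig_def by (intro continuous_intros)

lemma measurable_trig [measurable]: "trig z n \<in> borel_measurable borel"
  by (intro borel_measurable_continuous_onI continuous_intros)

lemma trig_bound: "\<bar>trig z n x\<bar> \<le> (\<Sum>k=1..n. cmod (z k))"
  unfolding trig_def
  by (rule order_trans[OF sum_abs], rule sum_mono, rule order_trans[OF abs_Re_le_cmod]) (simp add: norm_mult)

lemma trig_diff: "trig z n x - trig w n x = trig (\<lambda>k. z k - w k) n x"
  by (simp add: trig_def sum_subtractf left_diff_distrib)

text \<open>Parseval: distinct positive frequencies are orthogonal, and the factor 1/2 is the mean
  of a squared cosine.\<close>

lemma integral_trig_square:
  "(LINT x|unifX. (trig z n x)\<^sup>2) = (\<Sum>k=1..n. (cmod (z k))\<^sup>2) / 2"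
proof -
  have i: "integrable unifX (\<lambda>x. Re (z k * cis (real k * x)) * Re (z l * cis (real l * x)))" for k l
  proof (rule integrable_unifX_bounded[where B="cmod (z k) * cmod (z l)"])
    have "\<bar>Re (z k * cis (real k * x))\<bar> \<le> cmod (z k)" for x k
      using abs_Re_le_cmod[of "z k * cis (real k * x)"] by (simp add: norm_mult)
    then show "norm (Re (z k * cis (real k * x)) * Re (z l * cis (real l * x))) \<le> cmod (z k) * cmod (z l)" for x
      by (auto simp: norm_mult abs_mult intro!: mult_mono simp del: Re_complex_of_real times_complex.simps)
  qed measurable
  have "(LINT x|unifX. (trig z n x)\<^sup>2) =
     (LINT x|unifX. (\<Sum>k=1..n. \<Sum>l=1..n. Re (z k * cis (real k * x)) * Re (z l * cis (real l * x))))"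
    unfolding trig_def power2_eq_square sum_product ..
  also have "\<dots> = (\<Sum>k=1..n. \<Sum>l=1..n. (LINT x|unifX. Re (z k * cis (real k * x)) * Re (z l * cis (real l * x))))"
    by (simp add: Bochner_Integration.integral_sum i integrable_sum del: times_complex.simps)
  also have "\<dots> = (\<Sum>k=1..n. \<Sum>l=1..n. if k = l then Re (z k * cnj (z l)) / 2 else 0)"
    by (intro sum.cong refl integral_unifX_Re_cis_mult) auto
  also have "\<dots> = (\<Sum>k=1..n. (cmod (z k))\<^sup>2) / 2"
    by (simp add: sum.delta' sum_divide_distrib cmod_power2) (simp add: power2_eq_square)
  finally show ?thesis .
qed

text \<open>This is the nonnegativity of the variance of \<open>\<bar>f x\<bar>\<close>.\<close>

lemma (in prob_space) abs_expectation_le_sqrt: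
  fixes f :: "'a \<Rightarrow> real"
  assumes "f \<in> borel_measurable M" "integrable M (\<lambda>x. (f x)\<^sup>2)"
  shows "expectation (\<lambda>x. \<bar>f x\<bar>) \<le> sqrt (expectation (\<lambda>x. (f x)\<^sup>2))"
proof (rule real_le_rsqrt)
  have i: "integrable M (\<lambda>x. \<bar>f x\<bar>)"
    using square_integrable_imp_integrable[OF assms] by simp
  have "0 \<le> variance (\<lambda>x. \<bar>f x\<bar>)" by (rule variance_positive)
  also have "\<dots> = expectation (\<lambda>x. \<bar>f x\<bar>\<^sup>2) - (expectation (\<lambda>x. \<bar>f x\<bar>))\<^sup>2"
    by (rule variance_eq[OF i]) (simp add: assms)
  finally show "(expectation (\<lambda>x. \<bar>f x\<bar>))\<^sup>2 \<le> expectation (\<lambda>x. (f x)\<^sup>2)" by simp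
qed

lemma cmod_iexp_diff_le: "cmod (iexp s - iexp t) \<le> \<bar>s - t\<bar>"
proof -
  have "iexp s - iexp t = iexp t * (iexp (s - t) - 1)"
    by (simp add: right_diff_distrib algebra_simps flip: exp_add)
  then have "cmod (iexp s - iexp t) = cmod (iexp (s - t) - 1)" by (simp add: norm_mult)
  also have "\<dots> \<le> \<bar>s - t\<bar>" using iexp_approx1[of "s - t" 0] by simp
  finally show ?thesis .
qed

definition trig_char :: "(nat \<Rightarrow> complex) \<Rightarrow> nat \<Rightarrow> complex" where
  "trig_char z n = (LINT x|unifX. iexp (trig z n x))"

lemma integrable_iexp_trig [simp]: "integrable unifX (\<lambda>x. iexp (trig z n x))"
  by (rule integrable_unifX_bounded[where B=1]) auto

text \<open>The map \<open>iexp\<close> is 1-Lipschitz, and Parseval evaluates the mean square of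
  the difference. This stability serves twice: to compare different \<open>n\<close>, and to compare
  truncated with original coefficients.\<close>

lemma trig_char_diff:
  "cmod (trig_char z n - trig_char w n) \<le> sqrt ((\<Sum>k=1..n. (cmod (z k - w k))\<^sup>2) / 2)"
proof -
  let ?D = "trig (\<lambda>k. z k - w k) n"
  have sq: "integrable unifX (\<lambda>x. (?D x)\<^sup>2)"
  proof (rule integrable_unifX_bounded)
    show "norm ((?D x)\<^sup>2) \<le> (\<Sum>k=1..n. cmod (z k - w k))\<^sup>2" for x
      using power_mono[OF trig_bound[of "\<lambda>k. z k - w k" n x], of 2] by simp
  qed simp
  have "cmod (trig_char z n - trig_char w n) = cmod (LINT x|unifX. iexp (trig z n x) - iexp (trig w n x))"
    unfolding trig_char_def by (subst Bochner_Integration.integral_diff) auto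
  also have "\<dots> \<le> (LINT x|unifX. cmod (iexp (trig z n x) - iexp (trig w n x)))"
    by (rule integral_norm_bound)
  also have "\<dots> \<le> (LINT x|unifX. \<bar>?D x\<bar>)"
  proof (rule integral_mono)
    show "integrable unifX (\<lambda>x. \<bar>?D x\<bar>)"
      by (rule integrable_unifX_bounded[of _ "\<Sum>k=1..n. cmod (z k - w k)"]) (auto intro!: trig_bound simp del: One_nat_def)
    show "cmod (iexp (trig z n x) - iexp (trig w n x)) \<le> \<bar>?D x\<bar>" for x
      using cmod_iexp_diff_le trig_diff by metis
  qed auto
  also have "\<dots> \<le> sqrt (LINT x|unifX. (?D x)\<^sup>2)"
    by (rule unifX.abs_expectation_le_sqrt) (auto simp: sq)
  finally show ?thesis by (simp add: integral_trig_square)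
qed

subsection \<open>A law of large numbers bound for nonnegative variables\<close>

lemma (in prob_space) indep_vars_sum_square:
  fixes X :: "'i \<Rightarrow> 'a \<Rightarrow> real"
  assumes I: "finite I" and ind: "indep_vars (\<lambda>_. borel) X I"
    and int: "\<And>i. i \<in> I \<Longrightarrow> integrable M (X i)"
    and int2: "\<And>i. i \<in> I \<Longrightarrow> integrable M (\<lambda>\<omega>. (X i \<omega>)\<^sup>2)"
    and zero: "\<And>i. i \<in> I \<Longrightarrow> expectation (X i) = 0"
  shows "integrable M (\<lambda>\<omega>. (\<Sum>i\<in>I. X i \<omega>)\<^sup>2)"
    and "expectation (\<lambda>\<omega>. (\<Sum>i\<in>I. X i \<omega>)\<^sup>2) = (\<Sum>i\<in>I. expectation (\<lambda>\<omega>. (X i \<omega>)\<^sup>2))"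
proof -
  have pr: "integrable M (\<lambda>\<omega>. X i \<omega> * X j \<omega>) \<and>
      expectation (\<lambda>\<omega>. X i \<omega> * X j \<omega>) = (if i = j then expectation (\<lambda>\<omega>. (X i \<omega>)\<^sup>2) else 0)"
    if "i \<in> I" "j \<in> I" for i j
  proof (cases "i = j")
    case True
    then show ?thesis using int2[OF that(1)] by (simp add: power2_eq_square)
  next
    case False
    have "indep_vars (\<lambda>_. borel) X {i, j}"
      by (rule indep_vars_subset[OF ind]) (use that in auto)
    note f = indep_vars_integrable[OF _ this] indep_vars_lebesgue_integral[OF _ this]
    show ?thesis
      using f False int that zero by auto
  qed
  have e: "(\<lambda>\<omega>. (\<Sum>i\<in>I. X i \<omega>)\<^sup>2) = (\<lambda>\<omega>. \<Sum>i\<in>I. \<Sum>j\<in>I. X i \<omega> * X j \<omega>)"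
    by (simp add: power2_eq_square sum_product)
  show "integrable M (\<lambda>\<omega>. (\<Sum>i\<in>I. X i \<omega>)\<^sup>2)"
    unfolding e by (intro Bochner_Integration.integrable_sum) (use pr in auto)
  have "expectation (\<lambda>\<omega>. (\<Sum>i\<in>I. X i \<omega>)\<^sup>2) = (\<Sum>i\<in>I. \<Sum>j\<in>I. expectation (\<lambda>\<omega>. X i \<omega> * X j \<omega>))"
    unfolding e using pr by (subst Bochner_Integration.integral_sum, force)
      (intro sum.cong refl Bochner_Integration.integral_sum, auto)
  also have "\<dots> = (\<Sum>i\<in>I. \<Sum>j\<in>I. if i = j then expectation (\<lambda>\<omega>. (X i \<omega>)\<^sup>2) else 0)"
    using pr by (intro sum.cong refl) auto
  finally show "expectation (\<lambda>\<omega>. (\<Sum>i\<in>I. X i \<omega>)\<^sup>2) = (\<Sum>i\<in>I. expectation (\<lambda>\<omega>. (X i \<omega>)\<^sup>2))"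
    using I by simp
qed

lemma dyadic_truncation_sum1:
  fixes z :: real
  assumes "z \<ge> 0"
  shows "(\<Sum>m<N. 2^m * indicator {z. z > 2^m} z) \<le> 2 * z"
proof -
  \<comment> \<open>The second bound drives the induction: if \<open>z > 2^N\<close>, the new term
    is \<open>2^N\<close> and the old sum is at most \<open>2^N\<close>, so both bounds
    persist.\<close>
  have "(\<Sum>m<N. 2^m * indicator {z. z > 2^m} z) \<le> 2 * z \<and> (\<Sum>m<N. 2^m * indicator {z. z > 2^m} z) \<le> (2::real)^N"
    by (induction N) (use assms in \<open>auto simp: indicator_def\<close>)
  then show ?thesis by simp
qed

lemma dyadic_truncation_sum2:
  fixes z :: real
  assumes z: "z \<ge> 0"
  shows "(\<Sum>m<N. (min z (2^m))\<^sup>2 / 2^m) \<le> 4 * z"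
proof -
  \<comment> \<open>The induction step at the one index where \<open>y = 2^N\<close> is below
    \<open>z\<close> and \<open>2 * y\<close> is not.\<close>
  have key: "2 * y \<le> 4 * z - 2 * z\<^sup>2 / (2 * y)" if "y < z" "z \<le> 2 * y" "y > 0" for y :: real
  proof -
    have "(z - y) * (2 * y - z) \<ge> 0" using that by simp
    then have "z\<^sup>2 / y \<le> 3 * z - 2 * y"
      using that by (simp add: field_simps power2_eq_square)
    moreover have "2 * z\<^sup>2 / (2 * y) = z\<^sup>2 / y" by simp
    ultimately show ?thesis using that by linarith
  qed
  \<comment> \<open>As long as \<open>2^m < z\<close> the terms are \<open>2^m\<close>, with sum
    below \<open>2^N\<close>. Afterwards they are \<open>z\<^sup>2 / 2^m\<close>, and the subtracted
    \<open>2 * z\<^sup>2 / 2^N\<close> is exactly the sum of all terms still to come.\<close>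
  have "(\<Sum>m<N. (min z (2^m))\<^sup>2 / 2^m) \<le> (if 2^N < z then 2^N else 4 * z - 2 * z\<^sup>2 / 2^N)"
  proof (induction N)
    case 0
    have "2 * z\<^sup>2 \<le> 4 * z" if "z \<le> 1"
      using mult_right_mono[OF that z] z by (simp add: power2_eq_square)
    then show ?case by simp
  next
    case (Suc N)
    consider "2 * 2^N < z" | "2^N < z" "z \<le> 2 * 2^N" | "z \<le> 2^N" by linarith
    then show ?case
    proof cases
      case 1
      moreover have "(0::real) < 2^N" by simp
      ultimately have N: "2^N < z" by linarith
      then have "(min z (2^N))\<^sup>2 / 2^N = 2^N" by (simp add: min_def power2_eq_square)
      then show ?thesis using Suc 1 N by simp
    next
      case 2
      then have "(min z (2^N))\<^sup>2 / 2^N = 2^N" by (simp add: min_def power2_eq_square)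
      then show ?thesis using Suc 2 key[of "2^N"] by simp
    next
      case 3
      then have m: "(min z (2^N))\<^sup>2 / 2^N = z\<^sup>2 / 2^N" by (simp add: min_def)
      have "\<not> 2^N < z" "\<not> 2^Suc N < z" using 3 zero_less_power[of "2::real" N] by (simp_all del: zero_less_power)
      moreover have "2 * z\<^sup>2 / 2^Suc N = z\<^sup>2 / 2^N" "2 * z\<^sup>2 / 2^N = 2 * (z\<^sup>2 / 2^N)" by simp_all
      ultimately show ?thesis using Suc m by simp
    qed
  qed
  also have "\<dots> \<le> 4 * z" using z by auto
  finally show ?thesis .
qed

text \<open>Truncation at level $2^m$ and Chebyshev's inequality. By the two preceding lemmas the
  right-hand sides are summable over $m$ under a mere first moment assumption.\<close>

lemma (in prob_space) iid_dyadic_sum_tail: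
  fixes Z :: "nat \<Rightarrow> 'a \<Rightarrow> real"
  assumes ind: "indep_vars (\<lambda>_. borel) Z {1..}"
    and nonneg: "\<And>k \<omega>. 0 \<le> Z k \<omega>"
    and dist: "\<And>k. k \<ge> 1 \<Longrightarrow> distr M borel (Z k) = distr M borel (Z 1)"
    and int: "integrable M (Z 1)" and e: "e > 0"
  shows "prob {\<omega>\<in>space M. (\<Sum>k=1..2^m. Z k \<omega>) > 2^m * (expectation (Z 1) + e)}
    \<le> expectation (\<lambda>\<omega>. 2^m * indicator {z. z > 2^m} (Z 1 \<omega>) + (min (Z 1 \<omega>) (2^m))\<^sup>2 / 2^m / e\<^sup>2)"
    (is "prob ?A \<le> _")
proof -
  let ?n = "2^m :: nat" and ?N = "2^m :: real"
  have rv: "random_variable borel (Z k)" if "k \<ge> 1" for k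
    using ind that by (auto simp: indep_vars_def)
  note rv[measurable]
  have transfer: "expectation (\<lambda>\<omega>. h (Z k \<omega>)) = expectation (\<lambda>\<omega>. h (Z 1 \<omega>))"
    if "k \<ge> 1" "h \<in> borel_measurable borel" for k and h :: "real \<Rightarrow> real"
    using integral_distr[OF rv[OF that(1)] that(2)] integral_distr[OF rv[of 1] that(2)] dist[OF that(1)] by simp
  define T where "T k \<omega> = min (Z k \<omega>) ?N" for k \<omega>
  define c where "c = expectation (T 1)"
  have T_bd: "\<bar>T k \<omega>\<bar> \<le> ?N" for k \<omega>
    using nonneg[of k \<omega>] by (auto simp: T_def min_def)
  have T_rv[measurable]: "random_variable borel (T k)" if "k \<ge> 1" for k
    using rv[OF that] unfolding T_def by measurable
  have T_int: "integrable M (T k)" "integrable M (\<lambda>\<omega>. (T k \<omega>)\<^sup>2)" if "k \<ge> 1" for k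
    using that T_bd power_mono[OF T_bd[of k] abs_ge_zero, where n=2]
     apply (intro integrable_const_bound[where B="?N"]; simp)
    using that T_bd power_mono[OF T_bd[of k] abs_ge_zero, where n=2]
    by (intro integrable_const_bound[where B="?N\<^sup>2"]; simp)
  have Tc: "expectation (T k) = c" if "k \<ge> 1" for k
    unfolding c_def T_def by (rule transfer[OF that]) measurable
  have Tsq: "expectation (\<lambda>\<omega>. (T k \<omega>)\<^sup>2) = expectation (\<lambda>\<omega>. (T 1 \<omega>)\<^sup>2)" if "k \<ge> 1" for k
    unfolding T_def by (rule transfer[OF that]) measurable
  \<comment> \<open>Truncation lowers the mean, which is the favourable direction for an upper
    bound.\<close>
  have c_le: "c \<le> expectation (Z 1)"
    unfolding c_def by (rule integral_mono) (use T_int[of 1] int in \<open>auto simp: T_def\<close>)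
  define S where "S \<omega> = (\<Sum>k=1..?n. T k \<omega> - c)" for \<omega>
  have ind': "indep_vars (\<lambda>_. borel) (\<lambda>k \<omega>. T k \<omega> - c) {1..?n}"
    unfolding T_def
    by (rule indep_vars_compose2[where Y="\<lambda>_ z. min z ?N - c", OF indep_vars_subset[OF ind]]) auto
  have Tm: "integrable M (\<lambda>\<omega>. (T k \<omega> - c)\<^sup>2)" "expectation (\<lambda>\<omega>. (T k \<omega> - c)\<^sup>2) \<le> expectation (\<lambda>\<omega>. (T 1 \<omega>)\<^sup>2)"
    if k: "k \<ge> 1" for k
  proof -
    show "integrable M (\<lambda>\<omega>. (T k \<omega> - c)\<^sup>2)"
      unfolding power2_diff using k by (auto intro!: Bochner_Integration.integrable_add Bochner_Integration.integrable_diff T_int)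
    have "expectation (\<lambda>\<omega>. (T k \<omega> - c)\<^sup>2) = expectation (\<lambda>\<omega>. (T k \<omega>)\<^sup>2) - c\<^sup>2"
      using variance_eq[OF T_int[OF k]] Tc[OF k] by simp
    then show "expectation (\<lambda>\<omega>. (T k \<omega> - c)\<^sup>2) \<le> expectation (\<lambda>\<omega>. (T 1 \<omega>)\<^sup>2)"
      using Tsq[OF k] by simp
  qed
  have S0: "expectation (\<lambda>\<omega>. T k \<omega> - c) = 0" if "k \<ge> 1" for k
    using T_int[OF that] Tc[OF that] by (simp add: prob_space)
  have S2: "integrable M (\<lambda>\<omega>. (S \<omega>)\<^sup>2)"
    "expectation (\<lambda>\<omega>. (S \<omega>)\<^sup>2) = (\<Sum>k=1..?n. expectation (\<lambda>\<omega>. (T k \<omega> - c)\<^sup>2))"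
    unfolding S_def using indep_vars_sum_square[OF _ ind'] T_int Tm S0 by auto
  have S2': "expectation (\<lambda>\<omega>. (S \<omega>)\<^sup>2) \<le> ?N * expectation (\<lambda>\<omega>. (T 1 \<omega>)\<^sup>2)"
  proof -
    have "expectation (\<lambda>\<omega>. (S \<omega>)\<^sup>2) \<le> (\<Sum>k=1..?n. expectation (\<lambda>\<omega>. (T 1 \<omega>)\<^sup>2))"
      unfolding S2 by (intro sum_mono Tm) auto
    then show ?thesis by simp
  qed
  have Srv[measurable]: "random_variable borel S" unfolding S_def by (measurable; auto)
  have ES: "expectation S = 0"
    unfolding S_def using T_int S0 by (subst Bochner_Integration.integral_sum) auto
  let ?B = "\<lambda>k. {\<omega>\<in>space M. Z k \<omega> > ?N}" and ?C = "{\<omega>\<in>space M. \<bar>S \<omega>\<bar> \<ge> ?N * e}"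
  have "?A \<subseteq> (\<Union>k\<in>{1..?n}. ?B k) \<union> ?C"
  proof
    fix \<omega> assume w: "\<omega> \<in> ?A"
    show "\<omega> \<in> (\<Union>k\<in>{1..?n}. ?B k) \<union> ?C"
    proof (cases "\<exists>k\<in>{1..?n}. Z k \<omega> > ?N")
      case False
      then have "S \<omega> = (\<Sum>k=1..?n. Z k \<omega> - c)"
        unfolding S_def T_def by (intro sum.cong) (auto simp: not_less min_def)
      also have "\<dots> = (\<Sum>k=1..?n. Z k \<omega>) - ?N * c" by (simp add: sum_subtractf)
      also have "\<dots> \<ge> ?N * e"
      proof -
        have "?N * c \<le> ?N * expectation (Z 1)" using c_le by (intro mult_left_mono) auto
        moreover have "?N * expectation (Z 1) + ?N * e < (\<Sum>k=1..?n. Z k \<omega>)" using w by (simp add: distrib_left)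
        ultimately show ?thesis by linarith
      qed
      finally show ?thesis using w by auto
    qed (use w in auto)
  qed
  then have "prob ?A \<le> prob ((\<Union>k\<in>{1..?n}. ?B k) \<union> ?C)"
    by (rule finite_measure_mono) measurable
  also have "\<dots> \<le> prob (\<Union>k\<in>{1..?n}. ?B k) + prob ?C"
    by (rule measure_Un_le) measurable
  also have "prob (\<Union>k\<in>{1..?n}. ?B k) \<le> (\<Sum>k=1..?n. prob (?B k))"
    by (rule measure_UNION_le) (use rv in \<open>auto simp: borel_measurable_iff_greater\<close>)
  also have "\<dots> = (\<Sum>k=1..?n. expectation (\<lambda>\<omega>. indicator {z. z > ?N} (Z 1 \<omega>)))"
  proof (rule sum.cong)
    fix k assume "k \<in> {1..?n}"
    then have k: "k \<ge> 1" by simp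
    have "prob (?B k) = expectation (indicator (?B k))"
      using k by simp
    also have "\<dots> = expectation (\<lambda>\<omega>. indicator {z. z > ?N} (Z k \<omega>))"
      by (rule Bochner_Integration.integral_cong) (auto simp: indicator_def)
    also have "\<dots> = expectation (\<lambda>\<omega>. indicator {z. z > ?N} (Z 1 \<omega>))"
      by (rule transfer[OF k]) measurable
    finally show "prob (?B k) = expectation (\<lambda>\<omega>. indicator {z. z > ?N} (Z 1 \<omega>))" .
  qed simp
  also have "\<dots> = ?N * expectation (\<lambda>\<omega>. indicator {z. z > ?N} (Z 1 \<omega>))" by simp
  also have "prob ?C \<le> expectation (\<lambda>\<omega>. (S \<omega>)\<^sup>2) / (?N * e)\<^sup>2"
    using Chebyshev_inequality[OF Srv S2(1), of "?N * e"] e ES by simp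
  also have "\<dots> \<le> ?N * expectation (\<lambda>\<omega>. (T 1 \<omega>)\<^sup>2) / (?N * e)\<^sup>2"
    by (rule divide_right_mono[OF S2']) simp
  also have "\<dots> = expectation (\<lambda>\<omega>. (T 1 \<omega>)\<^sup>2) / ?N / e\<^sup>2"
    using e by (simp add: power2_eq_square)
  also have "?N * expectation (\<lambda>\<omega>. indicator {z. z > ?N} (Z 1 \<omega>)) + expectation (\<lambda>\<omega>. (T 1 \<omega>)\<^sup>2) / ?N / e\<^sup>2
    = expectation (\<lambda>\<omega>. 2^m * indicator {z. z > 2^m} (Z 1 \<omega>) + (min (Z 1 \<omega>) (2^m))\<^sup>2 / 2^m / e\<^sup>2)"
  proof -
    have i1: "integrable M (\<lambda>\<omega>. ?N * indicator {z. z > ?N} (Z 1 \<omega>))"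
    proof (rule integrable_const_bound[where B="?N"])
      have [measurable]: "random_variable borel (Z 1)" by (rule rv) simp
      show "random_variable borel (\<lambda>\<omega>. ?N * indicator {z. z > ?N} (Z 1 \<omega>))" by measurable
    qed (auto simp: indicator_def)
    have i2: "integrable M (\<lambda>\<omega>. (T 1 \<omega>)\<^sup>2 / ?N / e\<^sup>2)" using T_int by auto
    show ?thesis using Bochner_Integration.integral_add[OF i1 i2] by (simp add: T_def)
  qed
  finally show ?thesis by simp
qed

text \<open>Borel-Cantelli gives the bound along \<open>n = 2^m\<close>. Partial sums of nonnegative
  terms are monotone, so any other \<open>n\<close> is bounded by the next power of two, which costs
  the factor 2.\<close>

lemma (in prob_space) iid_average_bound:
  fixes Z :: "nat \<Rightarrow> 'a \<Rightarrow> real"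
  assumes ind: "indep_vars (\<lambda>_. borel) Z {1..}"
    and nonneg: "\<And>k \<omega>. 0 \<le> Z k \<omega>"
    and dist: "\<And>k. k \<ge> 1 \<Longrightarrow> distr M borel (Z k) = distr M borel (Z 1)"
    and int: "integrable M (Z 1)" and e: "e > 0"
  shows "AE \<omega> in M. \<forall>\<^sub>F n in sequentially. (\<Sum>k=1..n. Z k \<omega>) \<le> 2 * (expectation (Z 1) + e) * real n"
proof -
  define A where "A m = {\<omega>\<in>space M. (\<Sum>k=1..2^m. Z k \<omega>) > 2^m * (expectation (Z 1) + e)}" for m
  define f where "f m \<omega> = 2^m * indicator {z. z > 2^m} (Z 1 \<omega>) + (min (Z 1 \<omega>) (2^m))\<^sup>2 / 2^m / e\<^sup>2" for m \<omega>
  have rv[measurable]: "random_variable borel (Z k)" if "k \<ge> 1" for k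
    using ind that by (auto simp: indep_vars_def)
  have Am[measurable]: "A m \<in> sets M" for m unfolding A_def by (measurable; auto)
  have f0: "0 \<le> f m \<omega>" for m \<omega> by (simp add: f_def)
  have fsum: "(\<Sum>m<N. f m \<omega>) \<le> (2 + 4 / e\<^sup>2) * Z 1 \<omega>" for N \<omega>
  proof -
    have "(\<Sum>m<N. f m \<omega>) = (\<Sum>m<N. 2^m * indicator {z. z > 2^m} (Z 1 \<omega>)) + (\<Sum>m<N. (min (Z 1 \<omega>) (2^m))\<^sup>2 / 2^m) / e\<^sup>2"
      by (simp add: f_def sum.distrib sum_divide_distrib)
    also have "\<dots> \<le> 2 * Z 1 \<omega> + 4 * Z 1 \<omega> / e\<^sup>2"
      using dyadic_truncation_sum1[OF nonneg[of 1 \<omega>], of N] dyadic_truncation_sum2[OF nonneg[of 1 \<omega>], of N]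
      by (intro add_mono divide_right_mono) auto
    finally show ?thesis by (simp add: field_simps)
  qed
  have fint: "integrable M (f m)" for m
  proof (rule Bochner_Integration.integrable_bound)
    show "integrable M (\<lambda>\<omega>. (2 + 4 / e\<^sup>2) * Z 1 \<omega>)" using int by simp
    show "random_variable borel (f m)" unfolding f_def by measurable
    have "f m \<omega> \<le> (\<Sum>j<Suc m. f j \<omega>)" for \<omega>
      by (rule member_le_sum) (auto simp: f0)
    then have "f m \<omega> \<le> (2 + 4 / e\<^sup>2) * Z 1 \<omega>" for \<omega>
      by (rule order_trans[OF _ fsum])
    then show "AE \<omega> in M. norm (f m \<omega>) \<le> norm ((2 + 4 / e\<^sup>2) * Z 1 \<omega>)"
      using f0 by (auto intro: order_trans[OF _ abs_ge_self])
  qed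
  have le: "prob (A m) \<le> expectation (f m)" for m
    unfolding A_def f_def using iid_dyadic_sum_tail[OF assms] by simp
  have summ: "summable (\<lambda>m. prob (A m))"
  proof (rule summableI_nonneg_bounded)
    show "(\<Sum>m<N. prob (A m)) \<le> expectation (\<lambda>\<omega>. (2 + 4 / e\<^sup>2) * Z 1 \<omega>)" for N
    proof -
      have "(\<Sum>m<N. prob (A m)) \<le> (\<Sum>m<N. expectation (f m))" by (intro sum_mono le)
      also have "\<dots> = expectation (\<lambda>\<omega>. \<Sum>m<N. f m \<omega>)" using fint by simp
      also have "\<dots> \<le> expectation (\<lambda>\<omega>. (2 + 4 / e\<^sup>2) * Z 1 \<omega>)"
        by (rule integral_mono) (use fint int fsum in auto)
      finally show ?thesis .
    qed
  qed auto
  have "AE \<omega> in M. \<forall>\<^sub>F m in sequentially. \<omega> \<in> space M - A m"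
    by (rule borel_cantelli_AE1) (auto simp: summ emeasure_eq_measure)
  then show ?thesis
  proof (eventually_elim)
    case (elim \<omega>)
    then obtain m0 where m0: "\<And>m. m \<ge> m0 \<Longrightarrow> (\<Sum>k=1..2^m. Z k \<omega>) \<le> 2^m * (expectation (Z 1) + e)"
      by (auto simp: eventually_sequentially A_def not_less)
    have "expectation (Z 1) \<ge> 0" by (rule integral_nonneg_AE) (simp add: nonneg)
    then have pos: "expectation (Z 1) + e \<ge> 0" using e by simp
    show ?case
    proof (rule eventually_sequentiallyI[of "2^m0 + 1"])
      fix n :: nat assume n: "2^m0 + 1 \<le> n"
      then obtain l where lo: "2^l \<le> n" and hi: "n < 2^(l+1)"
        using ex_power_ivl1[of 2 n] by auto
      define m where "m = Suc l"
      have hi: "n < 2^m" using hi by (simp add: m_def)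
      have "(2::nat)^m0 < 2^m" using n hi by linarith
      then have "m \<ge> m0" by simp
      have "(\<Sum>k=1..n. Z k \<omega>) \<le> (\<Sum>k=1..2^m. Z k \<omega>)"
        by (rule sum_mono2) (use hi nonneg in auto)
      also have "\<dots> \<le> 2^m * (expectation (Z 1) + e)" by (rule m0) fact
      also have "\<dots> \<le> 2 * real n * (expectation (Z 1) + e)"
      proof (rule mult_right_mono[OF _ pos])
        have "real (2^m) \<le> real (2 * n)" using lo by (simp only: m_def of_nat_le_iff) simp
        then show "2^m \<le> 2 * real n" by simp
      qed
      finally show "(\<Sum>k=1..n. Z k \<omega>) \<le> 2 * (expectation (Z 1) + e) * real n" by (simp add: mult_ac)
    qed
  qed
qed

text \<open>The expectation is expressed by a reference variable \<open>X\<close>, so that both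
  coefficient families can be measured against \<open>a 1\<close>.\<close>

lemma (in prob_space) iid_average_bound_comp:
  fixes c :: "nat \<Rightarrow> 'a \<Rightarrow> real" and h :: "real \<Rightarrow> real"
  assumes ind: "indep_vars (\<lambda>_. borel) c {1..}"
    and X: "random_variable borel X" and dist: "\<And>k. k \<ge> 1 \<Longrightarrow> distr M borel (c k) = distr M borel X"
    and h: "h \<in> borel_measurable borel" "\<And>x. 0 \<le> h x"
    and int: "integrable M (\<lambda>\<omega>. h (X \<omega>))" and e: "e > 0"
  shows "AE \<omega> in M. \<forall>\<^sub>F n in sequentially. (\<Sum>k=1..n. h (c k \<omega>)) \<le> 2 * (expectation (\<lambda>\<omega>. h (X \<omega>)) + e) * real n"
proof -
  have c: "random_variable borel (c k)" if "k \<ge> 1" for k using ind that by (simp add: indep_vars_def)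
  have c1: "random_variable borel (c 1)" by (rule c) simp
  have d: "distr M borel (\<lambda>\<omega>. h (c k \<omega>)) = distr M borel (\<lambda>\<omega>. h (X \<omega>))" if "k \<ge> 1" for k
    using distr_distr[OF h(1) c[OF that]] distr_distr[OF h(1) X] dist[OF that] by (simp add: comp_def)
  have E: "expectation (\<lambda>\<omega>. h (c 1 \<omega>)) = expectation (\<lambda>\<omega>. h (X \<omega>))"
    using integral_distr[OF c1 h(1)] integral_distr[OF X h(1)] dist[of 1] by simp
  have I: "integrable M (\<lambda>\<omega>. h (c 1 \<omega>))"
    using integrable_distr_eq[OF c1 h(1)] integrable_distr_eq[OF X h(1)] dist[of 1] int by simp
  show ?thesis
    unfolding E[symmetric]
  proof (rule iid_average_bound)
    show "indep_vars (\<lambda>_. borel) (\<lambda>k \<omega>. h (c k \<omega>)) {1..}"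
      by (rule indep_vars_compose2[where Y="\<lambda>_. h", OF ind]) (rule h)
    show "distr M borel (\<lambda>\<omega>. h (c k \<omega>)) = distr M borel (\<lambda>\<omega>. h (c 1 \<omega>))" if "k \<ge> 1" for k
      using d[OF that] d[of 1] by simp
  qed (use I h e in auto)
qed

subsection \<open>Random characteristic functions for bounded coefficients\<close>

lemma exp_diff_le_nonpos:
  fixes a b :: real
  assumes "a \<le> 0" "b \<le> 0"
  shows "\<bar>exp a - exp b\<bar> \<le> \<bar>a - b\<bar>"
proof -
  have *: "exp v - exp u \<le> v - u" if "u \<le> v" "v \<le> 0" for u v :: real
  proof -
    have "exp v - exp u = exp v * (1 - exp (u - v))" by (simp add: right_diff_distrib flip: exp_add)
    also have "\<dots> \<le> 1 * (v - u)"
    proof (rule mult_mono)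
      show "1 - exp (u - v) \<le> v - u" using exp_ge_add_one_self[of "u - v"] by linarith
    qed (use that in auto)
    finally show ?thesis by simp
  qed
  show ?thesis
  proof (cases "a \<le> b")
    case True
    then show ?thesis using *[of a b] assms by auto
  next
    case False
    then show ?thesis using *[of b a] assms by auto
  qed
qed

lemma (in prob_space) char_bounded_approx:
  assumes [measurable]: "random_variable borel c" and B: "\<And>\<omega>. \<bar>c \<omega>\<bar> \<le> B"
    and E: "expectation c = 0" "expectation (\<lambda>\<omega>. (c \<omega>)\<^sup>2) = v" and s: "\<bar>s\<bar> \<le> d"
  shows "cmod (char (distr M borel c) s - exp (- v * s\<^sup>2 / 2)) \<le> (B^3 / 6 + d * v\<^sup>2 / 8) * \<bar>s\<bar>^3"
proof -
  have i1: "integrable M c" by (rule integrable_const_bound[where B=B]) (use B in auto)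
  have i2: "integrable M (\<lambda>\<omega>. (c \<omega>)\<^sup>2)"
    by (rule integrable_const_bound[where B="B\<^sup>2"]) (use power_mono[OF B abs_ge_zero, where n=2] in auto)
  have var: "variance c = v" using E by simp
  have v: "0 \<le> v" using E(2) by (metis (no_types, lifting) Bochner_Integration.integral_nonneg zero_le_power2)
  have "cmod (char (distr M borel c) s - (1 - s\<^sup>2 * v / 2)) \<le>
    (s\<^sup>2 / 6) * expectation (\<lambda>\<omega>. min (6 * (c \<omega>)\<^sup>2) (\<bar>s\<bar> * \<bar>c \<omega>\<bar>^3))"
    by (rule char_approx3') (use i1 i2 E var in auto)
  also have "\<dots> \<le> (s\<^sup>2 / 6) * (\<bar>s\<bar> * B^3)"
  proof (rule mult_left_mono)
    have "expectation (\<lambda>\<omega>. min (6 * (c \<omega>)\<^sup>2) (\<bar>s\<bar> * \<bar>c \<omega>\<bar>^3)) \<le> expectation (\<lambda>\<omega>. \<bar>s\<bar> * B^3)"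
    proof (rule integral_mono)
      show "integrable M (\<lambda>\<omega>. min (6 * (c \<omega>)\<^sup>2) (\<bar>s\<bar> * \<bar>c \<omega>\<bar>^3))"
        by (rule Bochner_Integration.integrable_bound[of M "\<lambda>\<omega>. 6 * (c \<omega>)\<^sup>2"]) (use i2 in \<open>auto simp: min_def\<close>)
      show "min (6 * (c \<omega>)\<^sup>2) (\<bar>s\<bar> * \<bar>c \<omega>\<bar>^3) \<le> \<bar>s\<bar> * B^3" for \<omega>
        using power_mono[OF B[of \<omega>] abs_ge_zero, of 3] by (intro min.coboundedI2 mult_left_mono) auto
    qed auto
    then show "expectation (\<lambda>\<omega>. min (6 * (c \<omega>)\<^sup>2) (\<bar>s\<bar> * \<bar>c \<omega>\<bar>^3)) \<le> \<bar>s\<bar> * B^3"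
      by (simp add: prob_space)
  qed auto
  also have "\<dots> = B^3 / 6 * \<bar>s\<bar>^3" by (simp add: power3_eq_cube power2_eq_square)
  finally have 1: "cmod (char (distr M borel c) s - (1 - s\<^sup>2 * v / 2)) \<le> B^3 / 6 * \<bar>s\<bar>^3" .
  define y where "y = v * s\<^sup>2 / 2"
  have y: "0 \<le> y" using v by (simp add: y_def)
  have "\<bar>exp (- y) - (1 - y)\<bar> \<le> y\<^sup>2 / 2"
  proof -
    have "exp (-y) \<ge> 1 - y" using exp_ge_add_one_self[of "-y"] by simp
    \<comment> \<open>Invert the lower Taylor bound of \<open>exp y\<close>: the product of
      \<open>1 + y + y\<^sup>2 / 2\<close> and \<open>1 - y + y\<^sup>2 / 2\<close> is
      \<open>1 + y^4 / 4\<close>, hence at least 1.\<close>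
    moreover have "exp (-y) \<le> 1 - y + y\<^sup>2 / 2"
    proof -
      have "1 + y + y\<^sup>2 / 2 \<le> exp y" using exp_lower_Taylor_quadratic[OF y] by simp
      then have "(1 + y + y\<^sup>2 / 2) * exp (-y) \<le> 1"
        by (metis exp_ge_zero exp_minus_inverse mult.commute mult_left_mono)
      moreover have "1 \<le> (1 + y + y\<^sup>2/2) * (1 - y + y\<^sup>2/2)"
      proof -
        have "(1 + y + y\<^sup>2/2) * (1 - y + y\<^sup>2/2) = 1 + y^4 / 4"
          by (simp add: field_simps power2_eq_square power4_eq_xxxx)
        then show ?thesis by simp
      qed
      ultimately have "(1 + y + y\<^sup>2 / 2) * exp (-y) \<le> (1 + y + y\<^sup>2/2) * (1 - y + y\<^sup>2/2)" by linarith
      moreover have "0 < 1 + y + y\<^sup>2/2" using y by (simp add: add_pos_nonneg)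
      ultimately show ?thesis by simp
    qed
    ultimately show ?thesis by simp
  qed
  \<comment> \<open>The Gaussian error is quartic in \<open>s\<close>; one factor is traded for
    \<open>d\<close> to match the cubic error of the characteristic function.\<close>
  also have "y\<^sup>2 / 2 = v\<^sup>2 / 8 * (\<bar>s\<bar> * \<bar>s\<bar>^3)"
    by (simp add: y_def power2_eq_square power3_eq_cube)
  also have "\<dots> \<le> v\<^sup>2 / 8 * (d * \<bar>s\<bar>^3)"
    using s by (intro mult_left_mono mult_right_mono) auto
  finally have 2: "\<bar>exp (- y) - (1 - y)\<bar> \<le> d * v\<^sup>2 / 8 * \<bar>s\<bar>^3" by (simp add: mult_ac)
  have "char (distr M borel c) s - exp (- v * s\<^sup>2 / 2) =
     (char (distr M borel c) s - (1 - s\<^sup>2 * v / 2)) - complex_of_real (exp (- y) - (1 - y))"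
    by (simp add: y_def mult.commute)
  then have "cmod (char (distr M borel c) s - exp (- v * s\<^sup>2 / 2)) \<le>
     cmod (char (distr M borel c) s - (1 - s\<^sup>2 * v / 2)) + cmod (complex_of_real (exp (- y) - (1 - y)))"
    by (metis norm_triangle_ineq4)
  also have "\<dots> \<le> B^3 / 6 * \<bar>s\<bar>^3 + d * v\<^sup>2 / 8 * \<bar>s\<bar>^3"
    unfolding norm_of_real using 1 2 by (rule add_mono)
  finally show ?thesis by (simp add: distrib_right)
qed

text \<open>By independence both quantities are products of factors of modulus at most 1, and the
  distance of such products is at most the sum of the distances of the factors.\<close>

lemma (in prob_space) expectation_iexp_sum_approx:
  fixes c :: "'i \<Rightarrow> 'a \<Rightarrow> real" and w :: "'i \<Rightarrow> real"
  assumes I: "finite I" and ind: "indep_vars (\<lambda>_. borel) c I"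
    and approx: "\<And>i s. i \<in> I \<Longrightarrow> \<bar>s\<bar> \<le> d \<Longrightarrow>
      cmod (char (distr M borel (c i)) s - exp (- v * s\<^sup>2 / 2)) \<le> C * \<bar>s\<bar>^3"
    and w: "\<And>i. i \<in> I \<Longrightarrow> \<bar>w i\<bar> \<le> e" and e: "e \<le> d" and C: "0 \<le> C" and v: "0 \<le> v"
  shows "cmod (expectation (\<lambda>\<omega>. iexp (\<Sum>i\<in>I. w i * c i \<omega>)) - exp (- v * (\<Sum>i\<in>I. (w i)\<^sup>2) / 2))
    \<le> real (card I) * (C * e^3)"
proof -
  have rv[measurable]: "random_variable borel (c i)" if "i \<in> I" for i
    using ind that by (auto simp: indep_vars_def)
  have ind': "indep_vars (\<lambda>_. borel) (\<lambda>i \<omega>. w i * c i \<omega>) I"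
    by (rule indep_vars_compose2[where Y="\<lambda>i x. w i * x", OF ind]) auto
  have ch: "char (distr M borel (\<lambda>\<omega>. w i * c i \<omega>)) 1 = char (distr M borel (c i)) (w i)" if "i \<in> I" for i
    using rv[OF that] by (simp add: char_def integral_distr)
  have "expectation (\<lambda>\<omega>. iexp (\<Sum>i\<in>I. w i * c i \<omega>)) = char (distr M borel (\<lambda>\<omega>. \<Sum>i\<in>I. w i * c i \<omega>)) 1"
    unfolding char_def by (subst integral_distr) auto
  also have "\<dots> = (\<Prod>i\<in>I. char (distr M borel (\<lambda>\<omega>. w i * c i \<omega>)) 1)"
    by (rule char_distr_sum[OF ind'])
  also have "\<dots> = (\<Prod>i\<in>I. char (distr M borel (c i)) (w i))"
    by (intro prod.cong refl ch)
  finally have 1: "expectation (\<lambda>\<omega>. iexp (\<Sum>i\<in>I. w i * c i \<omega>)) = (\<Prod>i\<in>I. char (distr M borel (c i)) (w i))" .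
  have 2: "complex_of_real (exp (- v * (\<Sum>i\<in>I. (w i)\<^sup>2) / 2)) = (\<Prod>i\<in>I. complex_of_real (exp (- v * (w i)\<^sup>2 / 2)))"
    by (simp add: sum_distrib_left sum_divide_distrib exp_sum[OF I] flip: of_real_prod)
  have "cmod (expectation (\<lambda>\<omega>. iexp (\<Sum>i\<in>I. w i * c i \<omega>)) - exp (- v * (\<Sum>i\<in>I. (w i)\<^sup>2) / 2))
    \<le> (\<Sum>i\<in>I. cmod (char (distr M borel (c i)) (w i) - complex_of_real (exp (- v * (w i)\<^sup>2 / 2))))"
    unfolding 1 2
  proof (rule norm_prod_diff)
    fix i assume i: "i \<in> I"
    interpret D: real_distribution "distr M borel (c i)"
      using rv[OF i] by (rule real_distribution_distr)
    show "cmod (char (distr M borel (c i)) (w i)) \<le> 1" by (rule D.cmod_char_le_1)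
    show "cmod (complex_of_real (exp (- v * (w i)\<^sup>2 / 2))) \<le> 1" using v by (simp add: mult_nonpos_nonneg)
  qed
  also have "\<dots> \<le> (\<Sum>i\<in>I. C * e^3)"
  proof (rule sum_mono)
    fix i assume i: "i \<in> I"
    have "cmod (char (distr M borel (c i)) (w i) - complex_of_real (exp (- v * (w i)\<^sup>2 / 2))) \<le> C * \<bar>w i\<bar>^3"
      using approx[OF i] w[OF i] e by fastforce
    also have "\<dots> \<le> C * e^3" using w[OF i] C by (intro mult_left_mono power_mono) auto
    finally show "cmod (char (distr M borel (c i)) (w i) - complex_of_real (exp (- v * (w i)\<^sup>2 / 2))) \<le> C * e^3" .
  qed
  finally show ?thesis by simp
qed

lemma (in prob_space) norm_expectation_le:
  fixes f :: "'a \<Rightarrow> 'b::{banach, second_countable_topology}"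
  assumes "\<And>x. norm (f x) \<le> B"
  shows "norm (expectation f) \<le> B"
proof -
  have "0 \<le> B" using assms norm_ge_zero order_trans by blast
  have "norm (expectation f) \<le> expectation (\<lambda>x. norm (f x))" by (rule integral_norm_bound)
  also have "\<dots> \<le> expectation (\<lambda>_. B)"
    by (rule integral_mono') (use assms \<open>0 \<le> B\<close> in auto)
  finally show ?thesis by (simp add: prob_space)
qed

text \<open>The squared modulus of the random characteristic function, minus its limit, is a double
  integral over two independent uniform points $x$, $y$. After Fubini, only the correlation
  $\sum_i w_i(x) w_i(y)$ of the two weight vectors, of mean size $\rho$, obstructs independence.\<close>

lemma (in prob_space) expectation_random_char_square:
  fixes c :: "'i \<Rightarrow> 'a \<Rightarrow> real" and w :: "'i \<Rightarrow> real \<Rightarrow> real"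
  assumes I: "finite I" and ind: "indep_vars (\<lambda>_. borel) c I"
    and approx: "\<And>i s. i \<in> I \<Longrightarrow> \<bar>s\<bar> \<le> d \<Longrightarrow>
      cmod (char (distr M borel (c i)) s - exp (- v * s\<^sup>2 / 2)) \<le> C * \<bar>s\<bar>^3"
    and wm[measurable]: "\<And>i. i \<in> I \<Longrightarrow> w i \<in> borel_measurable borel"
    and w: "\<And>i x. i \<in> I \<Longrightarrow> \<bar>w i x\<bar> \<le> e" and e: "2 * e \<le> d" "0 \<le> e" and C: "0 \<le> C" and v: "0 \<le> v"
    and V: "\<And>x. (\<Sum>i\<in>I. (w i x)\<^sup>2) = V"
    and R: "\<And>x. (LINT y|unifX. \<bar>\<Sum>i\<in>I. w i x * w i y\<bar>) \<le> \<rho>"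
  shows "expectation (\<lambda>\<omega>. (cmod ((LINT x|unifX. iexp (\<Sum>i\<in>I. w i x * c i \<omega>)) - exp (- v * V / 2)))\<^sup>2)
     \<le> 10 * real (card I) * C * e^3 + v * \<rho>"
proof -
  interpret P: pair_sigma_finite M unifX ..
  interpret PP: prob_space "M \<Otimes>\<^sub>M unifX"
    by (rule prob_space_pair) unfold_locales
  define \<gamma> where "\<gamma> = exp (- v * V / 2)"
  have V0: "0 \<le> V" unfolding V[of 0, symmetric] by (simp add: sum_nonneg)
  have \<gamma>: "0 \<le> \<gamma>" "\<gamma> \<le> 1" using v V0 by (auto simp: \<gamma>_def mult_nonpos_nonneg)
  have rv[measurable]: "random_variable borel (c i)" if "i \<in> I" for i
    using ind that by (auto simp: indep_vars_def)
  define S where "S \<omega> x = (\<Sum>i\<in>I. w i x * c i \<omega>)" for \<omega> x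
  have Sm[measurable]: "case_prod S \<in> borel_measurable (M \<Otimes>\<^sub>M unifX)"
    unfolding S_def by measurable
  have Sm1[measurable]: "(\<lambda>\<omega>. S \<omega> x) \<in> borel_measurable M" for x unfolding S_def by measurable
  have Sm2[measurable]: "S \<omega> \<in> borel_measurable borel" for \<omega> unfolding S_def by measurable
  define g where "g \<omega> x = iexp (S \<omega> x) - of_real \<gamma>" for \<omega> x
  have gm[measurable]: "case_prod g \<in> borel_measurable (M \<Otimes>\<^sub>M unifX)" unfolding g_def by measurable
  have gm1[measurable]: "(\<lambda>\<omega>. g \<omega> x) \<in> borel_measurable M" for x unfolding g_def by measurable
  have gm2[measurable]: "g \<omega> \<in> borel_measurable borel" for \<omega> unfolding g_def by measurable
  have gb: "cmod (g \<omega> x) \<le> 2" for \<omega> x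
    using norm_triangle_ineq4[of "iexp (S \<omega> x)" "of_real \<gamma>"] \<gamma> by (simp add: g_def)
  have [measurable]: "cnj \<in> borel_measurable borel"
    by (intro borel_measurable_continuous_onI continuous_intros)
  define h where "h \<omega> = (LINT x|unifX. g \<omega> x)" for \<omega>
  have hm[measurable]: "h \<in> borel_measurable M" unfolding h_def by measurable
  have hb: "cmod (h \<omega>) \<le> 2" for \<omega>
  proof -
    have "cmod (h \<omega>) \<le> (LINT x|unifX. cmod (g \<omega> x))" unfolding h_def by (rule integral_norm_bound)
    also have "\<dots> \<le> (LINT x|unifX. 2)"
      by (rule integral_mono) (auto intro!: integrable_unifX_bounded[where B=2] gb)
    finally show ?thesis by (simp add: unifX.prob_space[simplified])
  qed
  have h_eq: "h \<omega> = (LINT x|unifX. iexp (\<Sum>i\<in>I. w i x * c i \<omega>)) - \<gamma>" for \<omega>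
  proof -
    have "integrable unifX (\<lambda>x. iexp (S \<omega> x))" by (rule integrable_unifX_bounded[where B=1]) auto
    then show ?thesis
      unfolding h_def g_def by (subst Bochner_Integration.integral_diff) (auto simp: S_def unifX.prob_space[simplified])
  qed
  \<comment> \<open>The constant is 10 = 8 + 1 + 1: the weights \<open>w i x - w i y\<close> of the
    joint exponential are bounded by \<open>2 * e\<close>, whose cube yields 8, and the two single
    exponentials yield 1 each.\<close>
  have Eg: "cmod (expectation (\<lambda>\<omega>. g \<omega> x * cnj (g \<omega> y))) \<le> 10 * real (card I) * C * e^3 + v * \<bar>\<Sum>i\<in>I. w i x * w i y\<bar>" for x y
  proof -
    let ?R = "\<Sum>i\<in>I. w i x * w i y"
    have ii: "integrable M (\<lambda>\<omega>. iexp (f \<omega>))" if "f \<in> borel_measurable M" for f :: "'a \<Rightarrow> real"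
      by (rule integrable_const_bound[where B=1]) (use that in auto)
    let ?E = "expectation (\<lambda>\<omega>. iexp (S \<omega> x - S \<omega> y))"
    let ?Ex = "expectation (\<lambda>\<omega>. iexp (S \<omega> x))"
    let ?Ey = "expectation (\<lambda>\<omega>. iexp (- S \<omega> y))"
    let ?X = "exp (- v * (2 * V - 2 * ?R) / 2)"
    have "g \<omega> x * cnj (g \<omega> y) = iexp (S \<omega> x - S \<omega> y) - \<gamma> * iexp (S \<omega> x) - \<gamma> * iexp (- S \<omega> y) + \<gamma>\<^sup>2" for \<omega>
      by (simp add: g_def exp_cnj algebra_simps power2_eq_square flip: exp_add)
    then have "expectation (\<lambda>\<omega>. g \<omega> x * cnj (g \<omega> y)) =
       ?E - \<gamma> * ?Ex
       - \<gamma> * ?Ey + \<gamma>\<^sup>2"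
      by (simp add: ii prob_space del: of_real_minus of_real_diff)
    also have "\<dots> = (?E - ?X)
       + of_real (?X - \<gamma>\<^sup>2)
       - \<gamma> * (?Ex - \<gamma>) - \<gamma> * (?Ey - \<gamma>)"
      by (simp add: algebra_simps power2_eq_square)
    finally have "cmod (expectation (\<lambda>\<omega>. g \<omega> x * cnj (g \<omega> y))) \<le>
       cmod (?E - ?X)
       + cmod (of_real (?X - \<gamma>\<^sup>2))
       + cmod (\<gamma> * (?Ex - \<gamma>)) + cmod (\<gamma> * (?Ey - \<gamma>))"
      by (smt (verit) norm_triangle_ineq norm_triangle_ineq4)
    also have "cmod (?E - ?X) \<le> real (card I) * (C * (2 * e)^3)"
    proof -
      have w2: "\<bar>w i x - w i y\<bar> \<le> 2 * e" if "i \<in> I" for i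
        using w[OF that, of x] w[OF that, of y] by linarith
      have S2: "S \<omega> x - S \<omega> y = (\<Sum>i\<in>I. (w i x - w i y) * c i \<omega>)" for \<omega>
        by (simp add: S_def sum_subtractf left_diff_distrib)
      have V2: "(\<Sum>i\<in>I. (w i x - w i y)\<^sup>2) = 2 * V - 2 * ?R"
        by (simp add: power2_diff sum.distrib sum_subtractf V flip: sum_distrib_left) (simp add: mult.assoc flip: sum_distrib_left)
      show ?thesis
        unfolding S2 V2[symmetric]
        by (rule expectation_iexp_sum_approx[OF I ind approx]) (use w2 e C v in auto)
    qed
    \<comment> \<open>For uncorrelated weights, \<open>?R = 0\<close>, the two exponentials would
      coincide. In general their exponents are nonpositive and differ by \<open>v * ?R\<close>, and
      \<open>exp\<close> is 1-Lipschitz there.\<close>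
    also have "cmod (of_real (?X - \<gamma>\<^sup>2)) \<le> v * \<bar>?R\<bar>"
    proof -
      have g2: "\<gamma>\<^sup>2 = exp (- v * V)" by (simp add: \<gamma>_def power2_eq_square flip: exp_add)
      have VR: "0 \<le> V - ?R"
      proof -
        have "0 \<le> (\<Sum>i\<in>I. (w i x - w i y)\<^sup>2)" by (simp add: sum_nonneg)
        also have "\<dots> = 2 * V - 2 * ?R"
          by (simp add: power2_diff sum.distrib sum_subtractf V flip: sum_distrib_left) (simp add: mult.assoc flip: sum_distrib_left)
        finally show ?thesis by simp
      qed
      have "\<bar>exp (- v * (V - ?R)) - exp (- v * V)\<bar> \<le> \<bar>- v * (V - ?R) - - v * V\<bar>"
        by (rule exp_diff_le_nonpos) (use v V0 VR in \<open>auto simp: mult_nonpos_nonneg\<close>)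
      also have "\<dots> = v * \<bar>?R\<bar>" using v by (simp add: algebra_simps abs_mult)
      finally have "\<bar>exp (- v * (V - ?R)) - exp (- v * V)\<bar> \<le> v * \<bar>?R\<bar>" .
      moreover have "- v * (2 * V - 2 * ?R) / 2 = - v * (V - ?R)" by simp
      ultimately show ?thesis unfolding g2 norm_of_real by (simp only:)
    qed
    also have "cmod (\<gamma> * (?Ex - \<gamma>)) \<le> 1 * (real (card I) * (C * e^3))"
      unfolding norm_mult
    proof (rule mult_mono)
      show "cmod (?Ex - \<gamma>) \<le> real (card I) * (C * e^3)"
        unfolding \<gamma>_def S_def V[of x, symmetric]
        by (rule expectation_iexp_sum_approx[OF I ind approx]) (use w e C v in auto)
    qed (use \<gamma> in auto)
    also have "cmod (\<gamma> * (?Ey - \<gamma>)) \<le> 1 * (real (card I) * (C * e^3))"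
      unfolding norm_mult
    proof (rule mult_mono)
      have S2: "- S \<omega> y = (\<Sum>i\<in>I. (- w i y) * c i \<omega>)" for \<omega> by (simp add: S_def sum_negf)
      have V2: "V = (\<Sum>i\<in>I. (- w i y)\<^sup>2)" by (simp add: V)
      show "cmod (?Ey - \<gamma>) \<le> real (card I) * (C * e^3)"
        unfolding \<gamma>_def S2 V2
        by (rule expectation_iexp_sum_approx[OF I ind approx]) (use w e C v in auto)
    qed (use \<gamma> in auto)
    finally show ?thesis by (simp add: power_mult_distrib algebra_simps)
  qed
  have e1: "complex_of_real ((cmod (h \<omega>))\<^sup>2) = (LINT x|unifX. g \<omega> x * cnj (h \<omega>))" for \<omega>
  proof -
    have "complex_of_real ((cmod (h \<omega>))\<^sup>2) = h \<omega> * cnj (h \<omega>)" by (rule complex_norm_square)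
    then show ?thesis unfolding h_def by simp
  qed
  have e2: "g \<omega> x * cnj (h \<omega>) = (LINT y|unifX. g \<omega> x * cnj (g \<omega> y))" for \<omega> x
    unfolding h_def by simp
  have gh: "cmod (g \<omega> x * cnj (h \<omega>)) \<le> 4" for \<omega> x
    using mult_mono[OF gb[of \<omega> x] hb[of \<omega>]] by (simp add: norm_mult)
  have gg: "cmod (g \<omega> x * cnj (g \<omega> y)) \<le> 4" for \<omega> x y
    using mult_mono[OF gb[of \<omega> x] gb[of \<omega> y]] by (simp add: norm_mult)
  have "complex_of_real (expectation (\<lambda>\<omega>. (cmod (h \<omega>))\<^sup>2)) = expectation (\<lambda>\<omega>. (LINT x|unifX. g \<omega> x * cnj (h \<omega>)))"
    unfolding e1[symmetric] by (rule integral_complex_of_real[symmetric])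
  also have "\<dots> = (LINT x|unifX. expectation (\<lambda>\<omega>. g \<omega> x * cnj (h \<omega>)))"
  proof (rule P.Fubini_integral[symmetric])
    show "integrable (M \<Otimes>\<^sub>M unifX) (\<lambda>(\<omega>, x). g \<omega> x * cnj (h \<omega>))"
      by (rule PP.integrable_const_bound[where B=4]) (use gh in auto)
  qed
  also have "\<dots> = (LINT x|unifX. LINT y|unifX. expectation (\<lambda>\<omega>. g \<omega> x * cnj (g \<omega> y)))"
  proof (rule Bochner_Integration.integral_cong)
    fix x
    show "expectation (\<lambda>\<omega>. g \<omega> x * cnj (h \<omega>)) = (LINT y|unifX. expectation (\<lambda>\<omega>. g \<omega> x * cnj (g \<omega> y)))"
      unfolding e2
    proof (rule P.Fubini_integral[symmetric])
      show "integrable (M \<Otimes>\<^sub>M unifX) (\<lambda>(\<omega>, y). g \<omega> x * cnj (g \<omega> y))"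
        by (rule PP.integrable_const_bound[where B=4]) (use gg in auto)
    qed
  qed simp
  finally have "\<bar>expectation (\<lambda>\<omega>. (cmod (h \<omega>))\<^sup>2)\<bar> = cmod (LINT x|unifX. LINT y|unifX. expectation (\<lambda>\<omega>. g \<omega> x * cnj (g \<omega> y)))"
    by (metis norm_of_real)
  then have "expectation (\<lambda>\<omega>. (cmod (h \<omega>))\<^sup>2) \<le> cmod (LINT x|unifX. LINT y|unifX. expectation (\<lambda>\<omega>. g \<omega> x * cnj (g \<omega> y)))"
    by linarith
  also have "\<dots> \<le> (10 * real (card I) * C * e^3 + v * \<rho>)"
  proof (rule unifX.norm_expectation_le)
    fix x
    have Rb: "\<bar>\<Sum>i\<in>I. w i x * w i y\<bar> \<le> real (card I) * e\<^sup>2" for y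
    proof -
      have "\<bar>\<Sum>i\<in>I. w i x * w i y\<bar> \<le> (\<Sum>i\<in>I. \<bar>w i x * w i y\<bar>)" by (rule sum_abs)
      also have "\<dots> \<le> (\<Sum>i\<in>I. e\<^sup>2)"
        unfolding abs_mult power2_eq_square by (intro sum_mono mult_mono) (use w e in auto)
      finally show ?thesis by simp
    qed
    have Ri: "integrable unifX (\<lambda>y. \<bar>\<Sum>i\<in>I. w i x * w i y\<bar>)"
      by (rule integrable_unifX_bounded[where B="real (card I) * e\<^sup>2"]) (use Rb in auto)
    have "cmod (LINT y|unifX. expectation (\<lambda>\<omega>. g \<omega> x * cnj (g \<omega> y))) \<le>
        (LINT y|unifX. cmod (expectation (\<lambda>\<omega>. g \<omega> x * cnj (g \<omega> y))))"
      by (rule integral_norm_bound)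
    also have "\<dots> \<le> (LINT y|unifX. 10 * real (card I) * C * e^3 + v * \<bar>\<Sum>i\<in>I. w i x * w i y\<bar>)"
      by (rule integral_mono') (use Ri Eg e C v in auto)
    also have "\<dots> = 10 * real (card I) * C * e^3 + v * (LINT y|unifX. \<bar>\<Sum>i\<in>I. w i x * w i y\<bar>)"
      using Ri by (simp add: unifX.prob_space[simplified])
    also have "\<dots> \<le> 10 * real (card I) * C * e^3 + v * \<rho>"
      using R[of x] v by (intro add_left_mono mult_left_mono) auto
    finally show "cmod (LINT y|unifX. expectation (\<lambda>\<omega>. g \<omega> x * cnj (g \<omega> y))) \<le> 10 * real (card I) * C * e^3 + v * \<rho>" .
  qed
  finally show ?thesis unfolding h_eq \<gamma>_def .
qed

section \<open>Mean square rate for sampled weights\<close>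

abbreviation samp :: "(real \<Rightarrow> complex) \<Rightarrow> nat \<Rightarrow> nat \<Rightarrow> complex" where
  "samp q n k \<equiv> q (real k / real n) / complex_of_real (sqrt (real n))"

lemma sum_Inl_Inr:
  assumes "finite A"
  shows "(\<Sum>i\<in>Inl ` A \<union> Inr ` A. f i) = (\<Sum>k\<in>A. f (Inl k) + f (Inr k))"
  using assms by (subst sum.union_disjoint) (auto simp: sum.reindex inj_on_def sum.distrib)

text \<open>The sum over \<open>m\<close> has finite expectation, so it is almost surely finite and
  its terms vanish.\<close>

lemma (in prob_space) AE_tendsto_0_if_summable:
  fixes f :: "nat \<Rightarrow> 'a \<Rightarrow> real"
  assumes int: "\<And>m. integrable M (f m)" and nonneg: "\<And>m \<omega>. 0 \<le> f m \<omega>"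
    and summ: "summable (\<lambda>m. expectation (f m))"
  shows "AE \<omega> in M. (\<lambda>m. f m \<omega>) \<longlonglongrightarrow> 0"
proof -
  have rv[measurable]: "f m \<in> borel_measurable M" for m using int by auto
  have E0: "0 \<le> expectation (f m)" for m by (simp add: nonneg)
  have "(\<integral>\<^sup>+\<omega>. (\<Sum>m. ennreal (f m \<omega>)) \<partial>M) = (\<Sum>m. \<integral>\<^sup>+\<omega>. ennreal (f m \<omega>) \<partial>M)"
    by (rule nn_integral_suminf) measurable
  also have "\<dots> = (\<Sum>m. ennreal (expectation (f m)))"
    by (simp add: nn_integral_eq_integral[OF int] nonneg)
  also have "\<dots> = ennreal (\<Sum>m. expectation (f m))"
    using summ E0 by (intro suminf_ennreal2) auto
  finally have "(\<integral>\<^sup>+\<omega>. (\<Sum>m. ennreal (f m \<omega>)) \<partial>M) \<noteq> \<infinity>" by simp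
  then have "AE \<omega> in M. (\<Sum>m. ennreal (f m \<omega>)) \<noteq> \<infinity>"
    by (intro nn_integral_PInf_AE) measurable
  then show ?thesis
  proof eventually_elim
    case (elim \<omega>)
    then have "summable (\<lambda>m. f m \<omega>)"
      by (intro summable_suminf_not_top nonneg) (auto simp: top_ennreal_def)
    then show ?case by (rule summable_LIMSEQ_zero)
  qed
qed

text \<open>The square root in \<open>samp\<close> turns the sum of squared weights into a Riemann
  sum and bounds each weight by \<open>D / sqrt n\<close>. The \<open>2 n\<close> cubic errors then
  add up to order \<open>n^(-1/2)\<close>, and the mean correlation has the same order.\<close>

lemma (in prob_space) trig_char_square_rate:
  fixes \<alpha> \<beta> :: "nat \<Rightarrow> 'a \<Rightarrow> real" and q :: "real \<Rightarrow> complex"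
  assumes ind: "indep_vars (\<lambda>_. borel) (\<lambda>i. case i of Inl k \<Rightarrow> \<alpha> k | Inr k \<Rightarrow> \<beta> k) (Inl ` {1..} \<union> Inr ` {1..})"
    and bd: "\<And>k \<omega>. k \<ge> 1 \<Longrightarrow> \<bar>\<alpha> k \<omega>\<bar> \<le> B" "\<And>k \<omega>. k \<ge> 1 \<Longrightarrow> \<bar>\<beta> k \<omega>\<bar> \<le> B"
    and mean: "\<And>k. k \<ge> 1 \<Longrightarrow> expectation (\<alpha> k) = 0" "\<And>k. k \<ge> 1 \<Longrightarrow> expectation (\<beta> k) = 0"
    and var: "\<And>k. k \<ge> 1 \<Longrightarrow> expectation (\<lambda>\<omega>. (\<alpha> k \<omega>)\<^sup>2) = v" "\<And>k. k \<ge> 1 \<Longrightarrow> expectation (\<lambda>\<omega>. (\<beta> k \<omega>)\<^sup>2) = v"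
    and q: "\<And>u. u \<in> {0..1} \<Longrightarrow> cmod (q u) \<le> D" and n: "n \<ge> 1"
  shows "expectation (\<lambda>\<omega>. (cmod (trig_char (\<lambda>k. Complex (\<alpha> k \<omega>) (- \<beta> k \<omega>) * samp q n k) n
      - exp (- v * ((\<Sum>k=1..n. (cmod (q (real k / real n)))\<^sup>2) / real n) / 2)))\<^sup>2)
    \<le> (20 * (B^3 / 6 + 2 * D * v\<^sup>2 / 8) * D^3 + v * D\<^sup>2) / sqrt (real n)"
proof -
  define c where "c i = (case i of Inl k \<Rightarrow> \<alpha> k | Inr k \<Rightarrow> \<beta> k)" for i :: "nat + nat"
  define I where "I = Inl ` {1..n} \<union> Inr ` {1..n}"
  define r where "r k = samp q n k" for k :: nat
  define w where "w i x = (case i of Inl k \<Rightarrow> Re (r k * cis (real k * x)) | Inr k \<Rightarrow> Im (r k * cis (real k * x)))" for i :: "nat + nat" and x :: real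
  \<comment> \<open>The constant of \<open>char_bounded_approx\<close> for \<open>d = 2 * D\<close>,
    since differences of two weights may reach \<open>2 * e \<le> 2 * D\<close>.\<close>
  define C where "C = B^3 / 6 + 2 * D * v\<^sup>2 / 8"
  define e where "e = D / sqrt (real n)"
  have D0: "0 \<le> D" using order_trans[OF norm_ge_zero q[of 0]] by simp
  have B0: "0 \<le> B" using bd(1)[of 1 undefined] by simp
  have v0: "0 \<le> v" using var(1)[of 1] by (metis (no_types, lifting) Bochner_Integration.integral_nonneg zero_le_power2 order_refl)
  have C0: "0 \<le> C" using B0 D0 by (simp add: C_def)
  have sn: "1 \<le> sqrt (real n)" using n by simp
  have e0: "0 \<le> e" "2 * e \<le> 2 * D"
    using D0 sn by (auto simp: e_def divide_le_eq mult_le_cancel_left1)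
  have rb: "cmod (r k) \<le> e" if "k \<in> {1..n}" for k
    using q[of "real k / real n"] that n by (auto simp: r_def e_def norm_divide intro!: divide_right_mono)
  have fin: "finite I" and sub: "I \<subseteq> Inl ` {1..} \<union> Inr ` {1..}" by (auto simp: I_def)
  have ind': "indep_vars (\<lambda>_. borel) c I"
    using indep_vars_subset[OF ind sub] unfolding c_def .
  have card: "card I = 2 * n"
    unfolding I_def by (subst card_Un_disjoint) (auto simp: card_image inj_on_def)
  have cprops: "random_variable borel (c i)" "\<bar>c i \<omega>\<bar> \<le> B" "expectation (c i) = 0" "expectation (\<lambda>\<omega>. (c i \<omega>)\<^sup>2) = v"
    if "i \<in> I" for i \<omega>
  proof -
    show "random_variable borel (c i)" using ind' that by (auto simp: indep_vars_def)
  qed (use that bd mean var in \<open>auto simp: I_def c_def\<close>)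
  have wle: "\<bar>w i x\<bar> \<le> e" if i: "i \<in> I" for i x
  proof -
    obtain k where k: "k \<in> {1..n}" "i = Inl k \<or> i = Inr k" using i by (auto simp: I_def)
    have "\<bar>w i x\<bar> \<le> cmod (r k * cis (real k * x))"
      using k(2) abs_Re_le_cmod[of "r k * cis (real k * x)"] abs_Im_le_cmod[of "r k * cis (real k * x)"] by (auto simp: w_def simp del: times_complex.simps)
    also have "\<dots> \<le> e" using rb[OF k(1)] by (simp add: norm_mult)
    finally show ?thesis .
  qed
  have wm: "w i \<in> borel_measurable borel" if "i \<in> I" for i
    using that unfolding I_def w_def by (auto simp del: times_complex.simps)
  \<comment> \<open>The weights of \<open>\<alpha> k\<close> and \<open>\<beta> k\<close> are the
    real and imaginary parts of one complex number of modulus \<open>cmod (r k)\<close>. The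
    variance is thus the same at every \<open>x\<close>, and so is the Gaussian limit.\<close>
  have V: "(\<Sum>i\<in>I. (w i x)\<^sup>2) = (\<Sum>k=1..n. (cmod (r k))\<^sup>2)" for x
    unfolding I_def sum_Inl_Inr[OF finite_atLeastAtMost] by (simp add: w_def flip: cmod_power2 times_complex.sel) (simp add: norm_mult)
  have Vq: "(\<Sum>k=1..n. (cmod (r k))\<^sup>2) = (\<Sum>k=1..n. (cmod (q (real k / real n)))\<^sup>2) / n"
    using n by (simp add: r_def norm_divide power_divide sum_divide_distrib)
  \<comment> \<open>As a function of \<open>y\<close> the correlation is again a trigonometric sum,
    now with coefficients of order \<open>1 / n\<close>, so Parseval bounds its mean absolute
    value.\<close>
  have R: "(\<Sum>i\<in>I. w i x * w i y) = trig (\<lambda>k. (cmod (r k))\<^sup>2 * cis (- (real k * x))) n y" for x y :: real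
  proof -
    have "Re (r k * cis (real k * x)) * Re (r k * cis (real k * y)) + Im (r k * cis (real k * x)) * Im (r k * cis (real k * y))
       = Re ((cmod (r k))\<^sup>2 * cis (- (real k * x)) * cis (real k * y))" for k
    proof -
      have "Re s * Re t + Im s * Im t = Re (cnj s * t)" for s t by simp
      then have "Re (r k * cis (real k * x)) * Re (r k * cis (real k * y)) + Im (r k * cis (real k * x)) * Im (r k * cis (real k * y))
        = Re ((r k * cnj (r k)) * cis (- (real k * x)) * cis (real k * y))"
        by (simp only: complex_cnj_mult cis_cnj mult_ac)
      then show ?thesis by (simp only: complex_norm_square)
    qed
    then show ?thesis unfolding I_def sum_Inl_Inr[OF finite_atLeastAtMost] trig_def w_def sum.case by (intro sum.cong refl) simp
  qed
  have \<rho>: "(LINT y|unifX. \<bar>\<Sum>i\<in>I. w i x * w i y\<bar>) \<le> D\<^sup>2 / sqrt (real n)" for x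
  proof -
    let ?z = "\<lambda>k. (cmod (r k))\<^sup>2 * cis (- (real k * x))"
    have "(LINT y|unifX. \<bar>trig ?z n y\<bar>) \<le> sqrt (LINT y|unifX. (trig ?z n y)\<^sup>2)"
    proof (rule unifX.abs_expectation_le_sqrt)
      show "integrable unifX (\<lambda>y. (trig ?z n y)\<^sup>2)"
        by (rule integrable_unifX_bounded[where B="(\<Sum>k=1..n. cmod (?z k))\<^sup>2"])
          (use power_mono[OF trig_bound abs_ge_zero, of ?z n _ 2] in auto)
    qed simp
    also have "\<dots> = sqrt ((\<Sum>k=1..n. (cmod (r k))^4) / 2)"
      by (simp add: integral_trig_square norm_mult norm_power flip: power_mult)
    also have "\<dots> \<le> sqrt ((\<Sum>k=1..n. e^4) / 1)"
      by (intro real_sqrt_le_mono frac_le sum_mono power_mono rb sum_nonneg) auto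
    also have "\<dots> = sqrt (real n) * e\<^sup>2"
      by (simp add: real_sqrt_mult) (metis abs_power2 power_mult_numeral num_double numeral_times_numeral power2_eq_square power4_eq_xxxx power_even_eq real_sqrt_abs)
    also have "\<dots> = D\<^sup>2 / sqrt (real n)"
      using n by (simp add: e_def power2_eq_square field_simps)
    finally show ?thesis unfolding R .
  qed
  have S: "trig (\<lambda>k. Complex (\<alpha> k \<omega>) (- \<beta> k \<omega>) * samp q n k) n x = (\<Sum>i\<in>I. w i x * c i \<omega>)" for \<omega> x
  proof -
    have "Re (Complex s (- t) * p * u) = Re (p * u) * s + Im (p * u) * t" for s t p u
      by (simp add: algebra_simps)
    then show ?thesis
      unfolding I_def sum_Inl_Inr[OF finite_atLeastAtMost] trig_def w_def c_def r_def sum.case by (intro sum.cong refl) (simp only:)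
  qed
  have "expectation (\<lambda>\<omega>. (cmod ((LINT x|unifX. iexp (\<Sum>i\<in>I. w i x * c i \<omega>)) - exp (- v * (\<Sum>k=1..n. (cmod (r k))\<^sup>2) / 2)))\<^sup>2)
     \<le> 10 * real (card I) * C * e^3 + v * (D\<^sup>2 / sqrt (real n))"
  proof (rule expectation_random_char_square[OF fin ind' _ wm wle _ e0(1) C0 v0 V \<rho>])
    show "cmod (char (distr M borel (c i)) s - exp (- v * s\<^sup>2 / 2)) \<le> C * \<bar>s\<bar>^3" if "i \<in> I" "\<bar>s\<bar> \<le> 2 * D" for i s
      unfolding C_def by (rule char_bounded_approx) (use cprops that in auto)
  qed (use e0 in auto)
  also have "10 * real (card I) * C * e^3 = 20 * C * D^3 / sqrt (real n)"
  proof -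
    have "e^3 = D^3 / (n * sqrt (real n))"
      using n by (simp add: e_def power_divide power3_eq_cube)
    then show ?thesis using n by (simp add: card field_simps)
  qed
  finally show ?thesis
    unfolding trig_char_def S Vq C_def by (simp add: add_divide_distrib)
qed


section \<open>Comparison of trigonometric sums of different lengths\<close>

lemma trig_char_extend:
  assumes "N \<le> n"
  shows "trig_char w N = trig_char (\<lambda>k. if k \<le> N then w k else 0) n"
proof -
  have "trig w N x = trig (\<lambda>k. if k \<le> N then w k else 0) n x" for x
  proof -
    have "trig (\<lambda>k. if k \<le> N then w k else 0) n x = (\<Sum>k=1..N. Re ((if k \<le> N then w k else 0) * cis (real k * x)))"
      unfolding trig_def by (rule sum.mono_neutral_right) (use assms in auto)
    also have "\<dots> = trig w N x" unfolding trig_def by (rule sum.cong) auto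
    finally show ?thesis by simp
  qed
  then show ?thesis unfolding trig_char_def by simp
qed

text \<open>For \<open>k \<le> N\<close> two changes occur: the sample point moves by at most
  \<open>1 - \<theta>\<close>, and the normalisation changes by the relative amount
  \<open>sqrt (1 / \<theta>) - 1\<close>. The terms with \<open>k > N\<close> are new; they form a
  fraction \<open>1 - \<theta>\<close> of all terms and give the last summand.\<close>

lemma trig_char_interpolate:
  fixes q :: "real \<Rightarrow> complex" and z :: "nat \<Rightarrow> complex"
  assumes z: "\<And>k. k \<ge> 1 \<Longrightarrow> cmod (z k) \<le> Z"
    and q: "\<And>u. u \<in> {0..1} \<Longrightarrow> cmod (q u) \<le> D"
    and lip: "\<And>s t. s \<in> {0..1} \<Longrightarrow> t \<in> {0..1} \<Longrightarrow> cmod (q s - q t) \<le> D * \<bar>s - t\<bar>"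
    and N: "1 \<le> N" "N \<le> n"
  defines "\<theta> \<equiv> real N / real n"
  shows "cmod (trig_char (\<lambda>k. z k * samp q n k) n - trig_char (\<lambda>k. z k * samp q N k) N)
    \<le> Z * D * sqrt ((1 - \<theta> + (sqrt (1 / \<theta>) - 1))\<^sup>2 + (1 - \<theta>))"
proof -
  have D0: "0 \<le> D" using order_trans[OF norm_ge_zero q[of 0]] by simp
  have Z0: "0 \<le> Z" using z[of 1] norm_ge_zero[of "z 1"] order_trans by blast
  have \<theta>: "0 < \<theta>" "\<theta> \<le> 1" using N by (auto simp: \<theta>_def)
  define \<delta> where "\<delta> = 1 - \<theta> + (sqrt (1 / \<theta>) - 1)"
  have s\<theta>: "1 \<le> sqrt (1 / \<theta>)" by (rule real_le_rsqrt) (use \<theta> in simp)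
  have \<delta>: "0 \<le> \<delta>" using add_mono[OF \<theta>(2) s\<theta>] by (simp add: \<delta>_def)
  have n0: "0 < real n" "0 < real N" using N by auto
  let ?w = "\<lambda>k. if k \<le> N then z k * samp q N k else 0"
  let ?d = "\<lambda>k. cmod (z k * samp q n k - ?w k)"
  have near: "(?d k)\<^sup>2 \<le> (Z * D)\<^sup>2 * \<delta>\<^sup>2 / n" if k: "k \<in> {1..N}" for k
  proof -
    have u: "real k / real n \<in> {0..1}" "real k / real N \<in> {0..1}" using k N by auto
    have "cmod (samp q n k - samp q N k)
      = cmod ((q (real k / real n) - q (real k / real N)) / sqrt (real n) - q (real k / real N) * of_real (1 / sqrt (real N) - 1 / sqrt (real n)))"
      by (simp add: diff_divide_distrib right_diff_distrib)
    also have "\<dots> \<le> cmod ((q (real k / real n) - q (real k / real N)) / sqrt (real n)) + cmod (q (real k / real N) * of_real (1 / sqrt (real N) - 1 / sqrt (real n)))"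
      by (rule norm_triangle_ineq4)
    also have "cmod ((q (real k / real n) - q (real k / real N)) / sqrt (real n)) \<le> D * (1 - \<theta>) / sqrt (real n)"
    proof -
      have "cmod (q (real k / real n) - q (real k / real N)) \<le> D * \<bar>real k / real n - real k / real N\<bar>" by (rule lip[OF u])
      also have "\<bar>real k / real n - real k / real N\<bar> = (real k / real N) * (1 - \<theta>)"
      proof -
        have "real k / real n - real k / real N = - ((real k / real N) * (1 - \<theta>))" using n0 by (simp add: \<theta>_def field_simps)
        moreover have "0 \<le> (real k / real N) * (1 - \<theta>)" using \<theta> by simp
        ultimately show ?thesis by (simp only: abs_minus_cancel abs_of_nonneg)
      qed
      also have "D * ((real k / real N) * (1 - \<theta>)) \<le> D * (1 * (1 - \<theta>))"
        using u(2) \<theta> D0 by (intro mult_left_mono mult_right_mono) auto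
      finally show ?thesis by (simp add: norm_divide divide_right_mono)
    qed
    also have "cmod (q (real k / real N) * of_real (1 / sqrt (real N) - 1 / sqrt (real n))) \<le> D * ((sqrt (1 / \<theta>) - 1) / sqrt (real n))"
    proof -
      have "1 / sqrt (real N) - 1 / sqrt (real n) = (sqrt (1 / \<theta>) - 1) / sqrt (real n)"
        using n0 by (simp add: \<theta>_def real_sqrt_divide field_simps)
      moreover have "0 \<le> (sqrt (1 / \<theta>) - 1) / sqrt (real n)" using s\<theta> by simp
      ultimately show ?thesis using q[OF u(2)] by (simp only: norm_mult norm_of_real abs_of_nonneg mult_right_mono)
    qed
    finally have *: "cmod (samp q n k - samp q N k) \<le> D * \<delta> / sqrt (real n)"
      by (simp add: \<delta>_def field_simps add_divide_distrib diff_divide_distrib)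
    have "z k * samp q n k - ?w k = z k * (samp q n k - samp q N k)"
      using k by (simp add: right_diff_distrib)
    then have "?d k = cmod (z k) * cmod (samp q n k - samp q N k)"
      by (simp only: norm_mult)
    also have "\<dots> \<le> Z * (D * \<delta> / sqrt (real n))"
      using k z * Z0 by (intro mult_mono) auto
    finally have "(?d k)\<^sup>2 \<le> (Z * (D * \<delta> / sqrt (real n)))\<^sup>2"
      by (rule power_mono) simp
    then show ?thesis by (simp add: power_mult_distrib power_divide mult_ac)
  qed
  have far: "(?d k)\<^sup>2 \<le> (Z * D)\<^sup>2 / n" if k: "k \<in> {N<..n}" for k
  proof -
    have "?d k = cmod (z k) * cmod (q (real k / real n)) / sqrt (real n)"
      using k by (simp add: norm_mult norm_divide)
    also have "\<dots> \<le> Z * D / sqrt (real n)"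
      using k z q[of "real k / real n"] Z0 by (intro divide_right_mono mult_mono) auto
    finally have "(?d k)\<^sup>2 \<le> (Z * D / sqrt (real n))\<^sup>2"
      by (rule power_mono) simp
    then show ?thesis by (simp add: power_divide)
  qed
  have "{1..n} = {1..N} \<union> {N<..n}" using N by auto
  then have "(\<Sum>k=1..n. (?d k)\<^sup>2)
    = (\<Sum>k\<in>{1..N}. (?d k)\<^sup>2) + (\<Sum>k\<in>{N<..n}. (?d k)\<^sup>2)"
    by (simp only:) (rule sum.union_disjoint, auto)
  also have "\<dots> \<le> (\<Sum>k\<in>{1..N}. (Z * D)\<^sup>2 * \<delta>\<^sup>2 / n) + (\<Sum>k\<in>{N<..n}. (Z * D)\<^sup>2 / n)"
    by (intro add_mono sum_mono near far)
  also have "\<dots> = (Z * D)\<^sup>2 * (\<theta> * \<delta>\<^sup>2 + (1 - \<theta>))"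
    using N n0 by (simp add: \<theta>_def field_simps of_nat_diff)
  also have "\<dots> \<le> (Z * D)\<^sup>2 * (\<delta>\<^sup>2 + (1 - \<theta>))"
    using \<theta> by (intro mult_left_mono add_right_mono) (auto intro: mult_left_le_one_le)
  finally have sum: "(\<Sum>k=1..n. (?d k)\<^sup>2) \<le> (Z * D)\<^sup>2 * (\<delta>\<^sup>2 + (1 - \<theta>))" .
  have "cmod (trig_char (\<lambda>k. z k * samp q n k) n - trig_char ?w n)
     \<le> sqrt ((\<Sum>k=1..n. (?d k)\<^sup>2) / 2)"
    by (rule trig_char_diff)
  also have "\<dots> \<le> sqrt ((Z * D)\<^sup>2 * (\<delta>\<^sup>2 + (1 - \<theta>)))"
  proof (rule real_sqrt_le_mono)
    have "0 \<le> (\<Sum>k=1..n. (?d k)\<^sup>2)" by (simp add: sum_nonneg)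
    then show "(\<Sum>k=1..n. (?d k)\<^sup>2) / 2 \<le> (Z * D)\<^sup>2 * (\<delta>\<^sup>2 + (1 - \<theta>))"
      using sum by linarith
  qed
  also have "\<dots> = Z * D * sqrt (\<delta>\<^sup>2 + (1 - \<theta>))"
    using Z0 D0 by (simp add: real_sqrt_mult)
  finally show ?thesis
    unfolding \<delta>_def trig_char_extend[OF N(2)] .
qed

text \<open>The mean square rate $n^{-1/2}$ is summable along $n = m^4$, while consecutive fourth powers
  have ratio tending to one, so that the interpolation error vanishes.\<close>

definition root4 :: "nat \<Rightarrow> nat" where
  "root4 n = nat \<lfloor>real n powr (1/4)\<rfloor>"

lemma root4_le: "root4 n ^ 4 \<le> n"
proof -
  have "real (root4 n) \<le> real n powr (1/4)" by (simp add: root4_def)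
  then have "real (root4 n) ^ 4 \<le> (real n powr (1/4)) ^ 4" by (rule power_mono) simp
  also have "\<dots> = real n" by (cases "n = 0") (simp_all add: powr_powr flip: powr_realpow')
  finally show ?thesis by (metis of_nat_le_iff of_nat_power)
qed

lemma root4_at_top: "filterlim root4 sequentially sequentially"
proof -
  have "filterlim (\<lambda>n. nat \<lfloor>real n powr (1/4)\<rfloor>) sequentially sequentially"
    by (rule filterlim_compose[OF filterlim_nat_sequentially filterlim_compose[OF filterlim_floor_sequentially]]) real_asymp
  then show ?thesis unfolding root4_def .
qed

lemma root4_ratio: "(\<lambda>n. real (root4 n ^ 4) / real n) \<longlonglongrightarrow> 1"
proof -
  have "(\<lambda>n. (real_of_int \<lfloor>real n powr (1/4)\<rfloor>) ^ 4 / real n) \<longlonglongrightarrow> 1" by real_asymp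
  then show ?thesis by (simp add: root4_def)
qed

subsection \<open>The almost sure central limit theorem along a fixed linear form\<close>

lemma (in prob_space) indep_vars_reindex_inj:
  assumes ind: "indep_vars M' X (f ` I)" and inj: "inj_on f I"
  shows "indep_vars (\<lambda>i. M' (f i)) (\<lambda>i. X (f i)) I"
  unfolding indep_vars_def2
proof
  show "\<forall>i\<in>I. random_variable (M' (f i)) (X (f i))"
    using ind unfolding indep_vars_def2 by auto
  define F where "F i = {X i -` A \<inter> space M |A. A \<in> sets (M' i)}" for i
  have F: "indep_sets F (f ` I)"
    using ind unfolding indep_vars_def2 F_def by blast
  have "indep_sets (\<lambda>i. F (f i)) I"
  proof (rule indep_setsI)
    show "F (f i) \<subseteq> events" if "i \<in> I" for i
      using F that unfolding indep_sets_def by blast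
    fix A J assume J: "J \<noteq> {}" "J \<subseteq> I" "finite J" "\<forall>j\<in>J. A j \<in> F (f j)"
    have injJ: "inj_on f J" using inj J(2) inj_on_subset by blast
    define g where "g = the_inv_into J f"
    have g: "g (f j) = j" if "j \<in> J" for j
      using that injJ by (simp add: g_def the_inv_into_f_f)
    have "prob (\<Inter>j\<in>f ` J. A (g j)) = (\<Prod>j\<in>f ` J. prob (A (g j)))"
      by (rule indep_setsD[OF F]) (use J g in auto)
    moreover have "(\<Inter>j\<in>f ` J. A (g j)) = (\<Inter>j\<in>J. A j)" using g by auto
    moreover have "(\<Prod>j\<in>f ` J. prob (A (g j))) = (\<Prod>j\<in>J. prob (A j))"
      unfolding prod.reindex[OF injJ] comp_def by (rule prod.cong) (use g in auto)
    ultimately show "prob (\<Inter>j\<in>J. A j) = (\<Prod>j\<in>J. prob (A j))" by simp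
  qed
  then show "indep_sets (\<lambda>i. {X (f i) -` A \<inter> space M |A. A \<in> sets (M' (f i))}) I"
    unfolding F_def .
qed

lemma (in prob_space) indep_vars_case_sumD:
  fixes a b :: "nat \<Rightarrow> 'a \<Rightarrow> real"
  assumes ind: "indep_vars (\<lambda>_. borel) (\<lambda>i. case i of Inl k \<Rightarrow> a k | Inr k \<Rightarrow> b k) (Inl ` {1..} \<union> Inr ` {1..})"
  shows "indep_vars (\<lambda>_. borel) a {1..}" "indep_vars (\<lambda>_. borel) b {1..}"
    and "k \<ge> 1 \<Longrightarrow> random_variable borel (a k)" "k \<ge> 1 \<Longrightarrow> random_variable borel (b k)"
proof -
  show a: "indep_vars (\<lambda>_. borel) a {1..}"
    using indep_vars_reindex_inj[where f=Inl and I="{1..}", OF indep_vars_subset[OF ind]] by simp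
  show b: "indep_vars (\<lambda>_. borel) b {1..}"
    using indep_vars_reindex_inj[where f=Inr and I="{1..}", OF indep_vars_subset[OF ind]] by simp
  show "k \<ge> 1 \<Longrightarrow> random_variable borel (a k)" "k \<ge> 1 \<Longrightarrow> random_variable borel (b k)"
    using a b by (simp_all add: indep_vars_def)
qed

lemma (in prob_space) measurable_trig_char [measurable]:
  assumes [measurable]: "\<And>k. k \<in> {1..n} \<Longrightarrow> z k \<in> borel_measurable M"
  shows "(\<lambda>\<omega>. trig_char (\<lambda>k. z k \<omega>) n) \<in> borel_measurable M"
proof -
  have "(\<lambda>(\<omega>, x). trig (\<lambda>k. z k \<omega>) n x) \<in> borel_measurable (M \<Otimes>\<^sub>M unifX)"
    unfolding trig_def case_prod_beta by measurable
  then have "(\<lambda>(\<omega>, x). iexp (trig (\<lambda>k. z k \<omega>) n x)) \<in> borel_measurable (M \<Otimes>\<^sub>M unifX)"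
    by measurable
  then show ?thesis unfolding trig_char_def by measurable
qed

lemma cmod_trig_char_le: "cmod (trig_char z n) \<le> 1"
  unfolding trig_char_def by (rule unifX.norm_expectation_le) simp

lemma (in prob_space) bounded_trig_char_tendsto:
  fixes \<alpha> \<beta> :: "nat \<Rightarrow> 'a \<Rightarrow> real" and q :: "real \<Rightarrow> complex"
  assumes ind: "indep_vars (\<lambda>_. borel) (\<lambda>i. case i of Inl k \<Rightarrow> \<alpha> k | Inr k \<Rightarrow> \<beta> k) (Inl ` {1..} \<union> Inr ` {1..})"
    and bd: "\<And>k \<omega>. k \<ge> 1 \<Longrightarrow> \<bar>\<alpha> k \<omega>\<bar> \<le> B" "\<And>k \<omega>. k \<ge> 1 \<Longrightarrow> \<bar>\<beta> k \<omega>\<bar> \<le> B"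
    and mean: "\<And>k. k \<ge> 1 \<Longrightarrow> expectation (\<alpha> k) = 0" "\<And>k. k \<ge> 1 \<Longrightarrow> expectation (\<beta> k) = 0"
    and var: "\<And>k. k \<ge> 1 \<Longrightarrow> expectation (\<lambda>\<omega>. (\<alpha> k \<omega>)\<^sup>2) = v" "\<And>k. k \<ge> 1 \<Longrightarrow> expectation (\<lambda>\<omega>. (\<beta> k \<omega>)\<^sup>2) = v"
    and q: "\<And>u. u \<in> {0..1} \<Longrightarrow> cmod (q u) \<le> D"
    and lip: "\<And>s t. s \<in> {0..1} \<Longrightarrow> t \<in> {0..1} \<Longrightarrow> cmod (q s - q t) \<le> D * \<bar>s - t\<bar>"
    and Q: "(\<lambda>n. (\<Sum>k=1..n. (cmod (q (real k / real n)))\<^sup>2) / real n) \<longlonglongrightarrow> Q"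
  shows "AE \<omega> in M. (\<lambda>n. trig_char (\<lambda>k. Complex (\<alpha> k \<omega>) (- \<beta> k \<omega>) * samp q n k) n)
    \<longlonglongrightarrow> exp (- v * Q / 2)"
proof -
  define \<phi> where "\<phi> \<omega> n = trig_char (\<lambda>k. Complex (\<alpha> k \<omega>) (- \<beta> k \<omega>) * samp q n k) n" for \<omega> and n :: nat
  define \<gamma> where "\<gamma> n = exp (- v * ((\<Sum>k=1..n. (cmod (q (real k / real n)))\<^sup>2) / real n) / 2)" for n :: nat
  define K where "K = 20 * (B^3 / 6 + 2 * D * v\<^sup>2 / 8) * D^3 + v * D\<^sup>2"
  have \<gamma>: "\<gamma> \<longlonglongrightarrow> exp (- v * Q / 2)"
    unfolding \<gamma>_def by (intro tendsto_intros Q) simp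
  have v0: "0 \<le> v" using var(1)[of 1] by (metis (no_types, lifting) Bochner_Integration.integral_nonneg zero_le_power2 order_refl)
  have \<gamma>b: "0 \<le> \<gamma> n" "\<gamma> n \<le> 1" for n
    using v0 by (auto simp: \<gamma>_def sum_nonneg mult_nonpos_nonneg)
  note rv = indep_vars_case_sumD(3,4)[OF ind]
  have \<phi>m[measurable]: "(\<lambda>\<omega>. \<phi> \<omega> n) \<in> borel_measurable M" for n
    unfolding \<phi>_def
  proof (rule measurable_trig_char)
    fix k assume "k \<in> {1..n}"
    then have [measurable]: "random_variable borel (\<alpha> k)" "random_variable borel (\<beta> k)" using rv by auto
    show "(\<lambda>\<omega>. Complex (\<alpha> k \<omega>) (- \<beta> k \<omega>) * samp q n k) \<in> borel_measurable M"
      unfolding Complex_eq by measurable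
  qed
  \<comment> \<open>The index \<open>Suc m\<close> keeps \<open>n \<ge> 1\<close>, as the rate
    requires; along fourth powers the rate becomes \<open>K / (m + 1)^2\<close>.\<close>
  have "AE \<omega> in M. (\<lambda>m. (cmod (\<phi> \<omega> (Suc m ^ 4) - \<gamma> (Suc m ^ 4)))\<^sup>2) \<longlonglongrightarrow> 0"
  proof (rule AE_tendsto_0_if_summable)
    show "integrable M (\<lambda>\<omega>. (cmod (\<phi> \<omega> (Suc m ^ 4) - \<gamma> (Suc m ^ 4)))\<^sup>2)" for m
    proof (rule integrable_const_bound[where B="2\<^sup>2"])
      have "cmod (\<phi> \<omega> n - \<gamma> n) \<le> 2" for \<omega> n
        using norm_triangle_ineq4[of "\<phi> \<omega> n" "\<gamma> n"] cmod_trig_char_le \<gamma>b[of n] unfolding \<phi>_def by (smt (verit) norm_of_real)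
      from power_mono[OF this norm_ge_zero]
      show "AE \<omega> in M. norm ((cmod (\<phi> \<omega> (Suc m ^ 4) - \<gamma> (Suc m ^ 4)))\<^sup>2) \<le> 2\<^sup>2"
        by (intro AE_I2) (simp only: real_norm_def abs_power2)
    qed measurable
    show "summable (\<lambda>m. expectation (\<lambda>\<omega>. (cmod (\<phi> \<omega> (Suc m ^ 4) - \<gamma> (Suc m ^ 4)))\<^sup>2))"
    proof (rule summable_comparison_test')
      show "summable (\<lambda>m. K * inverse (real (Suc m) ^ 2))"
        by (intro summable_mult) (use inverse_power_summable[of 2, where 'a=real] in \<open>simp add: summable_Suc_iff[of "\<lambda>m. inverse (real m ^ 2)"] del: of_nat_Suc\<close>)
      fix m :: nat
      have "expectation (\<lambda>\<omega>. (cmod (\<phi> \<omega> (Suc m ^ 4) - \<gamma> (Suc m ^ 4)))\<^sup>2) \<le> K / sqrt (real (Suc m ^ 4))"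
        unfolding \<phi>_def \<gamma>_def K_def
        by (rule trig_char_square_rate[OF ind bd mean var q]) auto
      also have "sqrt (real (Suc m ^ 4)) = real (Suc m) ^ 2"
        by (rule real_sqrt_unique) (simp_all flip: power_mult del: of_nat_Suc)
      finally show "norm (expectation (\<lambda>\<omega>. (cmod (\<phi> \<omega> (Suc m ^ 4) - \<gamma> (Suc m ^ 4)))\<^sup>2)) \<le> K * inverse (real (Suc m) ^ 2)"
        by (simp add: divide_inverse del: of_nat_Suc of_nat_power)
    qed
  qed simp
  then show ?thesis
  proof eventually_elim
    case (elim \<omega>)
    let ?r = "\<lambda>n. root4 n ^ 4"
    have "(\<lambda>m. \<phi> \<omega> (Suc m ^ 4) - \<gamma> (Suc m ^ 4)) \<longlonglongrightarrow> 0"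
      using tendsto_real_sqrt[OF elim] by (simp add: tendsto_norm_zero_iff)
    then have "(\<lambda>m. \<phi> \<omega> (m ^ 4) - \<gamma> (m ^ 4)) \<longlonglongrightarrow> 0"
      by (subst (asm) filterlim_sequentially_Suc)
    from filterlim_compose[OF this root4_at_top]
    have 1: "(\<lambda>n. \<phi> \<omega> (?r n) - \<gamma> (?r n)) \<longlonglongrightarrow> 0" .
    have r4: "filterlim ?r sequentially sequentially"
    proof (rule filterlim_compose[OF _ root4_at_top])
      have "m \<le> m ^ 4" for m :: nat by (cases "m = 0") (auto intro: self_le_power)
      then show "filterlim (\<lambda>m::nat. m ^ 4) sequentially sequentially"
        by (intro filterlim_at_top_mono[OF filterlim_ident] always_eventually) auto
    qed
    have "(\<lambda>n. complex_of_real (\<gamma> (?r n))) \<longlonglongrightarrow> exp (- v * Q / 2)"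
      by (intro tendsto_of_real filterlim_compose[OF \<gamma> r4])
    from tendsto_add[OF 1 this] have 2: "(\<lambda>n. \<phi> \<omega> (?r n)) \<longlonglongrightarrow> exp (- v * Q / 2)" by simp
    define \<eta> where "\<eta> \<theta> = 2 * B * D * sqrt ((1 - \<theta> + (sqrt (1 / \<theta>) - 1))\<^sup>2 + (1 - \<theta>))" for \<theta> :: real
    have ev: "\<forall>\<^sub>F n in sequentially. norm (\<phi> \<omega> n - \<phi> \<omega> (?r n)) \<le> \<eta> (real (?r n) / real n)"
    proof -
      have "\<forall>\<^sub>F n in sequentially. 1 \<le> ?r n"
        using r4 by (simp add: filterlim_at_top)
      then show ?thesis
      proof eventually_elim
        case (elim n)
        show ?case
          unfolding \<phi>_def \<eta>_def
        proof (rule trig_char_interpolate[OF _ q lip elim root4_le])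
          fix k :: nat assume k: "1 \<le> k"
          have "cmod (Complex (\<alpha> k \<omega>) (- \<beta> k \<omega>)) \<le> \<bar>\<alpha> k \<omega>\<bar> + \<bar>- \<beta> k \<omega>\<bar>"
            using cmod_le[of "Complex (\<alpha> k \<omega>) (- \<beta> k \<omega>)"] by simp
          then show "cmod (Complex (\<alpha> k \<omega>) (- \<beta> k \<omega>)) \<le> 2 * B"
            using bd[OF k, of \<omega>] by simp
        qed auto
      qed
    qed
    have "(\<lambda>n. \<eta> (real (?r n) / real n)) \<longlonglongrightarrow> 2 * B * D * sqrt ((1 - 1 + (sqrt (1 / 1) - 1))\<^sup>2 + (1 - 1))"
      unfolding \<eta>_def by (intro tendsto_intros root4_ratio) simp
    then have "(\<lambda>n. \<eta> (real (?r n) / real n)) \<longlonglongrightarrow> 0" by simp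
    from Lim_null_comparison[OF ev this] have "(\<lambda>n. \<phi> \<omega> n - \<phi> \<omega> (?r n)) \<longlonglongrightarrow> 0" .
    from tendsto_add[OF this 2] show ?case unfolding \<phi>_def by simp
  qed
qed

text \<open>For each truncation level \<open>N\<close> the bounded case applies, with variance
  \<open>v N\<close> tending to 1, and the remainder is small in mean square uniformly in large
  \<open>n\<close>. The levels are countable, so one null set serves all of them; then
  \<open>N\<close> is fixed large before \<open>n\<close> grows.\<close>

lemma (in prob_space) trig_char_tendsto:
  fixes a b :: "nat \<Rightarrow> 'a \<Rightarrow> real" and q :: "real \<Rightarrow> complex"
  assumes ind: "indep_vars (\<lambda>_. borel) (\<lambda>i. case i of Inl k \<Rightarrow> a k | Inr k \<Rightarrow> b k) (Inl ` {1..} \<union> Inr ` {1..})"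
    and dist: "\<And>k. k \<ge> 1 \<Longrightarrow> distr M borel (a k) = distr M borel (a 1)"
      "\<And>k. k \<ge> 1 \<Longrightarrow> distr M borel (b k) = distr M borel (a 1)"
    and int2: "integrable M (\<lambda>\<omega>. (a 1 \<omega>)\<^sup>2)"
    and mean: "expectation (a 1) = 0" and var: "expectation (\<lambda>\<omega>. (a 1 \<omega>)\<^sup>2) = 1"
    and q: "\<And>u. u \<in> {0..1} \<Longrightarrow> cmod (q u) \<le> D"
    and lip: "\<And>s t. s \<in> {0..1} \<Longrightarrow> t \<in> {0..1} \<Longrightarrow> cmod (q s - q t) \<le> D * \<bar>s - t\<bar>"
    and Q: "(\<lambda>n. (\<Sum>k=1..n. (cmod (q (real k / real n)))\<^sup>2) / real n) \<longlonglongrightarrow> Q"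
  shows "AE \<omega> in M. (\<lambda>n. trig_char (\<lambda>k. Complex (a k \<omega>) (- b k \<omega>) * samp q n k) n)
    \<longlonglongrightarrow> exp (- Q / 2)"
proof -
  note rv[measurable] = indep_vars_case_sumD(3,4)[OF ind]
  have a1[measurable]: "random_variable borel (a 1)" by (rule rv) simp
  have transfer: "expectation (\<lambda>\<omega>. h (a k \<omega>)) = expectation (\<lambda>\<omega>. h (a 1 \<omega>))"
      "expectation (\<lambda>\<omega>. h (b k \<omega>)) = expectation (\<lambda>\<omega>. h (a 1 \<omega>))"
    if "k \<ge> 1" "h \<in> borel_measurable borel" for k and h :: "real \<Rightarrow> real"
    unfolding integral_distr[OF rv(1)[OF that(1)] that(2), symmetric] integral_distr[OF rv(2)[OF that(1)] that(2), symmetric]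
      integral_distr[OF a1 that(2), symmetric] dist[OF that(1)] by (rule refl)+
  have int1: "integrable M (a 1)" using square_integrable_imp_integrable[OF a1 int2] .
  define \<tau> where "\<tau> N x = (if \<bar>x\<bar> \<le> real N then x else 0)" for N x
  have \<tau>m[measurable]: "\<tau> N \<in> borel_measurable borel" for N unfolding \<tau>_def by measurable
  have \<tau>b: "\<bar>\<tau> N x\<bar> \<le> \<bar>x\<bar>" "\<bar>\<tau> N x\<bar> \<le> N" "\<bar>x - \<tau> N x\<bar> \<le> \<bar>x\<bar>" for N x by (auto simp: \<tau>_def)
  have \<tau>lim: "(\<lambda>N. \<tau> N x) \<longlonglongrightarrow> x" for x
  proof (rule tendsto_eventually)
    obtain N0 :: nat where "\<bar>x\<bar> \<le> N0" using real_arch_simple by blast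
    then show "\<forall>\<^sub>F N in sequentially. \<tau> N x = x"
      by (intro eventually_sequentiallyI[of N0]) (auto simp: \<tau>_def)
  qed
  define m where "m N = expectation (\<lambda>\<omega>. \<tau> N (a 1 \<omega>))" for N
  define K where "K = expectation (\<lambda>\<omega>. \<bar>a 1 \<omega>\<bar>)"
  have \<tau>int: "integrable M (\<lambda>\<omega>. \<tau> N (a 1 \<omega>))" for N
    by (rule integrable_const_bound[where B=N]) (use \<tau>b in auto)
  have mK: "\<bar>m N\<bar> \<le> K" for N
  proof -
    have "\<bar>m N\<bar> \<le> expectation (\<lambda>\<omega>. \<bar>\<tau> N (a 1 \<omega>)\<bar>)" unfolding m_def by (rule integral_abs_bound)
    also have "\<dots> \<le> K" unfolding K_def by (rule integral_mono) (use \<tau>int int1 \<tau>b in auto)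
    finally show ?thesis .
  qed
  have mN: "\<bar>m N\<bar> \<le> N" for N
    using norm_expectation_le[of "\<lambda>\<omega>. \<tau> N (a 1 \<omega>)" N] \<tau>b by (simp add: m_def)
  have mlim: "m \<longlonglongrightarrow> 0"
    unfolding m_def mean[symmetric]
    by (rule integral_dominated_convergence[where w="\<lambda>\<omega>. \<bar>a 1 \<omega>\<bar>"]) (use int1 \<tau>lim \<tau>b in auto)
  \<comment> \<open>Truncation may destroy the zero mean, hence the recentring by
    \<open>m N\<close>.\<close>
  define f where "f N x = \<tau> N x - m N" for N x
  have fm[measurable]: "f N \<in> borel_measurable borel" for N unfolding f_def by measurable
  have flim: "(\<lambda>N. f N x) \<longlonglongrightarrow> x" for x
    unfolding f_def using tendsto_diff[OF \<tau>lim mlim] by simp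
  have fb: "\<bar>f N x\<bar> \<le> 2 * real N" for N x
    unfolding f_def using \<tau>b(2)[of N x] mN[of N] by linarith
  have fK: "\<bar>f N x\<bar> \<le> \<bar>x\<bar> + K" "\<bar>x - f N x\<bar> \<le> \<bar>x\<bar> + K" for N x
    unfolding f_def using \<tau>b(1)[of N x] \<tau>b(3)[of x N] mK[of N] by linarith+
  \<comment> \<open>One integrable majorant, uniform in \<open>N\<close>, for the dominated
    convergence of both \<open>v\<close> and \<open>\<rho>\<close>.\<close>
  have fK2: "(f N x)\<^sup>2 \<le> (\<bar>x\<bar> + K)\<^sup>2" "(x - f N x)\<^sup>2 \<le> (\<bar>x\<bar> + K)\<^sup>2" for N x
    using power_mono[OF fK(1)[of N x] abs_ge_zero, of 2] power_mono[OF fK(2)[of x N] abs_ge_zero, of 2]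
    by (simp_all only: power2_abs)
  define v where "v N = expectation (\<lambda>\<omega>. (f N (a 1 \<omega>))\<^sup>2)" for N
  define \<rho> where "\<rho> N = expectation (\<lambda>\<omega>. (a 1 \<omega> - f N (a 1 \<omega>))\<^sup>2)" for N
  have wint: "integrable M (\<lambda>\<omega>. (\<bar>a 1 \<omega>\<bar> + K)\<^sup>2)"
    unfolding power2_sum using int1 int2 by simp
  have "v \<longlonglongrightarrow> expectation (\<lambda>\<omega>. (a 1 \<omega>)\<^sup>2)"
    unfolding v_def
  proof (rule integral_dominated_convergence[OF _ _ wint])
    show "AE \<omega> in M. norm ((f N (a 1 \<omega>))\<^sup>2) \<le> (\<bar>a 1 \<omega>\<bar> + K)\<^sup>2" for N
      by (intro AE_I2) (simp only: real_norm_def abs_power2 fK2)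
  qed (auto intro!: tendsto_intros flim)
  then have vlim: "v \<longlonglongrightarrow> 1" unfolding var .
  have \<rho>int: "integrable M (\<lambda>\<omega>. (a 1 \<omega> - f N (a 1 \<omega>))\<^sup>2)" for N
    by (rule Bochner_Integration.integrable_bound[OF wint])
      (measurable, intro AE_I2, simp only: real_norm_def abs_power2 fK2)
  have "\<rho> \<longlonglongrightarrow> expectation (\<lambda>\<omega>. 0)"
    unfolding \<rho>_def
  proof (rule integral_dominated_convergence[OF _ _ wint])
    show "AE \<omega> in M. norm ((a 1 \<omega> - f N (a 1 \<omega>))\<^sup>2) \<le> (\<bar>a 1 \<omega>\<bar> + K)\<^sup>2" for N
      by (intro AE_I2) (simp only: real_norm_def abs_power2 fK2)
    have "(\<lambda>N. (x - f N x)\<^sup>2) \<longlonglongrightarrow> 0" for x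
      using tendsto_power[OF tendsto_diff[OF tendsto_const flim], of x x 2] by simp
    then show "AE \<omega> in M. (\<lambda>N. (a 1 \<omega> - f N (a 1 \<omega>))\<^sup>2) \<longlonglongrightarrow> 0" by auto
  qed auto
  then have \<rho>lim: "\<rho> \<longlonglongrightarrow> 0" by simp
  define \<phi> where "\<phi> \<omega> n = trig_char (\<lambda>k. Complex (a k \<omega>) (- b k \<omega>) * samp q n k) n" for \<omega> and n :: nat
  define \<psi> where "\<psi> N \<omega> n = trig_char (\<lambda>k. Complex (f N (a k \<omega>)) (- f N (b k \<omega>)) * samp q n k) n" for N \<omega> and n :: nat
  have AE1: "AE \<omega> in M. \<forall>N. \<psi> N \<omega> \<longlonglongrightarrow> exp (- v N * Q / 2)"
    unfolding AE_all_countable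
  proof
    fix N
    show "AE \<omega> in M. \<psi> N \<omega> \<longlonglongrightarrow> exp (- v N * Q / 2)"
      unfolding \<psi>_def
    proof (rule bounded_trig_char_tendsto[where B="2 * real N" and D=D])
      have "indep_vars (\<lambda>_. borel) (\<lambda>i \<omega>. f N ((case i of Inl k \<Rightarrow> a k | Inr k \<Rightarrow> b k) \<omega>)) (Inl ` {1..} \<union> Inr ` {1..})"
        by (rule indep_vars_compose2[where Y="\<lambda>_. f N", OF ind]) auto
      also have "(\<lambda>i \<omega>. f N ((case i of Inl k \<Rightarrow> a k | Inr k \<Rightarrow> b k) \<omega>))
         = (\<lambda>i. case i of Inl k \<Rightarrow> (\<lambda>\<omega>. f N (a k \<omega>)) | Inr k \<Rightarrow> (\<lambda>\<omega>. f N (b k \<omega>)))"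
        by (auto simp: fun_eq_iff split: sum.split)
      finally show "indep_vars (\<lambda>_. borel) (\<lambda>i. case i of Inl k \<Rightarrow> (\<lambda>\<omega>. f N (a k \<omega>)) | Inr k \<Rightarrow> (\<lambda>\<omega>. f N (b k \<omega>)))
         (Inl ` {1..} \<union> Inr ` {1..})" .
      have f0: "expectation (\<lambda>\<omega>. f N (a 1 \<omega>)) = 0"
        unfolding f_def using \<tau>int by (simp add: m_def prob_space)
      fix k :: nat assume k: "k \<ge> 1"
      show "expectation (\<lambda>\<omega>. f N (a k \<omega>)) = 0" "expectation (\<lambda>\<omega>. f N (b k \<omega>)) = 0"
        using f0 transfer[OF k fm] by simp_all
      show "expectation (\<lambda>\<omega>. (f N (a k \<omega>))\<^sup>2) = v N" "expectation (\<lambda>\<omega>. (f N (b k \<omega>))\<^sup>2) = v N"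
        using transfer[OF k, of "\<lambda>x. (f N x)\<^sup>2"] by (simp_all add: v_def)
    qed (use fb q lip Q in auto)
  qed
  \<comment> \<open>The added \<open>1 / (N + 1)\<close> is the strictly positive slack of the
    averaging bound, chosen to vanish with \<open>N\<close>.\<close>
  let ?e = "\<lambda>N. \<rho> N + 1 / (real N + 1)"
  have AE2: "AE \<omega> in M. \<forall>N. \<forall>\<^sub>F n in sequentially. (\<Sum>k=1..n. (c k \<omega> - f N (c k \<omega>))\<^sup>2) \<le> 2 * ?e N * real n"
    if "indep_vars (\<lambda>_. borel) c {1..}" "\<And>k. k \<ge> 1 \<Longrightarrow> distr M borel (c k) = distr M borel (a 1)" for c
    unfolding AE_all_countable \<rho>_def
    by (intro allI iid_average_bound_comp[where h="\<lambda>x. (x - f _ x)\<^sup>2"] that a1 \<rho>int) auto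
  have AEa: "AE \<omega> in M. \<forall>N. \<forall>\<^sub>F n in sequentially. (\<Sum>k=1..n. (a k \<omega> - f N (a k \<omega>))\<^sup>2) \<le> 2 * ?e N * real n"
    by (rule AE2[OF indep_vars_case_sumD(1)[OF ind] dist(1)])
  have AEb: "AE \<omega> in M. \<forall>N. \<forall>\<^sub>F n in sequentially. (\<Sum>k=1..n. (b k \<omega> - f N (b k \<omega>))\<^sup>2) \<le> 2 * ?e N * real n"
    by (rule AE2[OF indep_vars_case_sumD(2)[OF ind] dist(2)])
  show ?thesis
    using AE1 AEa AEb
  proof eventually_elim
    case (elim \<omega>)
    define \<epsilon> where "\<epsilon> N = sqrt (2 * D\<^sup>2 * ?e N) + \<bar>exp (- v N * Q / 2) - exp (- Q / 2)\<bar>" for N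
    have "(\<lambda>N. 1 / (real N + 1)) \<longlonglongrightarrow> 0" by real_asymp
    then have "\<epsilon> \<longlonglongrightarrow> sqrt (2 * D\<^sup>2 * (0 + 0)) + \<bar>exp (- 1 * Q / 2) - exp (- Q / 2)\<bar>"
      unfolding \<epsilon>_def by (intro tendsto_intros \<rho>lim vlim) auto
    then have \<epsilon>lim: "\<epsilon> \<longlonglongrightarrow> 0" by simp
    have near: "\<forall>\<^sub>F n in sequentially. cmod (\<phi> \<omega> n - \<psi> N \<omega> n) \<le> sqrt (2 * D\<^sup>2 * ?e N)" for N
      using elim(2)[rule_format, of N] elim(3)[rule_format, of N] eventually_gt_at_top[of 0]
    proof eventually_elim
      case (elim n)
      let ?z = "\<lambda>k. Complex (a k \<omega>) (- b k \<omega>) * samp q n k"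
      let ?w = "\<lambda>k. Complex (f N (a k \<omega>)) (- f N (b k \<omega>)) * samp q n k"
      have n: "real n > 0" using elim by simp
      have t: "(cmod (?z k - ?w k))\<^sup>2 \<le> ((a k \<omega> - f N (a k \<omega>))\<^sup>2 + (b k \<omega> - f N (b k \<omega>))\<^sup>2) * (D\<^sup>2 / n)" if k: "k \<in> {1..n}" for k
      proof -
        have "?z k - ?w k = Complex (a k \<omega> - f N (a k \<omega>)) (f N (b k \<omega>) - b k \<omega>) * samp q n k"
        proof -
          have "Complex x y - Complex x' y' = Complex (x - x') (y - y')" for x y x' y' by (simp add: complex_eq_iff)
          moreover have "- y - - y' = y' - y" for y y' :: real by simp
          ultimately show ?thesis by (simp only: left_diff_distrib[symmetric])
        qed
        then have "(cmod (?z k - ?w k))\<^sup>2 = ((a k \<omega> - f N (a k \<omega>))\<^sup>2 + (f N (b k \<omega>) - b k \<omega>)\<^sup>2) * ((cmod (q (real k / real n)))\<^sup>2 / n)"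
          using n by (simp only: norm_mult norm_divide power_mult_distrib power_divide cmod_power2 norm_of_real complex.sel) simp
        also have "\<dots> \<le> ((a k \<omega> - f N (a k \<omega>))\<^sup>2 + (f N (b k \<omega>) - b k \<omega>)\<^sup>2) * (D\<^sup>2 / n)"
          using n k q[of "real k / real n"] by (intro mult_left_mono divide_right_mono power_mono) auto
        finally show ?thesis by (simp only: power2_commute[of "f N (b k \<omega>)"])
      qed
      have "cmod (\<phi> \<omega> n - \<psi> N \<omega> n) \<le> sqrt ((\<Sum>k=1..n. (cmod (?z k - ?w k))\<^sup>2) / 2)"
        unfolding \<phi>_def \<psi>_def by (rule trig_char_diff)
      also have "\<dots> \<le> sqrt (2 * D\<^sup>2 * ?e N)"
      proof (rule real_sqrt_le_mono)
        have "(\<Sum>k=1..n. (cmod (?z k - ?w k))\<^sup>2)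
           \<le> (\<Sum>k=1..n. ((a k \<omega> - f N (a k \<omega>))\<^sup>2 + (b k \<omega> - f N (b k \<omega>))\<^sup>2) * (D\<^sup>2 / n))"
          by (rule sum_mono[OF t])
        also have "\<dots> = ((\<Sum>k=1..n. (a k \<omega> - f N (a k \<omega>))\<^sup>2) + (\<Sum>k=1..n. (b k \<omega> - f N (b k \<omega>))\<^sup>2)) * (D\<^sup>2 / n)"
          by (simp only: sum.distrib flip: sum_distrib_right)
        also have "\<dots> \<le> (2 * ?e N * real n + 2 * ?e N * real n) * (D\<^sup>2 / n)"
          by (rule mult_right_mono[OF add_mono[OF elim(1,2)]]) simp
        also have "\<dots> = 4 * D\<^sup>2 * ?e N"
        proof -
          have "(2 * x * n + 2 * x * n) * (D\<^sup>2 / n) = 4 * D\<^sup>2 * x" for x :: real using n by simp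
          then show ?thesis .
        qed
        finally show "(\<Sum>k=1..n. (cmod (?z k - ?w k))\<^sup>2) / 2 \<le> 2 * D\<^sup>2 * ?e N" by simp
      qed
      finally show ?case .
    qed
    have "\<phi> \<omega> \<longlonglongrightarrow> exp (- Q / 2)"
    proof (rule LIMSEQ_I)
      show "\<exists>no. \<forall>n\<ge>no. cmod (\<phi> \<omega> n - exp (- Q / 2)) < r" if "r > 0" for r
      proof -
        have "\<forall>\<^sub>F N in sequentially. \<epsilon> N < r / 2"
          using order_tendstoD(2)[OF \<epsilon>lim, of "r / 2"] that by simp
        then obtain N where N: "\<epsilon> N < r / 2" by (auto simp: eventually_sequentially)
        have "\<forall>\<^sub>F n in sequentially. dist (\<psi> N \<omega> n) (exp (- v N * Q / 2)) < r / 2"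
          using tendstoD[OF elim(1)[rule_format, of N], of "r / 2"] that by simp
        with near[of N] have "\<forall>\<^sub>F n in sequentially. cmod (\<phi> \<omega> n - exp (- Q / 2)) < r"
        proof eventually_elim
          case (elim n)
          have "\<phi> \<omega> n - exp (- Q / 2) = (\<phi> \<omega> n - \<psi> N \<omega> n) + (\<psi> N \<omega> n - exp (- v N * Q / 2)) + of_real (exp (- v N * Q / 2) - exp (- Q / 2))"
            by simp
          note arg_cong[OF this, of cmod]
          then have "cmod (\<phi> \<omega> n - exp (- Q / 2)) \<le> cmod (\<phi> \<omega> n - \<psi> N \<omega> n) + cmod (\<psi> N \<omega> n - exp (- v N * Q / 2)) + \<bar>exp (- v N * Q / 2) - exp (- Q / 2)\<bar>"
            using norm_triangle_ineq[of "(\<phi> \<omega> n - \<psi> N \<omega> n) + (\<psi> N \<omega> n - exp (- v N * Q / 2))" "of_real (exp (- v N * Q / 2) - exp (- Q / 2))"]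
              norm_triangle_ineq[of "\<phi> \<omega> n - \<psi> N \<omega> n" "\<psi> N \<omega> n - exp (- v N * Q / 2)"]
            unfolding norm_of_real by linarith
          then show ?case using elim N unfolding \<epsilon>_def dist_norm by linarith
        qed
        then show ?thesis by (simp add: eventually_sequentially)
      qed
    qed
    then show ?case unfolding \<phi>_def .
  qed
qed

subsection \<open>Weak convergence on sequence space\<close>

text \<open>Rational coefficients keep the family of linear forms countable, hence a single null set of
  coefficient realisations suffices for all of them.\<close>

definition fin_rat :: "(nat \<Rightarrow> real) set" where
  "fin_rat = {d. (\<forall>j. d j \<in> \<rat>) \<and> (\<exists>N. \<forall>j\<ge>N. d j = 0)}"

lemma countable_fin_rat: "countable fin_rat"
proof -
  define F :: "rat list \<Rightarrow> nat \<Rightarrow> real" where "F xs j = (if j < length xs then of_rat (xs ! j) else 0)" for xs j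
  have "fin_rat \<subseteq> range F"
  proof
    fix d assume "d \<in> fin_rat"
    then obtain N where d: "\<And>j. d j \<in> \<rat>" "\<And>j. j \<ge> N \<Longrightarrow> d j = 0" by (auto simp: fin_rat_def)
    then have "\<forall>j. \<exists>r. d j = of_rat r" by (auto simp: Rats_def)
    then obtain r where r: "\<And>j. d j = of_rat (r j)" by metis
    have "d = F (map r [0..<N])" using d(2) r by (auto simp: F_def fun_eq_iff)
    then show "d \<in> range F" by blast
  qed
  then show ?thesis by (rule countable_subset) auto
qed

text \<open>Summing over the support avoids fixing a cut-off; for \<open>d\<close> in
  \<open>fin_rat\<close> every cut-off beyond the support gives the same value.\<close>

definition lin :: "(nat \<Rightarrow> real) \<Rightarrow> (nat \<Rightarrow> real) \<Rightarrow> real" where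
  "lin d y = (\<Sum>j | d j \<noteq> 0. d j * y j)"

lemma lin_eq:
  assumes "\<And>j. j \<ge> N \<Longrightarrow> d j = 0"
  shows "lin d y = (\<Sum>j<N. d j * y j)"
  unfolding lin_def by (rule sum.mono_neutral_left) (use assms not_less in auto)

lemma fin_rat_lin:
  assumes "d \<in> fin_rat"
  shows "\<exists>N. \<forall>y. lin d y = (\<Sum>j<N. d j * y j)"
proof -
  obtain N where "\<And>j. j \<ge> N \<Longrightarrow> d j = 0" using assms unfolding fin_rat_def by blast
  then show ?thesis using lin_eq by blast
qed

lemma lin_add:
  assumes "d \<in> fin_rat" "e \<in> fin_rat" "s \<in> \<rat>"
  shows "(\<lambda>j. d j + s * e j) \<in> fin_rat" "lin (\<lambda>j. d j + s * e j) y = lin d y + s * lin e y"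
proof -
  obtain N1 N2 where N: "\<And>j. j \<ge> N1 \<Longrightarrow> d j = 0" "\<And>j. j \<ge> N2 \<Longrightarrow> e j = 0"
    using assms unfolding fin_rat_def by blast
  define N where "N = max N1 N2"
  have z: "d j = 0" "e j = 0" if "j \<ge> N" for j using N that by (auto simp: N_def)
  show "(\<lambda>j. d j + s * e j) \<in> fin_rat"
  proof -
    have "\<forall>j\<ge>N. d j + s * e j = 0" using z by simp
    moreover have "\<forall>j. d j + s * e j \<in> \<rat>" using assms by (simp add: fin_rat_def)
    ultimately show ?thesis unfolding fin_rat_def by blast
  qed
  have "lin (\<lambda>j. d j + s * e j) y = (\<Sum>j<N. (d j + s * e j) * y j)"
    by (rule lin_eq) (use z in auto)
  also have "\<dots> = lin d y + s * lin e y"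
  proof -
    have "lin d y = (\<Sum>j<N. d j * y j)" "lin e y = (\<Sum>j<N. e j * y j)"
      by (rule lin_eq, erule z)+
    then show ?thesis by (simp add: sum.distrib sum_distrib_left distrib_right mult.assoc)
  qed
  finally show "lin (\<lambda>j. d j + s * e j) y = lin d y + s * lin e y" .
qed

lemma continuous_lin: "continuous_on S (lin d)"
  unfolding lin_def
  by (intro continuous_on_sum continuous_on_mult continuous_on_const continuous_on_subset[OF continuous_on_product_coordinates] subset_UNIV)

lemma measurable_lin [measurable]: "lin d \<in> borel_measurable borel"
  by (intro borel_measurable_continuous_onI continuous_lin)

text \<open>The free phase \<open>\<theta>\<close> covers sines and constants as well, and the
  product formula for two cosines stays within the family. Integrals of the generators are real
  parts of rotated characteristic functions.\<close>

inductive_set trigalg :: "((nat \<Rightarrow> real) \<Rightarrow> real) set" where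
  base: "d \<in> fin_rat \<Longrightarrow> (\<lambda>y. c * cos (\<theta> + lin d y)) \<in> trigalg"
| add: "f \<in> trigalg \<Longrightarrow> g \<in> trigalg \<Longrightarrow> (\<lambda>y. f y + g y) \<in> trigalg"

lemma trigalg_const: "(\<lambda>_. c) \<in> trigalg"
  using trigalg.base[of "\<lambda>_. 0" c 0] by (simp add: fin_rat_def lin_def)

lemma trigalg_mult:
  assumes "f \<in> trigalg" "g \<in> trigalg"
  shows "(\<lambda>y. f y * g y) \<in> trigalg"
  using assms(1)
proof induction
  case (base d c \<theta>)
  note d = this
  show ?case
    using assms(2)
  proof induction
    case (base e c' \<theta>')
    have "(\<lambda>y. c * cos (\<theta> + lin d y) * (c' * cos (\<theta>' + lin e y)))
      = (\<lambda>y. c * c' / 2 * cos ((\<theta> - \<theta>') + lin (\<lambda>j. d j + (-1) * e j) y) + c * c' / 2 * cos ((\<theta> + \<theta>') + lin (\<lambda>j. d j + 1 * e j) y))"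
    proof
      fix y
      have "cos (\<theta> + lin d y) * cos (\<theta>' + lin e y) = (cos ((\<theta> + lin d y) - (\<theta>' + lin e y)) + cos ((\<theta> + lin d y) + (\<theta>' + lin e y))) / 2"
        by (rule cos_times_cos)
      moreover have "(\<theta> + lin d y) - (\<theta>' + lin e y) = (\<theta> - \<theta>') + lin (\<lambda>j. d j + (-1) * e j) y"
        "(\<theta> + lin d y) + (\<theta>' + lin e y) = (\<theta> + \<theta>') + lin (\<lambda>j. d j + 1 * e j) y"
        by (subst lin_add[OF d base]; simp)+
      ultimately show "c * cos (\<theta> + lin d y) * (c' * cos (\<theta>' + lin e y))
        = c * c' / 2 * cos ((\<theta> - \<theta>') + lin (\<lambda>j. d j + (-1) * e j) y) + c * c' / 2 * cos ((\<theta> + \<theta>') + lin (\<lambda>j. d j + 1 * e j) y)"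
        by (simp only: mult.assoc mult.left_commute[of _ c']) (simp add: field_simps)
    qed
    also have "\<dots> \<in> trigalg"
      by (intro trigalg.intros lin_add d base) auto
    finally show ?case .
  next
    case (add f g)
    from trigalg.add[OF add(3,4)] show ?case by (simp add: distrib_left)
  qed
next
  case (add f h)
  from trigalg.add[OF add(3,4)] show ?case by (simp add: distrib_right)
qed

lemma trigalg_props:
  assumes "f \<in> trigalg"
  shows "continuous_on S f" and "\<exists>B. \<forall>y. \<bar>f y\<bar> \<le> B"
proof -
  show "continuous_on S f"
    using assms
    by induction (intro continuous_on_mult continuous_on_cos continuous_on_add continuous_on_const continuous_lin; assumption)+
  show "\<exists>B. \<forall>y. \<bar>f y\<bar> \<le> B"
    using assms
  proof induction
    case (base d c \<theta>)
    have "\<bar>c * cos (\<theta> + lin d y)\<bar> \<le> \<bar>c\<bar>" for y by (simp add: abs_mult mult_left_le)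
    then show ?case by blast
  next
    case (add f g)
    then obtain B C where "\<And>y. \<bar>f y\<bar> \<le> B" "\<And>y. \<bar>g y\<bar> \<le> C" by blast
    then have "\<bar>f y + g y\<bar> \<le> B + C" for y by (meson abs_triangle_ineq add_mono order_trans)
    then show ?case by blast
  qed
qed

lemma trigalg_real_polynomial:
  assumes "f \<in> trigalg" "real_polynomial_function p"
  shows "(\<lambda>y. p (f y)) \<in> trigalg"
  using assms(2)
proof induction
  case (linear h)
  obtain c where "h = (\<lambda>x. x * c)" using linear real_bounded_linear by auto
  then show ?case using trigalg_mult[OF assms(1) trigalg_const[of c]] by simp
qed (auto intro: trigalg_const trigalg_mult trigalg.add)

section \<open>Compact cubes and uniform approximation on them\<close>

definition cube :: "real \<Rightarrow> (nat \<Rightarrow> real) set" where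
  "cube R = {y. \<forall>j. \<bar>y j\<bar> \<le> 2^j * R}"

text \<open>Tychonoff, for a product of closed intervals.\<close>

lemma compact_cube: "compact (cube R)"
proof -
  have "compactin (product_topology (\<lambda>_. euclidean) UNIV) (PiE UNIV (\<lambda>j::nat. {- (2^j * R)..2^j * R}))"
    unfolding compactin_PiE by auto
  then have "compact (PiE UNIV (\<lambda>j::nat. {- (2^j * R)..2^j * R}))"
    by (simp add: euclidean_product_topology)
  also have "PiE UNIV (\<lambda>j::nat. {- (2^j * R)..2^j * R}) = cube R"
    by (simp add: cube_def PiE_def Pi_def abs_le_iff minus_le_iff[of "_ * R"] conj_commute)
  finally show ?thesis .
qed

lemma cube_in_borel [measurable]: "cube R \<in> sets borel"
  using compact_cube compact_imp_closed by (intro borel_closed) blast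

text \<open>Scaling the differing coordinate by a small \<open>r = 1 / n\<close> brings it into the
  interval where the sine is injective; \<open>r\<close> is rational, so the form stays in
  \<open>fin_rat\<close>. The bound on that coordinate comes from the cube.\<close>

lemma trigalg_separates:
  assumes x: "x \<in> cube R" and y: "y \<in> cube R" and ne: "x \<noteq> y"
  shows "\<exists>f\<in>trigalg. f x \<noteq> f y"
proof -
  obtain j where j: "x j \<noteq> y j" using ne by blast
  define L where "L = 2^j * R"
  have L: "\<bar>x j\<bar> \<le> L" "\<bar>y j\<bar> \<le> L" using x y by (auto simp: cube_def L_def)
  have L0: "0 \<le> L" using L(1) by linarith
  obtain n :: nat where n: "2 * (L + 1) / pi < n" using reals_Archimedean2 by blast
  have "0 \<le> 2 * (L + 1) / pi" using L0 by simp
  then have n0: "real n > 0" using n by linarith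
  define r where "r = 1 / real n"
  have r: "0 < r" "r * L < pi / 2"
  proof -
    have "2 * (L + 1) < n * pi" using n by (simp add: field_simps)
    then have "2 * L < n * pi" by simp
    then show "r * L < pi / 2" using n0 by (simp add: r_def field_simps)
  qed (use n0 in \<open>simp add: r_def\<close>)
  define d where "d i = (if i = j then r else 0)" for i
  have d: "d \<in> fin_rat"
  proof -
    have "\<forall>i. d i \<in> \<rat>" "\<forall>i\<ge>Suc j. d i = 0" by (auto simp: d_def r_def)
    then show ?thesis unfolding fin_rat_def by blast
  qed
  have lind: "lin d z = r * z j" for z
    by (subst lin_eq[of "Suc j"]) (auto simp: d_def if_distrib[where f="\<lambda>a. a * _"] cong: if_cong)
  have bnd: "\<bar>r * z\<bar> \<le> pi / 2" if "\<bar>z\<bar> \<le> L" for z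
  proof -
    have "r * \<bar>z\<bar> \<le> r * L" using that r by (intro mult_left_mono) auto
    moreover have "\<bar>r * z\<bar> = r * \<bar>z\<bar>" using r(1) by (simp add: abs_mult)
    ultimately show ?thesis using r(2) by linarith
  qed
  have "sin (r * x j) \<noteq> sin (r * y j)"
  proof
    assume "sin (r * x j) = sin (r * y j)"
    then have "r * x j = r * y j"
      by (rule sin_inj_pi[rotated 4]) (use bnd[OF L(1)] bnd[OF L(2)] in linarith)+
    then show False using r(1) j by simp
  qed
  moreover have "1 * cos (- (pi / 2) + u) = sin u" for u :: real by (simp only: cos_add) simp
  ultimately have "1 * cos (- (pi / 2) + lin d x) \<noteq> 1 * cos (- (pi / 2) + lin d y)"
    by (simp only: lind) simp
  then show ?thesis by (intro bexI[OF _ trigalg.base[OF d, of 1 "- (pi / 2)"]]) simp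
qed

text \<open>Stone--Weierstrass only controls the approximant on the compact cube. Composing it with a
  polynomial close to a truncation function stays in the algebra and gives a global bound.\<close>

lemma trigalg_approx:
  assumes H: "continuous_on (cube R) H" "\<And>y. \<bar>H y\<bar> \<le> B" and e: "e > 0"
  obtains g where "g \<in> trigalg" "\<And>y. \<bar>g y\<bar> \<le> B + e" "\<And>y. y \<in> cube R \<Longrightarrow> \<bar>H y - g y\<bar> \<le> 2 * e"
proof -
  interpret function_ring_on trigalg "cube R"
    by unfold_locales (auto intro: compact_cube trigalg_props trigalg.add trigalg_mult trigalg_const trigalg_separates)
  obtain f where f: "f \<in> trigalg" "\<And>y. y \<in> cube R \<Longrightarrow> \<bar>H y - f y\<bar> < e"
    using Stone_Weierstrass_basic[OF H(1) e] by blast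
  obtain G where G: "\<And>y. \<bar>f y\<bar> \<le> G" using trigalg_props(2)[OF f(1)] by blast
  define clip where "clip u = max (- B) (min B u)" for u :: real
  have "continuous_on {-G..G} clip" unfolding clip_def by (intro continuous_intros)
  from Stone_Weierstrass_real_polynomial_function[OF _ this e]
  obtain p where p: "real_polynomial_function p" "\<And>u. u \<in> {-G..G} \<Longrightarrow> \<bar>clip u - p u\<bar> < e" by auto
  have fG: "f y \<in> {-G..G}" for y using G[of y] by (auto simp: abs_le_iff)
  have B: "0 \<le> B" by (rule order_trans[OF abs_ge_zero H(2)])
  show thesis
  proof
    show "(\<lambda>y. p (f y)) \<in> trigalg" by (rule trigalg_real_polynomial[OF f(1) p(1)])
    show "\<bar>p (f y)\<bar> \<le> B + e" for y
      using p(2)[OF fG[of y]] B by (auto simp: clip_def max_def min_def split: if_splits)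
    show "\<bar>H y - p (f y)\<bar> \<le> 2 * e" if "y \<in> cube R" for y
    proof -
      \<comment> \<open>Clipping projects onto the interval from \<open>-B\<close> to
        \<open>B\<close>, which contains \<open>H y\<close>, so it cannot increase the
        distance.\<close>
      have "\<bar>H y - clip (f y)\<bar> \<le> \<bar>H y - f y\<bar>"
        using H(2)[of y] by (auto simp: clip_def max_def min_def abs_if split: if_splits)
      then show ?thesis using p(2)[OF fG[of y]] f(2)[OF that] by linarith
    qed
  qed
qed

text \<open>The weight \<open>2^j\<close> in \<open>cube\<close> turns the Chebyshev bounds into a
  geometric series of ratio 1/4, with sum 4/3, rounded up to 2.\<close>

lemma cube_tail:
  fixes M :: "(nat \<Rightarrow> real) measure"
  assumes M: "prob_space M" and sets[measurable_cong]: "sets M = sets borel"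
    and tail: "\<And>j r. r > 0 \<Longrightarrow> measure M {y\<in>space M. \<bar>y j\<bar> > r} \<le> C / r\<^sup>2" and R: "R > 0"
  shows "measure M (space M - cube R) \<le> 2 * C / R\<^sup>2"
proof -
  interpret prob_space M by fact
  let ?A = "\<lambda>j. {y\<in>space M. \<bar>y j\<bar> > 2^j * R}"
  have coord: "(\<lambda>y. y j) \<in> borel_measurable M" for j
    using measurable_cong_sets[OF sets refl] by (metis borel_measurable_continuous_onI continuous_on_product_coordinates)
  note coord[measurable]
  have Am: "?A j \<in> events" for j by measurable
  have C: "0 \<le> C" using order_trans[OF measure_nonneg tail[of 1 0]] by simp
  have b: "prob (?A j) \<le> C / R\<^sup>2 * (1/4)^j" for j
  proof -
    have "prob (?A j) \<le> C / (2^j * R)\<^sup>2" by (rule tail) (use R in simp)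
    also have "(2^j * R)\<^sup>2 = 4^j * R\<^sup>2" by (simp add: power_mult_distrib power2_eq_square flip: power_mult_distrib)
    finally show ?thesis by (simp add: power_one_over field_simps)
  qed
  have s: "summable (\<lambda>j. C / R\<^sup>2 * (1/4)^j)" by (intro summable_mult summable_geometric) simp
  have s': "summable (\<lambda>j. prob (?A j))"
    by (rule summable_comparison_test'[OF s, of 0]) (use b in auto)
  have "space M - cube R = (\<Union>j. ?A j)" by (auto simp: cube_def not_le) (metis not_le)
  then have "prob (space M - cube R) = prob (\<Union>j. ?A j)" by simp
  also have "\<dots> \<le> (\<Sum>j. prob (?A j))"
    by (rule finite_measure_subadditive_countably) (use Am s' in auto)
  also have "\<dots> \<le> (\<Sum>j. C / R\<^sup>2 * (1/4)^j)" by (rule suminf_le[OF b s' s])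
  also have "\<dots> = C / R\<^sup>2 * (4/3)" by (subst suminf_mult) (auto simp: suminf_geometric)
  also have "\<dots> \<le> 2 * C / R\<^sup>2" using C by (simp add: divide_simps)
  finally show ?thesis .
qed

lemma expectation_approx_cube:
  fixes M :: "(nat \<Rightarrow> real) measure"
  assumes M: "prob_space M" and sets[measurable_cong]: "sets M = sets borel"
    and Hm[measurable]: "H \<in> borel_measurable borel" and H: "\<And>y. \<bar>H y\<bar> \<le> B"
    and g: "g \<in> trigalg" "\<And>y. \<bar>g y\<bar> \<le> B + e" "\<And>y. y \<in> cube R \<Longrightarrow> \<bar>H y - g y\<bar> \<le> 2 * e"
    and e: "e > 0"
  shows "\<bar>integral\<^sup>L M H - integral\<^sup>L M g\<bar> \<le> 2 * e + (2 * B + e) * measure M (space M - cube R)"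
proof -
  interpret prob_space M by fact
  have sp: "space M = UNIV" using sets_eq_imp_space_eq[OF sets] by simp
  have gm[measurable]: "g \<in> borel_measurable borel"
    using trigalg_props(1)[OF g(1)] by (rule borel_measurable_continuous_onI)
  have i: "integrable M H" "integrable M g"
    using H g(2) by (intro integrable_const_bound[where B=B]; simp) (intro integrable_const_bound[where B="B+e"]; use g(2) in simp)
  have "\<bar>expectation H - expectation g\<bar> = \<bar>expectation (\<lambda>y. H y - g y)\<bar>" using i by simp
  also have "\<dots> \<le> expectation (\<lambda>y. \<bar>H y - g y\<bar>)" by (rule integral_abs_bound)
  also have "\<dots> \<le> expectation (\<lambda>y. 2 * e + (2 * B + e) * indicator (space M - cube R) y)"
  proof (rule integral_mono)
    fix y
    show "\<bar>H y - g y\<bar> \<le> 2 * e + (2 * B + e) * indicator (space M - cube R) y"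
      using H[of y] g(2)[of y] g(3)[of y] e sp by (auto simp: indicator_def)
  qed (use i in \<open>auto intro!: Bochner_Integration.integrable_add integrable_mult_right integrable_real_indicator simp: less_top[symmetric]\<close>)
  also have "\<dots> = 2 * e + (2 * B + e) * prob (space M - cube R)"
    by (subst Bochner_Integration.integral_add) (auto simp: prob_space less_top[symmetric])
  finally show ?thesis .
qed

text \<open>\<open>H\<close> is only assumed continuous on each cube, which is what the Taylor
  series map provides. One approximant \<open>g\<close> from \<open>trigalg\<close> handles all laws
  at once: the tail bounds have a common constant \<open>C\<close>, so the mass outside a large cube
  is uniformly small.\<close>

lemma weak_conv_sequence_space:
  fixes P :: "nat \<Rightarrow> (nat \<Rightarrow> real) measure" and H :: "(nat \<Rightarrow> real) \<Rightarrow> real"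
  assumes P: "\<And>n. prob_space (P n)" "\<And>n. sets (P n) = sets borel"
    and P0: "prob_space P0" "sets P0 = sets borel"
    and tail: "\<And>n j r. n \<ge> n0 \<Longrightarrow> r > 0 \<Longrightarrow> measure (P n) {y\<in>space (P n). \<bar>y j\<bar> > r} \<le> C / r\<^sup>2"
    and tail0: "\<And>j r. r > 0 \<Longrightarrow> measure P0 {y\<in>space P0. \<bar>y j\<bar> > r} \<le> C / r\<^sup>2"
    and char: "\<And>d \<theta>. d \<in> fin_rat \<Longrightarrow> (\<lambda>n. LINT y|P n. cos (\<theta> + lin d y)) \<longlonglongrightarrow> (LINT y|P0. cos (\<theta> + lin d y))"
    and H: "H \<in> borel_measurable borel" "\<And>y. \<bar>H y\<bar> \<le> B" "\<And>R. continuous_on (cube R) H"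
  shows "(\<lambda>n. integral\<^sup>L (P n) H) \<longlonglongrightarrow> integral\<^sup>L P0 H"
proof -
  interpret P0: prob_space P0 by fact
  have B: "0 \<le> B" by (rule order_trans[OF abs_ge_zero H(2)])
  have C: "0 \<le> C" using order_trans[OF measure_nonneg tail0[of 1 0]] by simp
  have integ: "integrable Q f" if Q: "f \<in> trigalg" "prob_space Q" "sets Q = sets borel" for f and Q :: "(nat \<Rightarrow> real) measure"
  proof -
    interpret Q: prob_space Q by fact
    obtain K where K: "\<And>y. \<bar>f y\<bar> \<le> K" using trigalg_props(2)[OF Q(1)] by blast
    have "f \<in> borel_measurable borel" using trigalg_props(1)[OF Q(1)] by (rule borel_measurable_continuous_onI)
    then have "f \<in> borel_measurable Q" using measurable_cong_sets[OF Q(3) refl] by blast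
    then show ?thesis by (intro Q.integrable_const_bound[where B=K]) (use K in auto)
  qed
  have conv: "(\<lambda>n. integral\<^sup>L (P n) f) \<longlonglongrightarrow> integral\<^sup>L P0 f" if "f \<in> trigalg" for f
    using that
  proof induction
    case (base d c \<theta>)
    then show ?case using tendsto_mult_left[OF char[OF base, of \<theta>], of c] by simp
  next
    case (add f g)
    then show ?case
      using tendsto_add[OF add(3,4)] integ P P0 by simp
  qed
  show ?thesis
  proof (rule LIMSEQ_I)
    fix r :: real assume r: "r > 0"
    define e where "e = min 1 (r / 16)"
    have e: "e > 0" "e \<le> 1" "16 * e \<le> r" using r by (auto simp: e_def)
    \<comment> \<open>Chosen so that the part outside the cube costs at most \<open>r / 8\<close>,
      the approximation on the cube costing \<open>2 * e \<le> r / 8\<close>. The summands 1 keep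
      \<open>R\<close> positive when \<open>B\<close> or \<open>C\<close> is 0.\<close>
    define R where "R = sqrt ((2 * B + 1) * (16 * C + 1) / r)"
    have R2: "R\<^sup>2 = (2 * B + 1) * (16 * C + 1) / r" unfolding R_def using B C r by simp
    have R: "R > 0" unfolding R_def using B C r by (simp add: add_nonneg_pos)
    have small: "(2 * B + e) * (2 * C / R\<^sup>2) \<le> r / 8"
    proof -
      have "(2 * B + e) * (2 * C / R\<^sup>2) \<le> (2 * B + 1) * (2 * C / R\<^sup>2)"
        using e C by (intro mult_right_mono) auto
      also have "\<dots> = r / 8 * (16 * C / (16 * C + 1))"
        unfolding R2 using B C r by (simp add: divide_simps add_nonneg_pos)
      also have "\<dots> \<le> r / 8 * 1" using r C by (intro mult_left_mono) (auto simp: divide_simps)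
      finally show ?thesis by simp
    qed
    obtain g where g: "g \<in> trigalg" "\<And>y. \<bar>g y\<bar> \<le> B + e" "\<And>y. y \<in> cube R \<Longrightarrow> \<bar>H y - g y\<bar> \<le> 2 * e"
      using trigalg_approx[OF H(3) H(2) e(1)] by blast
    have approx: "\<bar>integral\<^sup>L Q H - integral\<^sup>L Q g\<bar> \<le> r / 4"
      if Q: "prob_space Q" "sets Q = sets borel" "\<And>j s. s > 0 \<Longrightarrow> measure Q {y\<in>space Q. \<bar>y j\<bar> > s} \<le> C / s\<^sup>2" for Q
    proof -
      interpret Q: prob_space Q by fact
      have "\<bar>integral\<^sup>L Q H - integral\<^sup>L Q g\<bar> \<le> 2 * e + (2 * B + e) * measure Q (space Q - cube R)"
        by (rule expectation_approx_cube[OF Q(1,2) H(1,2) g e(1)])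
      also have "\<dots> \<le> 2 * e + (2 * B + e) * (2 * C / R\<^sup>2)"
        using cube_tail[OF Q R] B e by (intro add_left_mono mult_left_mono) auto
      also have "\<dots> \<le> r / 4" using small e by linarith
      finally show ?thesis .
    qed
    obtain N where N: "\<And>n. n \<ge> N \<Longrightarrow> \<bar>integral\<^sup>L (P n) g - integral\<^sup>L P0 g\<bar> < r / 4"
      using LIMSEQ_D[OF conv[OF g(1)], of "r / 4"] r by auto
    have "norm (integral\<^sup>L (P n) H - integral\<^sup>L P0 H) < r" if n: "n \<ge> max N n0" for n
    proof -
      have "n \<ge> n0" "n \<ge> N" using n by auto
      have "\<bar>integral\<^sup>L (P n) H - integral\<^sup>L (P n) g\<bar> \<le> r / 4"
        by (rule approx[OF P]) (rule tail[OF \<open>n \<ge> n0\<close>])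
      moreover have "\<bar>integral\<^sup>L P0 H - integral\<^sup>L P0 g\<bar> \<le> r / 4"
        by (rule approx[OF P0 tail0])
      ultimately show ?thesis using N[OF \<open>n \<ge> N\<close>] r unfolding real_norm_def by linarith
    qed
    then show "\<exists>no. \<forall>n\<ge>no. norm (integral\<^sup>L (P n) H - integral\<^sup>L P0 H) < r" by blast
  qed
qed

subsection \<open>Taylor coefficients and the space of C1 functions\<close>

text \<open>Completeness of \<open>C1code\<close> allows the Taylor series in \<open>Phi\<close> to
  be summed in norm.\<close>

instance bcontfun :: (metric_space, banach) banach ..

lemma clamp02pi_range: "clamp02pi t \<in> {0..2*pi}"
  by (auto simp: clamp02pi_def)

lemma clamp02pi_id: "t \<in> {0..2*pi} \<Longrightarrow> clamp02pi t = t"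
  by (auto simp: clamp02pi_def)

lemma clamp02pi_clamp02pi [simp]: "clamp02pi (clamp02pi t) = clamp02pi t"
  by (rule clamp02pi_id) (rule clamp02pi_range)

lemma continuous_clamp02pi: "continuous_on S clamp02pi"
  unfolding clamp02pi_def by (intro continuous_intros)

lemma clamp02pi_bcontfun:
  fixes g :: "real \<Rightarrow> real"
  assumes "continuous_on {0..2*pi} g"
  shows "(\<lambda>t. g (clamp02pi t)) \<in> bcontfun"
proof -
  have "continuous_on UNIV (\<lambda>t. g (clamp02pi t))"
    by (rule continuous_on_compose2[OF assms continuous_clamp02pi]) (use clamp02pi_range in blast)
  moreover have "bounded (range (\<lambda>t. g (clamp02pi t)))"
  proof (rule bounded_subset)
    show "bounded (g ` {0..2*pi})"
      by (intro compact_imp_bounded compact_continuous_image assms) simp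
    show "range (\<lambda>t. g (clamp02pi t)) \<subseteq> g ` {0..2*pi}"
      using clamp02pi_range by blast
  qed
  ultimately show ?thesis by (simp add: bcontfun_def)
qed

lemma C1pair_apply:
  assumes "continuous_on {0..2*pi} g" "continuous_on {0..2*pi} g'"
  shows "apply_bcontfun (fst (C1pair g g')) t = g (clamp02pi t)"
    "apply_bcontfun (snd (C1pair g g')) t = g' (clamp02pi t)"
  using assms by (simp_all add: C1pair_def Bcontfun_inverse clamp02pi_bcontfun)

lemma C1code_eqI:
  fixes p q :: C1code
  assumes "\<And>t. apply_bcontfun (fst p) t = apply_bcontfun (fst q) t"
    and "\<And>t. apply_bcontfun (snd p) t = apply_bcontfun (snd q) t"
  shows "p = q"
  using assms by (intro prod_eqI bcontfun_eqI)

lemma C1_on_02piD: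
  assumes "C1_on_02pi g g'"
  shows "continuous_on {0..2*pi} g" "continuous_on {0..2*pi} g'"
  using assms unfolding C1_on_02pi_def
  by (auto intro!: DERIV_continuous_on)

text \<open>Uniform convergence of the derivatives carries the derivative relation to the limit.
  Closedness makes \<open>C1space\<close> a Borel set, so that its mass under the limit law can be
  computed.\<close>

lemma closed_C1space: "closed C1space"
  unfolding closed_sequential_limits
proof (intro allI impI, elim conjE)
  fix f :: "nat \<Rightarrow> C1code" and l
  assume f: "\<forall>n. f n \<in> C1space" and lim: "f \<longlonglongrightarrow> l"
  have "\<forall>n. \<exists>g g'. f n = C1pair g g' \<and> C1_on_02pi g g'" using f by (auto simp: C1space_def)
  then obtain g g' where g: "\<And>n. f n = C1pair (g n) (g' n)" "\<And>n. C1_on_02pi (g n) (g' n)" by metis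
  note c = C1_on_02piD[OF g(2)]
  define u where "u = apply_bcontfun (fst l)"
  define w where "w = apply_bcontfun (snd l)"
  have lu: "uniform_limit UNIV (\<lambda>n. apply_bcontfun (fst (f n))) u sequentially"
    unfolding u_def by (rule tendsto_bcontfun_uniform_limit[OF tendsto_fst[OF lim]])
  have lw: "uniform_limit UNIV (\<lambda>n. apply_bcontfun (snd (f n))) w sequentially"
    unfolding w_def by (rule tendsto_bcontfun_uniform_limit[OF tendsto_snd[OF lim]])
  have pu: "(\<lambda>n. g n (clamp02pi t)) \<longlonglongrightarrow> u t" for t
    using tendsto_uniform_limitI[OF lu, of t] by (simp add: g(1) C1pair_apply c)
  have pw: "(\<lambda>n. g' n (clamp02pi t)) \<longlonglongrightarrow> w t" for t
    using tendsto_uniform_limitI[OF lw, of t] by (simp add: g(1) C1pair_apply c)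
  \<comment> \<open>The limit inherits the constant extension outside the interval, so it is again
    of the form \<open>C1pair u w\<close>.\<close>
  have uc: "u (clamp02pi t) = u t" "w (clamp02pi t) = w t" for t
    using LIMSEQ_unique[OF pu[of "clamp02pi t"]] pu[of t] LIMSEQ_unique[OF pw[of "clamp02pi t"]] pw[of t] by simp_all
  have cu: "continuous_on {0..2*pi} u" and cw: "continuous_on {0..2*pi} w" unfolding u_def w_def by auto
  have "\<exists>v. \<forall>x\<in>{0..2*pi}. (\<lambda>n. g n x) \<longlonglongrightarrow> v x \<and> (v has_derivative (\<lambda>h. h * w x)) (at x within {0..2*pi})"
  proof (rule has_derivative_sequence[where f'="\<lambda>n x h. h * g' n x"])
    show "(g n has_derivative (\<lambda>h. h * g' n x)) (at x within {0..2*pi})" if "x \<in> {0..2*pi}" for n x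
    proof -
      have "(g n has_derivative (*) (g' n x)) (at x within {0..2*pi})"
        using g(2)[of n] that unfolding C1_on_02pi_def has_field_derivative_def by blast
      moreover have "(*) (g' n x) = (\<lambda>h. h * g' n x)" by (simp add: fun_eq_iff)
      ultimately show ?thesis by simp
    qed
    show "\<forall>\<^sub>F n in sequentially. \<forall>x\<in>{0..2*pi}. \<forall>h. norm (h * g' n x - h * w x) \<le> e * norm h" if "e > 0" for e :: real
      using uniform_limitD[OF lw that]
    proof eventually_elim
      case (elim n)
      show ?case
      proof (intro ballI allI)
        fix x h :: real assume x: "x \<in> {0..2*pi}"
        have "\<bar>g' n x - w x\<bar> \<le> e"
          using elim[rule_format, of x] x by (simp add: g(1) C1pair_apply c clamp02pi_id dist_real_def)
        then have "\<bar>h\<bar> * \<bar>g' n x - w x\<bar> \<le> \<bar>h\<bar> * e" by (intro mult_left_mono) auto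
        then show "norm (h * g' n x - h * w x) \<le> e * norm h"
          by (simp add: abs_mult[symmetric] right_diff_distrib mult.commute)
      qed
    qed
    show "(\<lambda>n. g n 0) \<longlonglongrightarrow> u 0" using pu[of 0] by (simp add: clamp02pi_id)
  qed auto
  then obtain v where v: "\<And>x. x \<in> {0..2*pi} \<Longrightarrow> (\<lambda>n. g n x) \<longlonglongrightarrow> v x"
     "\<And>x. x \<in> {0..2*pi} \<Longrightarrow> (v has_derivative (\<lambda>h. h * w x)) (at x within {0..2*pi})" by blast
  have vu: "v x = u x" if "x \<in> {0..2*pi}" for x
    using LIMSEQ_unique[OF v(1)[OF that]] pu[of x] that by (simp add: clamp02pi_id)
  have "C1_on_02pi u w"
    unfolding C1_on_02pi_def
  proof (intro conjI ballI cw)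
    fix t assume t: "t \<in> {0..2*pi}"
    have "(v has_real_derivative w t) (at t within {0..2*pi})"
    proof -
      have "(*) (w t) = (\<lambda>h. h * w t)" by (simp add: fun_eq_iff)
      then show ?thesis using v(2)[OF t] unfolding has_field_derivative_def by simp
    qed
    then show "(u has_real_derivative w t) (at t within {0..2*pi})"
      by (rule has_field_derivative_transform_within[OF _ zero_less_one t]) (use vu in auto)
  qed
  moreover have "C1pair u w = l"
    by (rule C1code_eqI) (simp_all only: C1pair_apply[OF cu cw] uc, simp_all add: u_def w_def)
  ultimately show "l \<in> C1space" unfolding C1space_def by blast
qed

section \<open>The map from Taylor coefficients to C1 functions\<close>

definition tay :: "nat \<Rightarrow> C1code" where
  "tay j = C1pair (\<lambda>t. t ^ j / fact j) (\<lambda>t. real j * t ^ (j - 1) / fact j)"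

lemma tay_apply:
  "apply_bcontfun (fst (tay j)) t = clamp02pi t ^ j / fact j"
  "apply_bcontfun (snd (tay j)) t = real j * clamp02pi t ^ (j - 1) / fact j"
proof -
  have c: "continuous_on {0..2*pi} (\<lambda>t::real. t ^ j / fact j)" "continuous_on {0..2*pi} (\<lambda>t. real j * t ^ (j - 1) / fact j)"
    by (intro continuous_intros; simp)+
  show "apply_bcontfun (fst (tay j)) t = clamp02pi t ^ j / fact j"
    "apply_bcontfun (snd (tay j)) t = real j * clamp02pi t ^ (j - 1) / fact j"
    unfolding tay_def C1pair_apply[OF c] by (rule refl)+
qed

text \<open>Here 7 bounds \<open>2 * pi\<close>, and the factor \<open>1 + j\<close> from value plus
  derivative is absorbed by \<open>2^j\<close>, giving 14 = 2 * 7.\<close>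

lemma norm_tay: "norm (tay j) \<le> 14 ^ j / fact j"
proof -
  have cl: "0 \<le> clamp02pi t" "clamp02pi t \<le> 7" for t
    using clamp02pi_range[of t] pi_less_4 pi_approx by auto
  have "norm (fst (tay j)) \<le> 7 ^ j / fact j"
    by (rule norm_bound) (use cl in \<open>auto simp: tay_apply intro!: divide_right_mono power_mono\<close>)
  moreover have "norm (snd (tay j)) \<le> real j * 7 ^ j / fact j"
  proof (rule norm_bound)
    fix t
    have "clamp02pi t ^ (j - 1) \<le> 7 ^ (j - 1)" using cl by (intro power_mono) auto
    also have "\<dots> \<le> 7 ^ j" by (intro power_increasing) auto
    finally show "norm (apply_bcontfun (snd (tay j)) t) \<le> real j * 7 ^ j / fact j"
      using cl[of t] by (auto simp: tay_apply abs_mult power_abs intro!: divide_right_mono mult_left_mono)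
  qed
  moreover have "norm (tay j) \<le> norm (fst (tay j)) + norm (snd (tay j))"
    by (metis norm_Pair_le prod.collapse)
  ultimately have "norm (tay j) \<le> (1 + real j) * 7 ^ j / fact j"
    by (simp add: distrib_right add_divide_distrib)
  also have "\<dots> \<le> 2 ^ j * 7 ^ j / fact j"
  proof -
    have "1 + real j \<le> 2 ^ j"
      by (induction j) auto
    then show ?thesis by (intro divide_right_mono mult_right_mono) auto
  qed
  also have "\<dots> = 14 ^ j / fact j" by (simp flip: power_mult_distrib)
  finally show ?thesis .
qed

definition Phi :: "(nat \<Rightarrow> real) \<Rightarrow> C1code" where
  "Phi y = (\<Sum>j. y j *\<^sub>R tay j)"

lemma summable_28: "summable (\<lambda>j. R * (28 ^ j / fact j :: real))"
  using summable_exp[of "28::real"] by (intro summable_mult) (simp add: divide_inverse mult.commute)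

text \<open>The cube contributes another \<open>2^j\<close>, whence 28 = 2 * 14. The majorant
  depends on \<open>R\<close> only, so it serves as the M-test bound for the whole cube.\<close>

lemma norm_Phi_term:
  assumes "y \<in> cube R"
  shows "norm (y j *\<^sub>R tay j) \<le> R * (28 ^ j / fact j)"
proof -
  have "norm (y j *\<^sub>R tay j) \<le> (2 ^ j * R) * (14 ^ j / fact j)"
    unfolding norm_scaleR
  proof (rule mult_mono)
    show "\<bar>y j\<bar> \<le> 2 ^ j * R" using assms by (simp add: cube_def)
    then show "0 \<le> 2 ^ j * R" by linarith
  qed (auto intro: norm_tay)
  also have "\<dots> = R * ((2 ^ j * 14 ^ j) / fact j)" by simp
  also have "(2::real) ^ j * 14 ^ j = 28 ^ j" by (simp flip: power_mult_distrib)
  finally show ?thesis .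
qed

lemma summable_Phi:
  assumes "y \<in> cube R"
  shows "summable (\<lambda>j. y j *\<^sub>R tay j)"
  by (rule summable_comparison_test'[OF summable_28[of R]]) (rule norm_Phi_term[OF assms])

lemma continuous_Phi_partial: "continuous_on S (\<lambda>y. \<Sum>j<n. y j *\<^sub>R tay j)"
  by (intro continuous_on_sum continuous_on_scaleR continuous_on_const continuous_on_subset[OF continuous_on_product_coordinates] subset_UNIV)

lemma continuous_Phi: "continuous_on (cube R) Phi"
proof -
  have "uniform_limit (cube R) (\<lambda>n y. \<Sum>j<n. y j *\<^sub>R tay j) (\<lambda>y. \<Sum>j. y j *\<^sub>R tay j) sequentially"
    by (rule Weierstrass_m_test[OF norm_Phi_term summable_28])
  then show ?thesis
    unfolding Phi_def
    by (rule uniform_limit_theorem[rotated]) (simp_all add: always_eventually continuous_Phi_partial)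
qed

text \<open>The exponential generating function: \<open>y j\<close> is the \<open>j\<close>-th
  derivative at 0, so differentiation becomes a shift of the sequence.\<close>

definition egf :: "(nat \<Rightarrow> real) \<Rightarrow> real \<Rightarrow> real" where
  "egf y t = (\<Sum>j. y j / fact j * t ^ j)"

lemma summable_egf:
  assumes "y \<in> cube R"
  shows "summable (\<lambda>j. y j / fact j * t ^ j)"
proof (rule summable_comparison_test')
  show "summable (\<lambda>j. R * ((2 * \<bar>t\<bar>) ^ j / fact j))"
    using summable_exp[of "2 * \<bar>t\<bar>"] by (intro summable_mult) (simp add: divide_inverse mult.commute)
  fix j
  have "norm (y j / fact j * t ^ j) = \<bar>y j\<bar> * (\<bar>t\<bar> ^ j / fact j)"
    by (simp add: abs_mult power_abs)
  also have "\<dots> \<le> (2 ^ j * R) * (\<bar>t\<bar> ^ j / fact j)"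
    using assms by (intro mult_right_mono) (auto simp: cube_def)
  finally show "norm (y j / fact j * t ^ j) \<le> R * ((2 * \<bar>t\<bar>) ^ j / fact j)"
    by (simp add: power_mult_distrib mult_ac)
qed

lemma cube_shift:
  assumes "y \<in> cube R"
  shows "(\<lambda>j. y (Suc j)) \<in> cube (2 * R)"
proof -
  have "\<bar>y (Suc j)\<bar> \<le> 2 ^ Suc j * R" for j using assms unfolding cube_def by blast
  then show ?thesis by (simp add: cube_def mult_ac)
qed

lemma egf_deriv:
  assumes "y \<in> cube R"
  shows "(egf y has_real_derivative egf (\<lambda>j. y (Suc j)) t) (at t)"
proof -
  have "((\<lambda>x. \<Sum>n. y n / fact n * x ^ n) has_field_derivative (\<Sum>n. diffs (\<lambda>n. y n / fact n) n * t ^ n)) (at t)"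
    by (rule termdiffs_strong_converges_everywhere) (rule summable_egf[OF assms])
  moreover have "diffs (\<lambda>n. y n / fact n) n = y (Suc n) / fact n" for n
    by (simp add: diffs_def field_simps del: of_nat_Suc)
  ultimately show ?thesis unfolding egf_def by simp
qed

lemma bounded_linear_eval_fst: "bounded_linear (\<lambda>p :: C1code. apply_bcontfun (fst p) t)"
proof (rule bounded_linear_intro[where K=1])
  show "norm (apply_bcontfun (fst p) t) \<le> norm p * 1" for p :: C1code
    using norm_bounded[of "fst p" t] norm_fst_le[of "fst p" "snd p"] by simp
qed auto

lemma bounded_linear_eval_snd: "bounded_linear (\<lambda>p :: C1code. apply_bcontfun (snd p) t)"
proof (rule bounded_linear_intro[where K=1])
  show "norm (apply_bcontfun (snd p) t) \<le> norm p * 1" for p :: C1code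
    using norm_bounded[of "snd p" t] norm_snd_le[of "snd p" "fst p"] by simp
qed auto

lemma Phi_apply:
  assumes "y \<in> cube R"
  shows "apply_bcontfun (fst (Phi y)) t = egf y (clamp02pi t)"
    "apply_bcontfun (snd (Phi y)) t = egf (\<lambda>j. y (Suc j)) (clamp02pi t)"
proof -
  note s = summable_Phi[OF assms]
  have "apply_bcontfun (fst (Phi y)) t = (\<Sum>j. apply_bcontfun (fst (y j *\<^sub>R tay j)) t)"
    unfolding Phi_def by (rule bounded_linear.suminf[OF bounded_linear_eval_fst s])
  then show "apply_bcontfun (fst (Phi y)) t = egf y (clamp02pi t)"
    by (simp add: egf_def tay_apply)
  have s': "summable (\<lambda>j. apply_bcontfun (snd (y j *\<^sub>R tay j)) t)"
    by (rule bounded_linear.summable[OF bounded_linear_eval_snd s])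
  have "apply_bcontfun (snd (Phi y)) t = (\<Sum>j. apply_bcontfun (snd (y j *\<^sub>R tay j)) t)"
    unfolding Phi_def by (rule bounded_linear.suminf[OF bounded_linear_eval_snd s])
  \<comment> \<open>The term \<open>j = 0\<close> vanishes because the derivative of
    \<open>tay 0\<close> carries the factor \<open>real 0\<close>, although its exponent
    \<open>j - 1\<close> is also 0.\<close>
  also have "\<dots> = (\<Sum>j. apply_bcontfun (snd (y (Suc j) *\<^sub>R tay (Suc j))) t)"
    by (subst suminf_split_head[OF s']) (simp add: tay_apply)
  also have "\<dots> = egf (\<lambda>j. y (Suc j)) (clamp02pi t)"
    unfolding egf_def by (intro suminf_cong) (simp add: tay_apply del: of_nat_Suc)
  finally show "apply_bcontfun (snd (Phi y)) t = egf (\<lambda>j. y (Suc j)) (clamp02pi t)" .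
qed

lemma continuous_egf: "y \<in> cube R \<Longrightarrow> continuous_on S (egf y)"
  using egf_deriv by (meson DERIV_continuous continuous_at_imp_continuous_on)

lemma C1_egf:
  assumes "y \<in> cube R"
  shows "C1_on_02pi (egf y) (egf (\<lambda>j. y (Suc j)))"
  unfolding C1_on_02pi_def
  using egf_deriv[OF assms] continuous_egf[OF cube_shift[OF assms]]
  by (auto intro: has_field_derivative_at_within)

lemma Phi_eq_C1pair:
  assumes "y \<in> cube R"
  shows "Phi y = C1pair (egf y) (egf (\<lambda>j. y (Suc j)))"
  by (rule C1code_eqI)
    (simp_all add: Phi_apply[OF assms] C1pair_apply continuous_egf[OF assms] continuous_egf[OF cube_shift[OF assms]])

lemma Phi_eq_C1emb:
  assumes "y \<in> cube R"
  shows "Phi y = C1emb (egf y)"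
proof -
  have "deriv (egf y) = egf (\<lambda>j. y (Suc j))"
    using egf_deriv[OF assms] by (intro ext DERIV_imp_deriv)
  then show ?thesis by (simp add: Phi_eq_C1pair[OF assms] C1emb_def)
qed

lemma Phi_in_C1space: "y \<in> cube R \<Longrightarrow> Phi y \<in> C1space"
  unfolding C1space_def using Phi_eq_C1pair C1_egf by blast

definition cubes :: "(nat \<Rightarrow> real) set" where
  "cubes = (\<Union>R::nat. cube (real R))"

lemma cube_mono: "R \<le> R' \<Longrightarrow> cube R \<subseteq> cube R'"
  unfolding cube_def by (auto intro: order_trans[OF _ mult_left_mono])

lemma cube_subset_cubes: "cube R \<subseteq> cubes"
proof -
  obtain n :: nat where "R \<le> n" using real_arch_simple by blast
  then show ?thesis using cube_mono[of R n] unfolding cubes_def by blast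
qed

text \<open>Off the union of the cubes the series defining \<^term>\<open>Phi\<close> need not converge; the value
  there is that of the zero sequence.\<close>

definition Phi0 :: "(nat \<Rightarrow> real) \<Rightarrow> C1code" where
  "Phi0 y = Phi (if y \<in> cubes then y else (\<lambda>_. 0))"

lemma Phi0_eq: "y \<in> cube R \<Longrightarrow> Phi0 y = Phi y"
  using cube_subset_cubes unfolding Phi0_def by auto

text \<open>\<open>Phi0\<close> is the pointwise limit of continuous partial sums evaluated at a
  sequence corrected to lie in \<open>cubes\<close>, and limits of Borel maps into a metric space
  are Borel.\<close>

lemma measurable_Phi0 [measurable]: "Phi0 \<in> borel_measurable borel"
proof (rule borel_measurable_LIMSEQ_metric)
  let ?T = "\<lambda>y. if y \<in> cubes then y else (\<lambda>_. 0)"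
  have "cubes \<in> sets borel" unfolding cubes_def by measurable
  then have T: "?T \<in> borel_measurable borel" by measurable
  have "(\<lambda>y. \<Sum>j<n. y j *\<^sub>R tay j) \<in> borel_measurable borel" for n
    by (intro borel_measurable_continuous_onI continuous_Phi_partial)
  from measurable_compose[OF T this]
  show "(\<lambda>y. \<Sum>j<n. ?T y j *\<^sub>R tay j) \<in> borel_measurable borel" for n .
  fix y :: "nat \<Rightarrow> real"
  have "(\<lambda>_. 0) \<in> cube 0" by (simp add: cube_def)
  then have "?T y \<in> cubes" using cube_subset_cubes by auto
  then obtain R :: nat where "?T y \<in> cube R" unfolding cubes_def by blast
  from summable_LIMSEQ[OF summable_Phi[OF this]]
  show "(\<lambda>n. \<Sum>j<n. ?T y j *\<^sub>R tay j) \<longlonglongrightarrow> Phi0 y" unfolding Phi0_def Phi_def .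
qed

lemma continuous_Phi0: "continuous_on (cube R) Phi0"
  using continuous_Phi Phi0_eq by (metis continuous_on_cong)

subsection \<open>The limiting Gaussian process\<close>

lemma prob_space_centered_normal: "0 \<le> v \<Longrightarrow> prob_space (centered_normal v)"
  unfolding centered_normal_def
  by (auto intro: prob_space_return prob_space_normal_density)

lemma char_centered_normal:
  assumes v: "0 \<le> v"
  shows "char (centered_normal v) s = exp (- v * s\<^sup>2 / 2)"
proof (cases "v = 0")
  case True
  then show ?thesis by (simp add: centered_normal_def char_def integral_return)
next
  case False
  then have v0: "0 < v" using v by simp
  interpret S: prob_space std_normal_distribution
    using real_dist_normal_dist by (simp add: real_distribution_def)
  have X: "distributed std_normal_distribution lborel (\<lambda>x. x) std_normal_density"
    unfolding distributed_def by (auto simp: distr_id2)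
  have "distributed std_normal_distribution lborel (\<lambda>x. 0 + sqrt v * x) (normal_density (0 + sqrt v * 0) (\<bar>sqrt v\<bar> * 1))"
    by (rule S.normal_density_affine[OF X]) (use v0 in auto)
  then have "distr std_normal_distribution lborel (\<lambda>x. sqrt v * x) = density lborel (normal_density 0 (sqrt v))"
    unfolding distributed_def using v0 by simp
  then have "centered_normal v = distr std_normal_distribution borel (\<lambda>x. sqrt v * x)"
    using False by (simp add: centered_normal_def cong: distr_cong)
  then have "char (centered_normal v) s = char std_normal_distribution (s * sqrt v)"
    by (simp add: char_def integral_distr mult_ac)
  also have "\<dots> = exp (- v * s\<^sup>2 / 2)"
    using v by (simp add: char_std_normal_distribution power_mult_distrib mult.commute)
  finally show ?thesis .
qed

section \<open>Covariances of Taylor coefficients and the Hilbert matrix\<close>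

lemma power_sum_limit:
  "(\<lambda>n. (\<Sum>k=1..n. (real k / real n) ^ m) / real n) \<longlonglongrightarrow> 1 / (real m + 1)"
proof -
  \<comment> \<open>Both bounds follow by induction on \<open>n\<close>: factoring a difference of
    consecutive powers compares the increment of \<open>n^(m+1)\<close> with \<open>m + 1\<close>
    times an \<open>m\<close>-th power.\<close>
  have lo: "real n ^ Suc m \<le> (real m + 1) * (\<Sum>k=1..n. real k ^ m)" for n
  proof (induction n)
    case (Suc n)
    have "real (Suc n) ^ Suc m - real n ^ Suc m \<le> (real m + 1) * real (Suc n) ^ m"
    proof -
      have "real (Suc n) ^ Suc m - real n ^ Suc m = (real (Suc n) - real n) * (\<Sum>i<Suc m. real (Suc n) ^ i * real n ^ (m - i))"
        by (subst diff_power_eq_sum) (simp add: mult.commute)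
      also have "\<dots> \<le> (real (Suc n) - real n) * (\<Sum>i<Suc m. real (Suc n) ^ i * real (Suc n) ^ (m - i))"
        by (intro mult_left_mono sum_mono power_mono) auto
      also have "\<dots> = (\<Sum>i<Suc m. real (Suc n) ^ m)"
        by (simp add: power_add[symmetric] del: of_nat_Suc sum.lessThan_Suc)
      finally show ?thesis by (simp add: add.commute)
    qed
    then show ?case using Suc by (simp add: distrib_left)
  qed simp
  have hi: "(real m + 1) * (\<Sum>k=1..n. real k ^ m) \<le> real (Suc n) ^ Suc m" for n
  proof (induction n)
    case (Suc n)
    have "(real m + 1) * real (Suc n) ^ m \<le> real (Suc (Suc n)) ^ Suc m - real (Suc n) ^ Suc m"
    proof -
      have "(real m + 1) * real (Suc n) ^ m = (real (Suc (Suc n)) - real (Suc n)) * (\<Sum>i<Suc m. real (Suc n) ^ i * real (Suc n) ^ (m - i))"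
        by (simp add: power_add[symmetric] del: of_nat_Suc sum.lessThan_Suc) simp
      also have "\<dots> \<le> (real (Suc (Suc n)) - real (Suc n)) * (\<Sum>i<Suc m. real (Suc (Suc n)) ^ i * real (Suc n) ^ (m - i))"
        by (intro mult_left_mono sum_mono mult_right_mono power_mono) auto
      also have "\<dots> = real (Suc (Suc n)) ^ Suc m - real (Suc n) ^ Suc m"
        by (subst diff_power_eq_sum) (simp add: mult.commute)
      finally show ?thesis .
    qed
    then show ?case using Suc by (simp add: distrib_left)
  qed simp
  have eq: "(\<Sum>k=1..n. (real k / real n) ^ m) / real n = (\<Sum>k=1..n. real k ^ m) / real n ^ Suc m" for n
    by (simp add: power_divide sum_divide_distrib mult.commute)
  show ?thesis
    unfolding eq
  proof (rule tendsto_sandwich)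
    show "\<forall>\<^sub>F n in sequentially. 1 / (real m + 1) \<le> (\<Sum>k=1..n. real k ^ m) / real n ^ Suc m"
      using eventually_gt_at_top[of 0]
    proof eventually_elim
      case (elim n)
      then have "0 < real n ^ Suc m" by simp
      then show ?case using lo[of n] by (simp add: divide_simps mult.commute)
    qed
    show "\<forall>\<^sub>F n in sequentially. (\<Sum>k=1..n. real k ^ m) / real n ^ Suc m \<le> (real (Suc n) / real n) ^ Suc m / (real m + 1)"
      using eventually_gt_at_top[of 0]
    proof eventually_elim
      case (elim n)
      then have "0 < real n ^ Suc m" by simp
      moreover have "0 < real m + 1" by simp
      ultimately show ?case using hi[of n] by (simp only: power_divide) (simp add: divide_simps mult.commute)
    qed
    have "(\<lambda>n. real (Suc n) / real n) \<longlonglongrightarrow> 1" by real_asymp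
    then have "(\<lambda>n. (real (Suc n) / real n) ^ Suc m / (real m + 1)) \<longlonglongrightarrow> 1 ^ Suc m / (real m + 1)"
      by (intro tendsto_intros) auto
    then show "(\<lambda>n. (real (Suc n) / real n) ^ Suc m / (real m + 1)) \<longlonglongrightarrow> 1 / (real m + 1)" by simp
  qed simp
qed

text \<open>The Cholesky factor of the Hilbert matrix $1/(j+l+1)$, that is, the coefficients of the
  monomials in the normalised shifted Legendre polynomials.\<close>

definition hchol :: "nat \<Rightarrow> nat \<Rightarrow> real" where
  "hchol j i = (if i \<le> j then sqrt (2 * real i + 1) * (fact j)\<^sup>2 / (fact (j - i) * fact (j + i + 1)) else 0)"

text \<open>Behind the identity is Parseval in the Legendre basis: both sides are the integral of
  \<open>u^j * u^l\<close> over the unit interval.\<close>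

lemma hchol_sum_aux:
  assumes "j \<le> l"
  shows "(\<Sum>i\<le>j. hchol j i * hchol l i) = 1 / (real j + real l + 1)"
proof -
  \<comment> \<open>the sum telescopes: its terms are \<open>G i - G (Suc i)\<close> for \<open>i < j\<close> and \<open>G j\<close> for \<open>i = j\<close>\<close>
  define G :: "nat \<Rightarrow> real" where
    "G i = (fact j)\<^sup>2 * (fact l)\<^sup>2 / ((real j + real l + 1) * (fact (j - i) * fact (j + i) * fact (l - i) * fact (l + i)))" for i
  have prod: "hchol j i * hchol l i = (2 * real i + 1) * (fact j)\<^sup>2 * (fact l)\<^sup>2 / (fact (j - i) * fact (j + i + 1) * fact (l - i) * fact (l + i + 1))"
    if "i \<le> j" for i
  proof -
    have "sqrt (2 * real i + 1) * sqrt (2 * real i + 1) = 2 * real i + 1" by simp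
    then show ?thesis using that assms by (simp add: hchol_def) (simp add: field_simps)
  qed
  have step: "hchol j i * hchol l i = G i - G (Suc i)" if i: "i < j" for i
  proof -
    obtain a where a: "j - i = Suc a" "j - Suc i = a" using i by (metis Suc_diff_Suc)
    obtain b where b: "l - i = Suc b" "l - Suc i = b" using i assms by (metis Suc_diff_Suc order_less_le_trans)
    have j: "real j = real a + real i + 1" using a i by linarith
    have l: "real l = real b + real i + 1" using b i assms by linarith
    define A B C D :: real where "A = fact a" and "B = fact (j + i)" and "C = fact b" and "D = fact (l + i)"
    have pos: "A > 0" "B > 0" "C > 0" "D > 0" by (simp_all add: A_def B_def C_def D_def)
    have f: "fact (j - i) = (real a + 1) * A" "fact (j + i + 1) = (real j + real i + 1) * B"
      "fact (l - i) = (real b + 1) * C" "fact (l + i + 1) = (real l + real i + 1) * D"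
      "fact (j - Suc i) = A" "fact (j + Suc i) = (real j + real i + 1) * B"
      "fact (l - Suc i) = C" "fact (l + Suc i) = (real l + real i + 1) * D"
      by (simp_all add: a b A_def B_def C_def D_def algebra_simps)
    define F :: real where "F = (fact j)\<^sup>2 * (fact l)\<^sup>2"
    have G1: "G i = F / ((real j + real l + 1) * ((real a + 1) * A * B * ((real b + 1) * C) * D))"
      unfolding G_def f F_def[symmetric] by (simp add: B_def D_def)
    have G2: "G (Suc i) = F / ((real j + real l + 1) * (A * ((real j + real i + 1) * B) * C * ((real l + real i + 1) * D)))"
      unfolding G_def f F_def[symmetric] ..
    have P: "hchol j i * hchol l i = (2 * real i + 1) * F / ((real a + 1) * A * ((real j + real i + 1) * B) * ((real b + 1) * C) * ((real l + real i + 1) * D))"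
      using prod[of i] i unfolding f F_def by simp
    define x y z where "x = real a" and "y = real b" and "z = real i"
    have xyz: "0 \<le> x" "0 \<le> y" "0 \<le> z" by (simp_all add: x_def y_def z_def)
    show ?thesis
      unfolding P G1 G2 j l x_def[symmetric] y_def[symmetric] z_def[symmetric]
      using pos xyz by (simp add: divide_simps add_nonneg_eq_0_iff) (simp add: algebra_simps)
  qed
  have tele: "(\<Sum>i<m. hchol j i * hchol l i) = G 0 - G m" if "m \<le> j" for m
    using that by (induction m) (auto simp: step)
  \<comment> \<open>Separate because natural subtraction gives \<open>j - Suc j = 0\<close>: the
    value \<open>G (Suc j)\<close> is positive, whereas telescoping would require 0.\<close>
  have last: "hchol j j * hchol l j = G j"
  proof -
    have f: "fact (j + j + 1) = (2 * real j + 1) * fact (j + j)" "fact (l + j + 1) = (real j + real l + 1) * fact (l + j)"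
      by (simp_all add: algebra_simps)
    show ?thesis unfolding prod[OF order_refl] G_def f by (simp add: divide_simps)
  qed
  have "(\<Sum>i\<le>j. hchol j i * hchol l i) = (\<Sum>i<j. hchol j i * hchol l i) + hchol j j * hchol l j"
    by (simp add: lessThan_Suc_atMost[symmetric])
  also have "\<dots> = G 0" using tele[of j] last by simp
  also have "\<dots> = 1 / (real j + real l + 1)" by (simp add: G_def power2_eq_square)
  finally show ?thesis .
qed

lemma hchol_sum:
  assumes "j < N" "l < N"
  shows "(\<Sum>i<N. hchol j i * hchol l i) = 1 / (real j + real l + 1)"
proof -
  have *: "(\<Sum>i<N. hchol j i * hchol l i) = 1 / (real j + real l + 1)" if "j < N" "j \<le> l" for j l
    unfolding hchol_sum_aux[OF that(2), symmetric]
    by (rule sum.mono_neutral_right) (use that in \<open>auto simp: hchol_def\<close>)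
  show ?thesis
    using *[of j l] *[of l j] assms by (cases "j \<le> l") (auto simp: mult.commute add.commute)
qed

text \<open>The covariance of the $j$-th and $l$-th derivatives at $0$ of the process with
  covariance $\int_0^1 \cos(u(t-s))\,du$.\<close>

definition cov :: "nat \<Rightarrow> nat \<Rightarrow> real" where
  "cov j l = Re (\<i> ^ j * cnj (\<i> ^ l)) / (real j + real l + 1)"

text \<open>The Fourier multiplier of a linear form in the Taylor coefficients: with
  \<open>u = k / n\<close>, the \<open>j\<close>-th derivative in \<open>t\<close> multiplies
  frequency \<open>k\<close> by the \<open>j\<close>-th power of \<open>\<i> * u\<close>.\<close>

definition qpoly :: "(nat \<Rightarrow> real) \<Rightarrow> nat \<Rightarrow> real \<Rightarrow> complex" where
  "qpoly d N u = (\<Sum>j<N. of_real (d j) * (\<i> * of_real u) ^ j)"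

definition qform :: "(nat \<Rightarrow> real) \<Rightarrow> nat \<Rightarrow> real" where
  "qform d N = (\<Sum>j<N. \<Sum>l<N. d j * d l * cov j l)"

lemma cmod_sum_square:
  "(cmod (\<Sum>j\<in>A. z j))\<^sup>2 = (\<Sum>j\<in>A. \<Sum>l\<in>A. Re (z j * cnj (z l)))"
proof -
  have "complex_of_real ((cmod (\<Sum>j\<in>A. z j))\<^sup>2) = (\<Sum>j\<in>A. \<Sum>l\<in>A. z j * cnj (z l))"
    unfolding complex_norm_square by (simp add: sum_product)
  then show ?thesis by (metis (no_types, lifting) Re_complex_of_real Re_sum sum.cong)
qed

lemma cmod_qpoly_square:
  "(cmod (qpoly d N u))\<^sup>2 = (\<Sum>j<N. \<Sum>l<N. d j * d l * Re (\<i> ^ j * cnj (\<i> ^ l)) * u ^ (j + l))"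
proof -
  have "Re (of_real (d j) * (\<i> * of_real u) ^ j * cnj (of_real (d l) * (\<i> * of_real u) ^ l))
     = d j * d l * Re (\<i> ^ j * cnj (\<i> ^ l)) * u ^ (j + l)" for j l
  proof -
    have "of_real (d j) * (\<i> * of_real u) ^ j * cnj (of_real (d l) * (\<i> * of_real u) ^ l)
      = of_real (d j * d l * u ^ (j + l)) * (\<i> ^ j * cnj (\<i> ^ l))"
      by (simp add: power_mult_distrib power_add mult_ac)
    then show ?thesis by (simp only: Re_complex_of_real times_complex.sel Im_complex_of_real) simp
  qed
  then show ?thesis unfolding qpoly_def cmod_sum_square by simp
qed

lemma qform_riemann:
  "(\<lambda>n. (\<Sum>k=1..n. (cmod (qpoly d N (real k / real n)))\<^sup>2) / real n) \<longlonglongrightarrow> qform d N"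
proof -
  have "(\<Sum>k=1..n. (cmod (qpoly d N (real k / real n)))\<^sup>2) / real n
    = (\<Sum>j<N. \<Sum>l<N. d j * d l * Re (\<i> ^ j * cnj (\<i> ^ l)) * ((\<Sum>k=1..n. (real k / real n) ^ (j + l)) / real n))" for n
  proof -
    have "(\<Sum>k=1..n. (cmod (qpoly d N (real k / real n)))\<^sup>2)
      = (\<Sum>k=1..n. \<Sum>j<N. \<Sum>l<N. d j * d l * Re (\<i> ^ j * cnj (\<i> ^ l)) * (real k / real n) ^ (j + l))"
      by (simp only: cmod_qpoly_square)
    also have "\<dots> = (\<Sum>j<N. \<Sum>k=1..n. \<Sum>l<N. d j * d l * Re (\<i> ^ j * cnj (\<i> ^ l)) * (real k / real n) ^ (j + l))"
      by (rule sum.swap)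
    also have "\<dots> = (\<Sum>j<N. \<Sum>l<N. \<Sum>k=1..n. d j * d l * Re (\<i> ^ j * cnj (\<i> ^ l)) * (real k / real n) ^ (j + l))"
      by (intro sum.cong refl sum.swap)
    finally show ?thesis by (simp only: sum_distrib_left sum_divide_distrib times_divide_eq_right)
  qed
  moreover have "(\<lambda>n. \<Sum>j<N. \<Sum>l<N. d j * d l * Re (\<i> ^ j * cnj (\<i> ^ l)) * ((\<Sum>k=1..n. (real k / real n) ^ (j + l)) / real n))
     \<longlonglongrightarrow> (\<Sum>j<N. \<Sum>l<N. d j * d l * Re (\<i> ^ j * cnj (\<i> ^ l)) * (1 / (real (j + l) + 1)))"
    by (intro tendsto_sum tendsto_mult tendsto_const power_sum_limit)
  ultimately show ?thesis by (simp add: qform_def cov_def)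
qed

text \<open>In this form dominated convergence applies once the polynomial is replaced by an
  exponential sum, see \<open>qform_tcoef_limit\<close>.\<close>

lemma qform_integral:
  "qform d N = (LINT u|lborel. indicator {0..1} u * (cmod (qpoly d N u))\<^sup>2)"
proof -
  have i: "integrable lborel (\<lambda>u::real. u ^ m * indicator {0..1} u)" for m
    using borel_integrable_atLeastAtMost[of 0 1 "\<lambda>u::real. u ^ m"] by (auto simp: mult.commute)
  have "(LINT u|lborel. indicator {0..1} u * (cmod (qpoly d N u))\<^sup>2)
    = (LINT u|lborel. (\<Sum>j<N. \<Sum>l<N. d j * d l * Re (\<i> ^ j * cnj (\<i> ^ l)) * (u ^ (j + l) * indicator {0..1} u)))"
    unfolding cmod_qpoly_square by (simp add: sum_distrib_left mult_ac)
  also have "\<dots> = (\<Sum>j<N. \<Sum>l<N. d j * d l * Re (\<i> ^ j * cnj (\<i> ^ l)) * (LINT u|lborel. u ^ (j + l) * indicator {0..1} u))"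
    by (simp add: i)
  also have "\<dots> = qform d N"
    unfolding qform_def cov_def by (subst integral_power) (simp_all add: add_ac)
  finally show ?thesis by simp
qed

section \<open>Gaussian noise and the random Taylor coefficients of the limit\<close>

abbreviation noise :: "(nat + nat \<Rightarrow> real) measure" where
  "noise \<equiv> Pi\<^sub>M UNIV (\<lambda>_. std_normal_distribution)"

lemma prob_space_std_normal: "prob_space std_normal_distribution"
  using real_dist_normal_dist by (simp add: real_distribution_def)

interpretation noise: product_prob_space "\<lambda>_ :: nat + nat. std_normal_distribution" UNIV
  by (rule product_prob_spaceI) (rule prob_space_std_normal)

lemma noise_coord: "(\<lambda>\<xi>. \<xi> i) \<in> borel_measurable noise"
proof -
  have "(\<lambda>\<xi>. \<xi> i) \<in> measurable noise std_normal_distribution" by measurable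
  then show ?thesis by (simp cong: measurable_cong_sets)
qed

lemma noise_distr: "distr noise borel (\<lambda>\<xi>. \<xi> i) = std_normal_distribution"
proof -
  have "distr noise borel (\<lambda>\<xi>. \<xi> i) = distr noise std_normal_distribution (\<lambda>\<xi>. \<xi> i)"
    by (rule distr_cong) auto
  also have "\<dots> = std_normal_distribution" by (rule noise.PiM_component) simp
  finally show ?thesis .
qed

lemma noise_indep: "noise.P.indep_vars (\<lambda>_. borel) (\<lambda>i \<xi>. \<xi> i) UNIV"
proof (subst noise.P.indep_vars_iff_distr_eq_PiM')
  show "(\<lambda>\<xi>. \<xi> i) \<in> borel_measurable noise" for i by (rule noise_coord)
  have "distr noise (Pi\<^sub>M UNIV (\<lambda>_. borel)) (\<lambda>x. \<lambda>i\<in>UNIV. x i) = distr noise noise (\<lambda>x. x)"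
    by (rule distr_cong) (auto intro!: sets_PiM_cong)
  also have "\<dots> = noise" by (rule distr_id)
  finally show "distr noise (Pi\<^sub>M UNIV (\<lambda>_. borel)) (\<lambda>x. \<lambda>i\<in>UNIV. x i) = Pi\<^sub>M UNIV (\<lambda>i. distr noise borel (\<lambda>\<xi>. \<xi> i))"
    by (simp add: noise_distr)
qed auto

text \<open>For standard normal variables the approximation lemma holds with constant
  \<open>C = 0\<close>, so it becomes an exact formula.\<close>

lemma noise_char_sum:
  assumes "finite I"
  shows "noise.P.expectation (\<lambda>\<xi>. iexp (\<Sum>i\<in>I. w i * \<xi> i)) = exp (- (\<Sum>i\<in>I. (w i)\<^sup>2) / 2)"
proof -
  have "cmod (noise.P.expectation (\<lambda>\<xi>. iexp (\<Sum>i\<in>I. w i * \<xi> i)) - exp (- 1 * (\<Sum>i\<in>I. (w i)\<^sup>2) / 2))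
    \<le> real (card I) * (0 * (\<Sum>i\<in>I. \<bar>w i\<bar>) ^ 3)"
  proof (rule noise.P.expectation_iexp_sum_approx[OF assms])
    show "noise.P.indep_vars (\<lambda>_. borel) (\<lambda>i \<xi>. \<xi> i) I"
      by (rule noise.P.indep_vars_subset[OF noise_indep]) simp
    show "cmod (char (distr noise borel (\<lambda>\<xi>. \<xi> i)) s - exp (- 1 * s\<^sup>2 / 2)) \<le> 0 * \<bar>s\<bar> ^ 3" for i s
      unfolding noise_distr char_std_normal_distribution by simp
    show "\<bar>w i\<bar> \<le> (\<Sum>i\<in>I. \<bar>w i\<bar>)" if "i \<in> I" for i
      by (rule member_le_sum) (use assms that in auto)
  qed (auto intro: order_refl)
  then show ?thesis by simp
qed

lemma noise_square_sum:
  assumes "finite I"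
  shows "integrable noise (\<lambda>\<xi>. (\<Sum>i\<in>I. w i * \<xi> i)\<^sup>2)"
    "noise.P.expectation (\<lambda>\<xi>. (\<Sum>i\<in>I. w i * \<xi> i)\<^sup>2) = (\<Sum>i\<in>I. (w i)\<^sup>2)"
proof -
  have tr: "integrable noise (\<lambda>\<xi>. f (\<xi> i)) \<longleftrightarrow> integrable std_normal_distribution f"
    "noise.P.expectation (\<lambda>\<xi>. f (\<xi> i)) = (LINT x|std_normal_distribution. f x)"
    if "f \<in> borel_measurable borel" for f :: "real \<Rightarrow> real" and i
    using integrable_distr_eq[OF noise_coord that, of i] integral_distr[OF noise_coord that, of i]
    unfolding noise_distr by auto
  have m1: "integrable noise (\<lambda>\<xi>. \<xi> i)" "noise.P.expectation (\<lambda>\<xi>. \<xi> i) = 0" for i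
    using tr[of "\<lambda>x. x" i] integrable_std_normal_distribution_moment[of 1] integral_std_normal_distribution_moment_odd[of 1]
    by simp_all
  have m2: "integrable noise (\<lambda>\<xi>. (\<xi> i)\<^sup>2)" "noise.P.expectation (\<lambda>\<xi>. (\<xi> i)\<^sup>2) = 1" for i
    using tr[of "\<lambda>x. x\<^sup>2" i] integrable_std_normal_distribution_moment[of 2] std_normal_distribution_even_moments(1)[of 1]
    by simp_all
  have ind: "noise.P.indep_vars (\<lambda>_. borel) (\<lambda>i \<xi>. w i * \<xi> i) I"
    by (rule noise.P.indep_vars_compose2[where Y="\<lambda>i x. w i * x", OF noise.P.indep_vars_subset[OF noise_indep]]) auto
  note S = noise.P.indep_vars_sum_square[OF assms ind]
  show "integrable noise (\<lambda>\<xi>. (\<Sum>i\<in>I. w i * \<xi> i)\<^sup>2)"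
    by (rule S) (simp_all add: m1 m2 power_mult_distrib)
  have "noise.P.expectation (\<lambda>\<xi>. (\<Sum>i\<in>I. w i * \<xi> i)\<^sup>2) = (\<Sum>i\<in>I. noise.P.expectation (\<lambda>\<xi>. (w i * \<xi> i)\<^sup>2))"
    by (rule S) (simp_all add: m1 m2 power_mult_distrib)
  also have "\<dots> = (\<Sum>i\<in>I. (w i)\<^sup>2)"
    by (intro sum.cong refl) (simp add: m2 power_mult_distrib)
  finally show "noise.P.expectation (\<lambda>\<xi>. (\<Sum>i\<in>I. w i * \<xi> i)\<^sup>2) = (\<Sum>i\<in>I. (w i)\<^sup>2)" .
qed

text \<open>\<open>hchol\<close> produces the Hilbert matrix entry of \<open>cov\<close>. The powers
  of \<open>\<i>\<close> send even orders to the \<open>Inl\<close> family and odd orders to the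
  independent \<open>Inr\<close> family, which yields the signs and the vanishing covariance between
  orders of different parity.\<close>

definition gseq :: "(nat + nat \<Rightarrow> real) \<Rightarrow> nat \<Rightarrow> real" where
  "gseq \<xi> j = (\<Sum>i\<le>j. hchol j i * (Re (\<i> ^ j) * \<xi> (Inl i) + Im (\<i> ^ j) * \<xi> (Inr i)))"

lemma measurable_gseq_coord [measurable]: "(\<lambda>\<xi>. gseq \<xi> j) \<in> borel_measurable noise"
proof -
  note noise_coord [measurable]
  show ?thesis unfolding gseq_def by measurable
qed

lemma measurable_gseq [measurable]: "gseq \<in> borel_measurable noise"
  by (rule measurable_coordinatewise_then_product) measurable

text \<open>The coordinates of \<open>qpoly d N\<close> in the orthonormal Legendre basis of the
  unit interval; \<open>pcoef_qform\<close> is Parseval for them.\<close>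

definition pcoef :: "(nat \<Rightarrow> real) \<Rightarrow> nat \<Rightarrow> nat \<Rightarrow> complex" where
  "pcoef d N i = (\<Sum>j<N. of_real (d j * hchol j i) * \<i> ^ j)"

lemma gseq_lin:
  "(\<Sum>j<N. d j * gseq \<xi> j) = (\<Sum>i\<in>Inl ` {..<N} \<union> Inr ` {..<N}. (case i of Inl k \<Rightarrow> Re (pcoef d N k) | Inr k \<Rightarrow> Im (pcoef d N k)) * \<xi> i)"
proof -
  have g: "gseq \<xi> j = (\<Sum>i<N. hchol j i * (Re (\<i> ^ j) * \<xi> (Inl i) + Im (\<i> ^ j) * \<xi> (Inr i)))" if "j < N" for j
    unfolding gseq_def by (rule sum.mono_neutral_left) (use that in \<open>auto simp: hchol_def\<close>)
  have "(\<Sum>j<N. d j * gseq \<xi> j) = (\<Sum>j<N. \<Sum>i<N. d j * (hchol j i * (Re (\<i> ^ j) * \<xi> (Inl i) + Im (\<i> ^ j) * \<xi> (Inr i))))"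
    by (intro sum.cong refl) (simp add: g sum_distrib_left)
  also have "\<dots> = (\<Sum>i<N. \<Sum>j<N. d j * (hchol j i * (Re (\<i> ^ j) * \<xi> (Inl i) + Im (\<i> ^ j) * \<xi> (Inr i))))"
    by (rule sum.swap)
  also have "\<dots> = (\<Sum>i<N. Re (pcoef d N i) * \<xi> (Inl i) + Im (pcoef d N i) * \<xi> (Inr i))"
    by (intro sum.cong refl)
      (simp add: pcoef_def sum.distrib sum_distrib_left distrib_left mult_ac)
  finally show ?thesis by (simp add: sum_Inl_Inr)
qed

lemma pcoef_qform: "(\<Sum>i<N. (cmod (pcoef d N i))\<^sup>2) = qform d N"
proof -
  have "(\<Sum>i<N. (cmod (pcoef d N i))\<^sup>2)
    = (\<Sum>i<N. \<Sum>j<N. \<Sum>l<N. d j * d l * Re (\<i> ^ j * cnj (\<i> ^ l)) * (hchol j i * hchol l i))"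
  proof -
    have "Re (of_real (d j * hchol j i) * \<i> ^ j * cnj (of_real (d l * hchol l i) * \<i> ^ l))
      = d j * d l * Re (\<i> ^ j * cnj (\<i> ^ l)) * (hchol j i * hchol l i)" for j l i
    proof -
      have "of_real (d j * hchol j i) * \<i> ^ j * cnj (of_real (d l * hchol l i) * \<i> ^ l)
        = of_real (d j * d l * (hchol j i * hchol l i)) * (\<i> ^ j * cnj (\<i> ^ l))"
        by (simp add: mult_ac)
      then show ?thesis by (simp only: Re_complex_of_real times_complex.sel Im_complex_of_real) simp
    qed
    then show ?thesis unfolding pcoef_def cmod_sum_square by simp
  qed
  also have "\<dots> = (\<Sum>j<N. \<Sum>i<N. \<Sum>l<N. d j * d l * Re (\<i> ^ j * cnj (\<i> ^ l)) * (hchol j i * hchol l i))"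
    by (rule sum.swap)
  also have "\<dots> = (\<Sum>j<N. \<Sum>l<N. \<Sum>i<N. d j * d l * Re (\<i> ^ j * cnj (\<i> ^ l)) * (hchol j i * hchol l i))"
    by (intro sum.cong refl sum.swap)
  also have "\<dots> = qform d N"
    unfolding qform_def sum_distrib_left[symmetric] by (intro sum.cong refl) (simp add: hchol_sum cov_def)
  finally show ?thesis .
qed

lemma gseq_variance_sum:
  "(\<Sum>i\<in>Inl ` {..<N} \<union> Inr ` {..<N}. (case i of Inl k \<Rightarrow> Re (pcoef d N k) | Inr k \<Rightarrow> Im (pcoef d N k))\<^sup>2) = qform d N"
  by (simp add: sum_Inl_Inr pcoef_qform flip: cmod_power2)

lemma gseq_char:
  "noise.P.expectation (\<lambda>\<xi>. iexp (\<Sum>j<N. d j * gseq \<xi> j)) = exp (- qform d N / 2)"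
  unfolding gseq_lin by (subst noise_char_sum) (simp_all add: gseq_variance_sum)

lemma gseq_second_moment:
  "integrable noise (\<lambda>\<xi>. (gseq \<xi> j)\<^sup>2)" "noise.P.expectation (\<lambda>\<xi>. (gseq \<xi> j)\<^sup>2) \<le> 1"
proof -
  let ?d = "\<lambda>i. if i = j then 1 else 0 :: real"
  have e: "gseq \<xi> j = (\<Sum>i<Suc j. ?d i * gseq \<xi> i)" for \<xi> by simp
  show "integrable noise (\<lambda>\<xi>. (gseq \<xi> j)\<^sup>2)"
    unfolding e gseq_lin by (rule noise_square_sum) simp
  have "noise.P.expectation (\<lambda>\<xi>. (gseq \<xi> j)\<^sup>2) = qform ?d (Suc j)"
    unfolding e gseq_lin gseq_variance_sum[symmetric] by (rule noise_square_sum) simp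
  also have "qform ?d (Suc j) = cov j j"
    unfolding qform_def by (simp add: if_distrib[where f="\<lambda>x. x * _"] if_distrib[where f="\<lambda>x. _ * x"] cong: if_cong)
  also have "cov j j = (cmod (\<i> ^ j))\<^sup>2 / (real j + real j + 1)"
    unfolding cov_def by (simp add: complex_norm_square[symmetric] del: complex_cnj_power) 
  also have "\<dots> \<le> 1" by (simp add: norm_power)
  finally show "noise.P.expectation (\<lambda>\<xi>. (gseq \<xi> j)\<^sup>2) \<le> 1" .
qed

lemma gseq_tail:
  assumes "r > 0"
  shows "noise.P.prob {\<xi> \<in> space noise. \<bar>gseq \<xi> j\<bar> > r} \<le> 1 / r\<^sup>2"
proof -
  have "noise.P.prob {\<xi> \<in> space noise. \<bar>gseq \<xi> j\<bar> > r} \<le> noise.P.prob {\<xi> \<in> space noise. \<bar>gseq \<xi> j\<bar> \<ge> r}"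
    by (rule noise.P.finite_measure_mono) auto
  also have "\<dots> \<le> noise.P.expectation (\<lambda>\<xi>. (gseq \<xi> j)\<^sup>2) / r\<^sup>2"
    by (rule noise.P.second_moment_method) (use gseq_second_moment assms in auto)
  also have "\<dots> \<le> 1 / r\<^sup>2" by (intro divide_right_mono gseq_second_moment) simp
  finally show ?thesis .
qed

text \<open>The mass outside \<open>cube n\<close> is at most \<open>2 / n^2\<close>. Hence almost
  every sample lies where \<open>Phi0\<close> is a genuine convergent Taylor series.\<close>

lemma gseq_in_cubes: "AE \<xi> in noise. gseq \<xi> \<in> cubes"
proof -
  let ?P = "distr noise borel gseq"
  have P: "prob_space ?P" by (rule noise.P.prob_space_distr) measurable
  interpret P: prob_space ?P by fact
  have coord: "(\<lambda>y::nat \<Rightarrow> real. y j) \<in> borel_measurable borel" for j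
    by (intro borel_measurable_continuous_onI continuous_on_product_coordinates)
  have tail: "P.prob {y\<in>space ?P. \<bar>y j\<bar> > r} \<le> 1 / r\<^sup>2" if "r > 0" for j r
  proof -
    note coord[measurable]
    have "P.prob {y\<in>space ?P. \<bar>y j\<bar> > r} = noise.P.prob (gseq -` {y\<in>space ?P. \<bar>y j\<bar> > r} \<inter> space noise)"
      by (rule measure_distr) measurable
    also have "gseq -` {y\<in>space ?P. \<bar>y j\<bar> > r} \<inter> space noise = {\<xi> \<in> space noise. \<bar>gseq \<xi> j\<bar> > r}" by auto
    finally show ?thesis using gseq_tail[OF that] by simp
  qed
  have cm[measurable]: "cubes \<in> sets borel" unfolding cubes_def by measurable
  have "P.prob (space ?P - cubes) \<le> 2 / (real n)\<^sup>2" if "n > 0" for n :: nat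
  proof -
    have "P.prob (space ?P - cubes) \<le> P.prob (space ?P - cube (real n))"
      using cube_subset_cubes by (intro P.finite_measure_mono) auto
    also have "\<dots> \<le> 2 * 1 / (real n)\<^sup>2"
      by (rule cube_tail[OF P _ tail]) (use that in auto)
    finally show ?thesis by simp
  qed
  then have "P.prob (space ?P - cubes) \<le> 0"
    by (intro LIMSEQ_le_const[of "\<lambda>n. 2 / (real n)\<^sup>2"] exI[of _ 1]) (real_asymp, auto)
  then have "P.prob (space ?P - cubes) = 0" by (simp add: antisym measure_nonneg)
  then have "P.prob cubes = 1" using P.prob_compl[of cubes] by simp
  then have "AE y in ?P. y \<in> cubes" by (subst (asm) P.prob_eq_1) auto
  then show ?thesis by (subst (asm) AE_distr_iff) auto
qed

section \<open>Finite-dimensional laws and the sinc covariance\<close>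

lemma integral_cos_sinc: "(LINT u|lborel. indicator {0..1} u * cos (x * u)) = sinc_cov x"
proof (cases "x = 0")
  case True
  then show ?thesis by (simp add: sinc_cov_def)
next
  case False
  have "(LINT u|lborel. indicator {0..1} u *\<^sub>R cos (x * u)) = sin (x * 1) / x - sin (x * 0) / x"
  proof (rule integral_FTC_Icc)
    show "((\<lambda>u. sin (x * u) / x) has_vector_derivative cos (x * u)) (at u within {0..1})" for u
      by (subst has_real_derivative_iff_has_vector_derivative[symmetric])
        (auto intro!: derivative_eq_intros simp: False)
  qed (auto intro!: continuous_intros)
  then show ?thesis using False by (simp add: sinc_cov_def)
qed

text \<open>A combination of point evaluations, rewritten as a linear form in Taylor coefficients.
  It generally has infinite support, hence the limits over cut-offs \<open>N\<close> below.\<close>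

definition tcoef :: "real set \<Rightarrow> (real \<Rightarrow> real) \<Rightarrow> nat \<Rightarrow> real" where
  "tcoef T c j = (\<Sum>t\<in>T. c t * (t ^ j / fact j))"

lemma qpoly_tcoef:
  "qpoly (tcoef T c) N u = (\<Sum>t\<in>T. of_real (c t) * (\<Sum>j<N. (\<i> * of_real (t * u)) ^ j /\<^sub>R fact j))"
proof -
  have "qpoly (tcoef T c) N u = (\<Sum>j<N. \<Sum>t\<in>T. of_real (c t) * ((\<i> * of_real (t * u)) ^ j /\<^sub>R fact j))"
    unfolding qpoly_def tcoef_def
    by (intro sum.cong refl) (simp add: sum_distrib_left sum_distrib_right scaleR_conv_of_real power_mult_distrib divide_inverse mult_ac)
  also have "\<dots> = (\<Sum>t\<in>T. \<Sum>j<N. of_real (c t) * ((\<i> * of_real (t * u)) ^ j /\<^sub>R fact j))"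
    by (rule sum.swap)
  finally show ?thesis by (simp add: sum_distrib_left)
qed

text \<open>The polynomials tend to the exponential sum \<open>w\<close>, dominated through
  \<open>exp \<bar>t\<bar>\<close>. Expanding the squared modulus of \<open>w\<close> leaves
  integrals of \<open>cos ((s - v) * u)\<close> over the unit interval, which are the sinc
  values.\<close>

lemma qform_tcoef_limit:
  assumes T: "finite T"
  shows "(\<lambda>N. qform (tcoef T c) N) \<longlonglongrightarrow> (\<Sum>s\<in>T. \<Sum>u\<in>T. c s * c u * sinc_cov (s - u))"
proof -
  define w where "w u = (\<Sum>t\<in>T. of_real (c t) * cis (t * u))" for u
  define K where "K = (\<Sum>t\<in>T. \<bar>c t\<bar> * exp \<bar>t\<bar>)"
  have lim: "(\<lambda>N. qpoly (tcoef T c) N u) \<longlonglongrightarrow> w u" for u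
    unfolding qpoly_tcoef w_def cis_conv_exp
    by (intro tendsto_sum tendsto_mult tendsto_const) (use exp_converges in \<open>auto simp: sums_def\<close>)
  have bnd: "cmod (qpoly (tcoef T c) N u) \<le> K" if u: "u \<in> {0..1}" for N u
  proof -
    have e: "cmod (\<Sum>j<N. (\<i> * of_real (t * u)) ^ j /\<^sub>R fact j) \<le> exp \<bar>t\<bar>" for t
    proof -
      have "cmod (\<Sum>j<N. (\<i> * of_real (t * u)) ^ j /\<^sub>R fact j) \<le> (\<Sum>j<N. cmod ((\<i> * of_real (t * u)) ^ j /\<^sub>R fact j))"
        by (rule norm_sum)
      also have "\<dots> \<le> (\<Sum>j<N. \<bar>t\<bar> ^ j /\<^sub>R fact j)"
      proof (rule sum_mono)
        fix j
        have "\<bar>t * u\<bar> \<le> \<bar>t\<bar>" using u by (simp add: abs_mult mult_left_le)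
        then have "\<bar>t * u\<bar> ^ j \<le> \<bar>t\<bar> ^ j" by (rule power_mono) simp
        then show "cmod ((\<i> * of_real (t * u)) ^ j /\<^sub>R fact j) \<le> \<bar>t\<bar> ^ j /\<^sub>R fact j"
          by (simp add: norm_power norm_mult abs_mult mult_left_mono del: of_real_mult)
      qed
      also have "\<dots> \<le> (\<Sum>j. \<bar>t\<bar> ^ j /\<^sub>R fact j)"
        by (rule sum_le_suminf[OF summable_exp_generic]) auto
      finally show ?thesis by (simp add: exp_def)
    qed
    have "cmod (qpoly (tcoef T c) N u) \<le> (\<Sum>t\<in>T. cmod (of_real (c t) * (\<Sum>j<N. (\<i> * of_real (t * u)) ^ j /\<^sub>R fact j)))"
      unfolding qpoly_tcoef by (rule norm_sum)
    also have "\<dots> \<le> K" unfolding K_def norm_mult norm_of_real by (intro sum_mono mult_left_mono e) auto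
    finally show ?thesis .
  qed
  have meas: "(\<lambda>u. indicator {0..1} u * (cmod (qpoly (tcoef T c) N u))\<^sup>2) \<in> borel_measurable lborel" for N
  proof -
    have "(\<lambda>u. (cmod (qpoly (tcoef T c) N u))\<^sup>2) \<in> borel_measurable borel"
      unfolding qpoly_def by (intro borel_measurable_continuous_onI continuous_intros)
    then show ?thesis by (intro borel_measurable_times borel_measurable_indicator) auto
  qed
  have "(\<lambda>N. LINT u|lborel. indicator {0..1} u * (cmod (qpoly (tcoef T c) N u))\<^sup>2)
      \<longlonglongrightarrow> (LINT u|lborel. indicator {0..1} u * (cmod (w u))\<^sup>2)"
  proof (rule integral_dominated_convergence[where w="\<lambda>u. indicator {0..1} u * K\<^sup>2"])
    show "(\<lambda>u. indicator {0..1} u * (cmod (w u))\<^sup>2) \<in> borel_measurable lborel"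
    proof -
      have "(\<lambda>u. (cmod (w u))\<^sup>2) \<in> borel_measurable borel"
        unfolding w_def by (intro borel_measurable_continuous_onI continuous_intros)
      then show ?thesis by (intro borel_measurable_times borel_measurable_indicator) auto
    qed
    show "AE u in lborel. (\<lambda>N. indicator {0..1} u * (cmod (qpoly (tcoef T c) N u))\<^sup>2) \<longlonglongrightarrow> indicator {0..1} u * (cmod (w u))\<^sup>2"
      by (intro AE_I2 tendsto_intros lim)
    show "AE u in lborel. norm (indicator {0..1} u * (cmod (qpoly (tcoef T c) N u))\<^sup>2) \<le> indicator {0..1} u * K\<^sup>2" for N
    proof (rule AE_I2)
      fix u :: real
      show "norm (indicator {0..1} u * (cmod (qpoly (tcoef T c) N u))\<^sup>2) \<le> indicator {0..1} u * K\<^sup>2"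
        using power_mono[OF bnd[of u N] norm_ge_zero, of 2] by (auto simp: indicator_def)
    qed
  qed (use meas in auto)
  also have "(LINT u|lborel. indicator {0..1} u * (cmod (w u))\<^sup>2)
     = (LINT u|lborel. (\<Sum>s\<in>T. \<Sum>v\<in>T. c s * c v * (indicator {0..1} u * cos ((s - v) * u))))"
  proof (rule Bochner_Integration.integral_cong)
    fix u :: real
    have "Re (of_real (c s) * cis (s * u) * cnj (of_real (c v) * cis (v * u))) = c s * c v * cos ((s - v) * u)" for s v
      by (simp add: left_diff_distrib cos_diff algebra_simps)
    then have "(cmod (w u))\<^sup>2 = (\<Sum>s\<in>T. \<Sum>v\<in>T. c s * c v * cos ((s - v) * u))"
      unfolding w_def cmod_sum_square by (simp only:)
    then show "indicator {0..1} u * (cmod (w u))\<^sup>2 = (\<Sum>s\<in>T. \<Sum>v\<in>T. c s * c v * (indicator {0..1} u * cos ((s - v) * u)))"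
      by (simp add: sum_distrib_left mult_ac)
  qed simp
  also have "\<dots> = (\<Sum>s\<in>T. \<Sum>v\<in>T. c s * c v * sinc_cov (s - v))"
  proof -
    have "integrable lborel (\<lambda>u. indicator {0..1} u * cos (x * u))" for x :: real
      using borel_integrable_atLeastAtMost[of 0 1 "\<lambda>u::real. cos (x * u)"] by (simp add: mult.commute)
    then show ?thesis by (simp add: integral_cos_sinc)
  qed
  finally show ?thesis unfolding qform_integral .
qed

lemma qform_nonneg: "0 \<le> qform d N"
  unfolding pcoef_qform[symmetric] by (simp add: sum_nonneg)

lemma qform_scale: "qform (\<lambda>j. s * d j) N = s\<^sup>2 * qform d N"
  unfolding qform_def sum_distrib_left by (intro sum.cong refl) (simp add: power2_eq_square mult_ac)

definition gauss_mu :: "C1code measure" where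
  "gauss_mu = distr noise borel (\<lambda>\<xi>. Phi0 (gseq \<xi>))"

lemma measurable_Phi0_gseq [measurable]: "(\<lambda>\<xi>. Phi0 (gseq \<xi>)) \<in> borel_measurable noise"
  by (rule measurable_compose[OF measurable_gseq measurable_Phi0])

lemma measurable_eval: "(\<lambda>p :: C1code. \<Sum>t\<in>T. c t * apply_bcontfun (fst p) t) \<in> borel_measurable borel"
  by (intro borel_measurable_continuous_onI continuous_on_sum continuous_on_mult continuous_on_const
      linear_continuous_on bounded_linear_eval_fst)

text \<open>The characteristic functions of the cut-off Taylor sums have two limits: the left-hand
  side, by almost sure convergence of the Taylor series, and the right-hand side, by the explicit
  formula \<open>gseq_char\<close>.\<close>

lemma gauss_mu_char:
  assumes T: "finite T" "T \<subseteq> {0..2*pi}"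
  shows "char (distr gauss_mu borel (\<lambda>p. \<Sum>t\<in>T. c t * apply_bcontfun (fst p) t)) s
    = exp (- (\<Sum>s\<in>T. \<Sum>u\<in>T. c s * c u * sinc_cov (s - u)) * s\<^sup>2 / 2)"
proof -
  define V where "V = (\<Sum>s\<in>T. \<Sum>u\<in>T. c s * c u * sinc_cov (s - u))"
  define L where "L p = (\<Sum>t\<in>T. c t * apply_bcontfun (fst p) t)" for p :: C1code
  have Lm[measurable]: "L \<in> borel_measurable borel" unfolding L_def by (rule measurable_eval)
  have "char (distr gauss_mu borel L) s = noise.P.expectation (\<lambda>\<xi>. iexp (s * L (Phi0 (gseq \<xi>))))"
    unfolding gauss_mu_def char_def
    by (subst distr_distr) (auto simp: integral_distr comp_def)
  moreover have lim1: "(\<lambda>N. noise.P.expectation (\<lambda>\<xi>. iexp (\<Sum>j<N. (s * tcoef T c j) * gseq \<xi> j)))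
    \<longlonglongrightarrow> noise.P.expectation (\<lambda>\<xi>. iexp (s * L (Phi0 (gseq \<xi>))))"
  proof (rule integral_dominated_convergence[where w="\<lambda>_. 1"])
    show "AE \<xi> in noise. (\<lambda>N. iexp (\<Sum>j<N. (s * tcoef T c j) * gseq \<xi> j)) \<longlonglongrightarrow> iexp (s * L (Phi0 (gseq \<xi>)))"
      using gseq_in_cubes
    proof eventually_elim
      case (elim \<xi>)
      then obtain R :: nat where R: "gseq \<xi> \<in> cube R" by (auto simp: cubes_def)
      have L: "L (Phi0 (gseq \<xi>)) = (\<Sum>t\<in>T. c t * egf (gseq \<xi>) t)"
        unfolding L_def Phi0_eq[OF R] Phi_apply[OF R] using T(2)
        by (intro sum.cong refl) (auto simp: clamp02pi_id)
      have e: "(\<Sum>j<N. (s * tcoef T c j) * gseq \<xi> j) = s * (\<Sum>t\<in>T. c t * (\<Sum>j<N. gseq \<xi> j / fact j * t ^ j))" for N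
      proof -
        have "(\<Sum>j<N. (s * tcoef T c j) * gseq \<xi> j) = (\<Sum>j<N. \<Sum>t\<in>T. s * (c t * (gseq \<xi> j / fact j * t ^ j)))"
          by (intro sum.cong refl) (simp add: tcoef_def sum_distrib_left sum_distrib_right mult_ac)
        also have "\<dots> = (\<Sum>t\<in>T. \<Sum>j<N. s * (c t * (gseq \<xi> j / fact j * t ^ j)))" by (rule sum.swap)
        finally show ?thesis by (simp add: sum_distrib_left)
      qed
      have "(\<lambda>N. \<Sum>j<N. gseq \<xi> j / fact j * t ^ j) \<longlonglongrightarrow> egf (gseq \<xi>) t" for t
        unfolding egf_def by (rule summable_LIMSEQ[OF summable_egf[OF R]])
      then show ?case unfolding e L by (intro tendsto_intros)
    qed
    show "(\<lambda>\<xi>. iexp (s * L (Phi0 (gseq \<xi>)))) \<in> borel_measurable noise" by measurable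
    show "(\<lambda>\<xi>. iexp (\<Sum>j<N. (s * tcoef T c j) * gseq \<xi> j)) \<in> borel_measurable noise" for N by measurable
  qed auto
  moreover have lim2: "(\<lambda>N. noise.P.expectation (\<lambda>\<xi>. iexp (\<Sum>j<N. (s * tcoef T c j) * gseq \<xi> j))) \<longlonglongrightarrow> exp (- V * s\<^sup>2 / 2)"
  proof -
    have "(\<lambda>N. complex_of_real (exp (- (s\<^sup>2 * qform (tcoef T c) N) / 2))) \<longlonglongrightarrow> complex_of_real (exp (- (s\<^sup>2 * V) / 2))"
      unfolding V_def by (intro tendsto_intros qform_tcoef_limit T) simp
    then show ?thesis by (simp only: gseq_char qform_scale) (simp add: mult.commute)
  qed
  ultimately have "char (distr gauss_mu borel L) s = exp (- V * s\<^sup>2 / 2)"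
    using LIMSEQ_unique[OF lim1 lim2] by simp
  then show ?thesis unfolding L_def V_def .
qed

lemma Phi0_in_C1space: "Phi0 y \<in> C1space"
proof -
  have "(\<lambda>_. 0) \<in> cube (real 0)" by (simp add: cube_def)
  then have "(if y \<in> cubes then y else (\<lambda>_. 0)) \<in> cubes"
    using cube_subset_cubes by auto
  then obtain R :: nat where "(if y \<in> cubes then y else (\<lambda>_. 0)) \<in> cube R"
    unfolding cubes_def by blast
  then show ?thesis unfolding Phi0_def by (rule Phi_in_C1space)
qed

lemma gauss_mu_law: "centered_gaussian_C1_law (\<lambda>t s. sinc_cov (t - s)) gauss_mu"
  unfolding centered_gaussian_C1_law_def
proof (intro conjI allI impI, goal_cases)
  case 1
  show ?case by (simp add: gauss_mu_def)
next
  case 2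
  show P: ?case unfolding gauss_mu_def by (rule noise.P.prob_space_distr) measurable
next
  case 3
  have "C1space \<in> sets borel" using closed_C1space by (rule borel_closed)
  then have "emeasure gauss_mu C1space = emeasure noise ((\<lambda>\<xi>. Phi0 (gseq \<xi>)) -` C1space \<inter> space noise)"
    unfolding gauss_mu_def by (intro emeasure_distr) auto
  also have "(\<lambda>\<xi>. Phi0 (gseq \<xi>)) -` C1space \<inter> space noise = space noise"
    using Phi0_in_C1space by auto
  finally show ?case by (simp add: noise.P.emeasure_space_1)
next
  case (4 T c)
  let ?V = "\<Sum>s\<in>T. \<Sum>u\<in>T. c s * c u * sinc_cov (s - u)"
  let ?L = "\<lambda>p :: C1code. \<Sum>t\<in>T. c t * apply_bcontfun (fst p) t"
  have T: "finite T" "T \<subseteq> {0..2*pi}" using 4 by auto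
  \<comment> \<open>Nonnegative as a limit of the forms \<open>qform\<close>; this makes
    \<open>centered_normal ?V\<close> a probability measure.\<close>
  have V: "0 \<le> ?V"
    by (rule LIMSEQ_le_const[OF qform_tcoef_limit[OF T(1)]]) (auto intro: qform_nonneg)
  interpret mu: prob_space gauss_mu unfolding gauss_mu_def by (rule noise.P.prob_space_distr) measurable
  have Lm: "?L \<in> borel_measurable gauss_mu"
    using measurable_eval[of c T] by (simp add: gauss_mu_def)
  show ?case
  proof (rule Levy_uniqueness)
    show "real_distribution (distr gauss_mu borel ?L)"
      by (rule mu.real_distribution_distr[OF Lm])
    interpret N: prob_space "centered_normal ?V" by (rule prob_space_centered_normal[OF V])
    show "real_distribution (centered_normal ?V)"
      by unfold_locales (auto simp: centered_normal_def)
    show "char (distr gauss_mu borel ?L) = char (centered_normal ?V)"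
      by (rule ext) (simp add: gauss_mu_char[OF T] char_centered_normal[OF V])
  qed
qed

subsection \<open>Proof of the theorem\<close>

lemma Re_of_real_mult: "Re (of_real r * w) = r * Re w"
  by simp

text \<open>$a_k \cos\theta + b_k \sin\theta$ is the real part of $(a_k - i b_k) e^{i\theta}$.\<close>

definition zcoef :: "(nat \<Rightarrow> real) \<Rightarrow> (nat \<Rightarrow> real) \<Rightarrow> nat \<Rightarrow> complex" where
  "zcoef a b k = Complex (a k) (- b k)"

abbreviation ipow :: "nat \<Rightarrow> nat \<Rightarrow> nat \<Rightarrow> complex" where
  "ipow j n k \<equiv> (\<i> * of_real (real k / real n)) ^ j / complex_of_real (sqrt (real n))"

text \<open>The \<open>j\<close>-th derivative of \<open>g_n\<close> in \<open>t\<close> at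
  \<open>0\<close> when \<open>X = x\<close>; the factor \<open>ipow\<close> collects the powers of
  \<open>\<i> * k / n\<close> and the normalisation.\<close>

definition rseq :: "(nat \<Rightarrow> complex) \<Rightarrow> nat \<Rightarrow> real \<Rightarrow> nat \<Rightarrow> real" where
  "rseq z n x j = trig (\<lambda>k. z k * ipow j n k) n x"

text \<open>A crude bound for fixed \<open>n\<close>, growing with \<open>n\<close>, which only
  secures convergence of the Taylor series. Control uniform in \<open>n\<close> comes from
  \<open>rseq_tail\<close>.\<close>

lemma rseq_in_cube: "rseq z n x \<in> cube (\<Sum>k=1..n. cmod (z k) / sqrt (real n))"
proof -
  have "\<bar>rseq z n x j\<bar> \<le> 2 ^ j * (\<Sum>k=1..n. cmod (z k) / sqrt (real n))" for j
  proof -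
    let ?R = "\<Sum>k=1..n. cmod (z k) / sqrt (real n)"
    have "\<bar>rseq z n x j\<bar> \<le> (\<Sum>k=1..n. cmod (z k * ipow j n k))"
      unfolding rseq_def by (rule trig_bound)
    also have "\<dots> \<le> ?R"
    proof (rule sum_mono)
      fix k assume k: "k \<in> {1..n}"
      have "cmod ((\<i> * of_real (real k / real n)) ^ j) \<le> 1"
        using k by (simp add: norm_power norm_mult power_le_one norm_divide)
      then have "cmod (z k) * (cmod ((\<i> * of_real (real k / real n)) ^ j) / sqrt (real n)) \<le> cmod (z k) * (1 / sqrt (real n))"
        by (intro mult_left_mono divide_right_mono) auto
      then show "cmod (z k * ipow j n k) \<le> cmod (z k) / sqrt (real n)"
        by (simp only: norm_mult norm_divide norm_of_real) simp
    qed
    also have "?R \<le> 2 ^ j * ?R"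
      using mult_right_mono[of 1 "2 ^ j" ?R] by (simp add: sum_nonneg)
    finally show ?thesis .
  qed
  then show ?thesis by (simp add: cube_def)
qed

lemma measurable_rseq: "rseq z n \<in> borel_measurable borel"
  by (rule measurable_coordinatewise_then_product) (simp add: rseq_def)

lemma rseq_lin:
  "(\<Sum>j<N. d j * rseq z n x j) = trig (\<lambda>k. z k * samp (qpoly d N) n k) n x"
proof -
  have "(\<Sum>j<N. d j * rseq z n x j)
    = (\<Sum>j<N. \<Sum>k=1..n. Re (of_real (d j) * (z k * ipow j n k * cis (real k * x))))"
    unfolding rseq_def trig_def by (simp only: Re_of_real_mult sum_distrib_left)
  also have "\<dots> = (\<Sum>k=1..n. \<Sum>j<N. Re (of_real (d j) * (z k * ipow j n k * cis (real k * x))))"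
    by (rule sum.swap)
  also have "\<dots> = (\<Sum>k=1..n. Re (\<Sum>j<N. of_real (d j) * (z k * ipow j n k * cis (real k * x))))"
    by (simp only: Re_sum)
  also have "\<dots> = (\<Sum>k=1..n. Re (z k * samp (qpoly d N) n k * cis (real k * x)))"
    unfolding qpoly_def
    by (intro sum.cong refl arg_cong[where f=Re])
      (simp only: sum_distrib_left sum_distrib_right sum_divide_distrib times_divide_eq_right times_divide_eq_left mult_ac)
  finally show ?thesis unfolding trig_def .
qed

text \<open>Expand \<open>exp (\<i> * k * t / n)\<close> in powers of \<open>t\<close> inside the
  finite sum over \<open>k\<close>.\<close>

lemma egf_rseq:
  assumes n: "n \<ge> 1"
  shows "egf (rseq (zcoef a b) n x) t
    = 1 / sqrt (real n) * (\<Sum>k=1..n. a k * cos (real k * (x + t / real n)) + b k * sin (real k * (x + t / real n)))"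
proof -
  let ?z = "zcoef a b" and ?s = "complex_of_real (sqrt (real n))"
  have "(\<lambda>j. \<Sum>k=1..n. Re (?z k / ?s * cis (real k * x) * ((\<i> * of_real (real k * t / real n)) ^ j /\<^sub>R fact j)))
    sums (\<Sum>k=1..n. Re (?z k / ?s * cis (real k * x) * exp (\<i> * of_real (real k * t / real n))))"
    by (intro sums_sum sums_Re sums_mult exp_converges)
  moreover have "(\<Sum>k=1..n. Re (?z k / ?s * cis (real k * x) * ((\<i> * of_real (real k * t / real n)) ^ j /\<^sub>R fact j)))
    = rseq ?z n x j / fact j * t ^ j" for j
  proof -
    have "?z k / ?s * cis (real k * x) * ((\<i> * of_real (real k * t / real n)) ^ j /\<^sub>R fact j)
      = of_real (t ^ j / fact j) * (?z k * ((\<i> * of_real (real k / real n)) ^ j / ?s) * cis (real k * x))" for k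
      by (simp add: scaleR_conv_of_real power_mult_distrib power_divide divide_inverse mult_ac)
    then have "(\<Sum>k=1..n. Re (?z k / ?s * cis (real k * x) * ((\<i> * of_real (real k * t / real n)) ^ j /\<^sub>R fact j)))
      = (\<Sum>k=1..n. t ^ j / fact j * Re (?z k * ((\<i> * of_real (real k / real n)) ^ j / ?s) * cis (real k * x)))"
      by (simp only: Re_of_real_mult)
    moreover have "u / fact j * t ^ j = t ^ j / fact j * u" for u by simp
    ultimately show ?thesis unfolding rseq_def trig_def by (simp only: sum_distrib_left)
  qed
  ultimately have "egf (rseq ?z n x) t = (\<Sum>k=1..n. Re (?z k / ?s * cis (real k * x) * exp (\<i> * of_real (real k * t / real n))))"
    unfolding egf_def by (simp add: sums_iff)
  also have "\<dots> = (\<Sum>k=1..n. 1 / sqrt (real n) * (a k * cos (real k * (x + t / real n)) + b k * sin (real k * (x + t / real n))))"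
  proof (rule sum.cong)
    fix k
    have "cis (real k * x) * exp (\<i> * of_real (real k * t / real n)) = cis (real k * (x + t / real n))"
    proof -
      have "exp (\<i> * of_real (real k * t / real n)) = cis (real k * t / real n)" by (simp only: cis_conv_exp)
      then show ?thesis by (simp only: cis_mult distrib_left times_divide_eq_right)
    qed
    then have "?z k / ?s * cis (real k * x) * exp (\<i> * of_real (real k * t / real n)) = of_real (1 / sqrt (real n)) * (?z k * cis (real k * (x + t / real n)))"
      by (simp add: mult.assoc)
    then show "Re (?z k / ?s * cis (real k * x) * exp (\<i> * of_real (real k * t / real n))) = 1 / sqrt (real n) * (a k * cos (real k * (x + t / real n)) + b k * sin (real k * (x + t / real n)))"
      by (simp only: Re_of_real_mult) (simp add: zcoef_def)
  qed simp
  finally show ?thesis by (simp add: sum_distrib_left)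
qed

text \<open>A single constant serves both estimates, as \<open>trig_char_tendsto\<close> asks: in
  \<open>j + 1\<close>, the \<open>j\<close> is the Lipschitz constant of \<open>u^j\<close> on the
  unit interval and the 1 its supremum.\<close>

lemma qpoly_bound_Lipschitz:
  defines "D \<equiv> \<lambda>d N. (\<Sum>j<N. \<bar>d j\<bar> * (real j + 1))"
  shows "u \<in> {0..1} \<Longrightarrow> cmod (qpoly d N u) \<le> D d N"
    and "s \<in> {0..1} \<Longrightarrow> t \<in> {0..1} \<Longrightarrow> cmod (qpoly d N s - qpoly d N t) \<le> D d N * \<bar>s - t\<bar>"
proof -
  assume u: "u \<in> {0..1}"
  have "cmod (qpoly d N u) \<le> (\<Sum>j<N. cmod (of_real (d j) * (\<i> * of_real u) ^ j))"
    unfolding qpoly_def by (rule norm_sum)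
  also have "\<dots> \<le> D d N"
    unfolding D_def
  proof (rule sum_mono)
    fix j
    have "u ^ j \<le> real j + 1" using u power_le_one[of u j] by simp
    then show "cmod (of_real (d j) * (\<i> * of_real u) ^ j) \<le> \<bar>d j\<bar> * (real j + 1)"
      using u by (simp add: norm_mult norm_power mult_left_mono)
  qed
  finally show "cmod (qpoly d N u) \<le> D d N" .
next
  assume st: "s \<in> {0..1}" "t \<in> {0..1}"
  have "cmod (qpoly d N s - qpoly d N t) = cmod (\<Sum>j<N. of_real (d j) * ((\<i> * of_real s) ^ j - (\<i> * of_real t) ^ j))"
    unfolding qpoly_def by (simp add: sum_subtractf right_diff_distrib)
  also have "\<dots> \<le> (\<Sum>j<N. cmod (of_real (d j) * ((\<i> * of_real s) ^ j - (\<i> * of_real t) ^ j)))"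
    by (rule norm_sum)
  also have "\<dots> \<le> (\<Sum>j<N. \<bar>d j\<bar> * (real j + 1) * \<bar>s - t\<bar>)"
  proof (rule sum_mono)
    fix j
    have "cmod ((\<i> * of_real s) ^ j - (\<i> * of_real t) ^ j) \<le> real j * cmod (\<i> * of_real s - \<i> * of_real t)"
      by (rule norm_power_diff) (use st in \<open>auto simp: norm_mult\<close>)
    also have "cmod (\<i> * of_real s - \<i> * of_real t) = \<bar>s - t\<bar>"
      by (simp add: norm_mult flip: right_diff_distrib of_real_diff)
    also have "real j * \<bar>s - t\<bar> \<le> (real j + 1) * \<bar>s - t\<bar>" by (intro mult_right_mono) auto
    finally show "cmod (of_real (d j) * ((\<i> * of_real s) ^ j - (\<i> * of_real t) ^ j)) \<le> \<bar>d j\<bar> * (real j + 1) * \<bar>s - t\<bar>"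
      by (simp add: norm_mult mult.assoc mult_left_mono)
  qed
  finally show "cmod (qpoly d N s - qpoly d N t) \<le> D d N * \<bar>s - t\<bar>"
    by (simp add: D_def sum_distrib_right)
qed

lemma (in prob_space) expectation_cos_shift:
  assumes "f \<in> borel_measurable M"
  shows "expectation (\<lambda>x. cos (\<theta> + f x)) = Re (cis \<theta> * expectation (\<lambda>x. iexp (f x)))"
proof -
  have i: "integrable M (\<lambda>x. iexp (f x))" by (rule integrable_const_bound[where B=1]) (use assms in auto)
  have "cos (\<theta> + f x) = Re (cis \<theta> * iexp (f x))" for x
    by (simp add: cis_mult flip: cis_conv_exp del: times_complex.sel)
  then have "expectation (\<lambda>x. cos (\<theta> + f x)) = expectation (\<lambda>x. Re (cis \<theta> * iexp (f x)))" by simp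
  also have "\<dots> = Re (expectation (\<lambda>x. cis \<theta> * iexp (f x)))"
    by (rule integral_Re) (use i in simp)
  finally show ?thesis by simp
qed

lemma rseq_tail:
  assumes r: "r > 0" and n: "n \<ge> 1" and C: "(\<Sum>k=1..n. (cmod (z k))\<^sup>2) \<le> 2 * C * real n"
  shows "measure unifX {x. \<bar>rseq z n x j\<bar> > r} \<le> C / r\<^sup>2"
proof -
  let ?w = "\<lambda>k. z k * ipow j n k"
  have m[measurable]: "(\<lambda>x. rseq z n x j) \<in> borel_measurable unifX" unfolding rseq_def by measurable
  have "(trig ?w n x)\<^sup>2 \<le> (\<Sum>k=1..n. cmod (?w k))\<^sup>2" for x
    using power_mono[OF trig_bound[of ?w n x] abs_ge_zero, of 2] by (simp only: power2_abs)
  note b = this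
  have "integrable unifX (\<lambda>x. (trig ?w n x)\<^sup>2)"
  proof (rule integrable_unifX_bounded)
    show "norm ((trig ?w n x)\<^sup>2) \<le> (\<Sum>k=1..n. cmod (?w k))\<^sup>2" for x
      using b[of x] by (simp only: real_norm_def abs_power2)
  qed measurable
  then have i: "integrable unifX (\<lambda>x. (rseq z n x j)\<^sup>2)" unfolding rseq_def .
  have "measure unifX {x. \<bar>rseq z n x j\<bar> > r} \<le> measure unifX {x\<in>space unifX. \<bar>rseq z n x j\<bar> \<ge> r}"
    by (rule unifX.finite_measure_mono) (use m in auto)
  also have "\<dots> \<le> (LINT x|unifX. (rseq z n x j)\<^sup>2) / r\<^sup>2"
    by (rule unifX.second_moment_method) (use i r in auto)
  also have "(LINT x|unifX. (rseq z n x j)\<^sup>2) = (\<Sum>k=1..n. (cmod (?w k))\<^sup>2) / 2"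
    unfolding rseq_def by (rule integral_trig_square)
  also have "(\<Sum>k=1..n. (cmod (?w k))\<^sup>2) \<le> (\<Sum>k=1..n. (cmod (z k))\<^sup>2 / real n)"
  proof (rule sum_mono)
    fix k assume k: "k \<in> {1..n}"
    have "cmod ((\<i> * of_real (real k / real n)) ^ j) \<le> 1"
      using k by (simp add: norm_power norm_mult power_le_one norm_divide)
    then have "(cmod ((\<i> * of_real (real k / real n)) ^ j))\<^sup>2 \<le> 1"
      by (rule power_le_one[OF norm_ge_zero])
    then have "(cmod (z k))\<^sup>2 * ((cmod ((\<i> * of_real (real k / real n)) ^ j))\<^sup>2 / real n) \<le> (cmod (z k))\<^sup>2 * (1 / real n)"
      by (intro mult_left_mono divide_right_mono) auto
    moreover have "(sqrt (real n))\<^sup>2 = real n" by simp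
    ultimately show "(cmod (?w k))\<^sup>2 \<le> (cmod (z k))\<^sup>2 / real n"
      by (simp only: norm_mult norm_divide norm_of_real power_mult_distrib power_divide abs_of_nonneg real_sqrt_ge_zero of_nat_0_le_iff) simp
  qed
  also have "\<dots> = (\<Sum>k=1..n. (cmod (z k))\<^sup>2) / real n" by (simp add: sum_divide_distrib)
  also have "\<dots> \<le> 2 * C" using C n by (simp add: divide_simps)
  finally show ?thesis using r by (simp add: divide_right_mono)
qed

text \<open>The deterministic half of the theorem, for one fixed realisation of the coefficients. A
  test function on \<open>C1code\<close> becomes \<open>F (Phi0 y)\<close> on sequence space, which
  is bounded and continuous on every cube.\<close>

lemma weak_conv_of_char:
  fixes a b :: "nat \<Rightarrow> real"
  assumes bound: "\<And>n. n \<ge> n0 \<Longrightarrow> (\<Sum>k=1..n. (cmod (zcoef a b k))\<^sup>2) \<le> 2 * C * real n" and C: "C \<ge> 1"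
    and char: "\<And>d N. d \<in> fin_rat \<Longrightarrow> (\<lambda>n. trig_char (\<lambda>k. zcoef a b k * samp (qpoly d N) n k) n)
      \<longlonglongrightarrow> exp (- qform d N / 2)"
    and G: "\<And>n t x. G n x t = 1 / sqrt (real n) * (\<Sum>k=1..n. a k * cos (real k * (x + t / real n)) + b k * sin (real k * (x + t / real n)))"
  shows "weak_conv_metric (\<lambda>n. distr unifX borel (\<lambda>x. C1emb (G n x))) gauss_mu"
  unfolding weak_conv_metric_def
proof (intro allI impI, elim conjE)
  fix F :: "C1code \<Rightarrow> real" assume F: "continuous_on UNIV F" "bounded (range F)"
  let ?Y = "rseq (zcoef a b)"
  obtain B where B: "\<And>p. \<bar>F p\<bar> \<le> B" using F(2) by (auto simp: bounded_iff)
  have Fm[measurable]: "F \<in> borel_measurable borel" by (rule borel_measurable_continuous_onI[OF F(1)])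
  define H where "H y = F (Phi0 y)" for y
  have Hm: "H \<in> borel_measurable borel"
    unfolding H_def by (rule measurable_compose[OF measurable_Phi0 Fm])
  have Ym: "?Y n \<in> measurable unifX borel" for n
    using measurable_rseq measurable_cong_sets[OF sets_unifX refl] by blast
  define P where "P n = distr unifX borel (?Y n)" for n
  define P0 where "P0 = distr noise borel gseq"
  have lim: "(\<lambda>n. integral\<^sup>L (P n) H) \<longlonglongrightarrow> integral\<^sup>L P0 H"
  proof (rule weak_conv_sequence_space[where C=C and B=B and ?n0.0="max 1 n0"])
    show "prob_space (P n)" for n unfolding P_def by (rule unifX.prob_space_distr[OF Ym])
    show "prob_space P0" unfolding P0_def by (rule noise.P.prob_space_distr) measurable
    show "sets (P n) = sets borel" "sets P0 = sets borel" for n by (simp_all add: P_def P0_def)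
    have cl: "{y :: nat \<Rightarrow> real. \<bar>y j\<bar> > r} \<in> sets borel" for j r
      by (intro borel_open open_Collect_less continuous_on_const continuous_on_rabs continuous_on_product_coordinates)
    show "measure (P n) {y\<in>space (P n). \<bar>y j\<bar> > r} \<le> C / r\<^sup>2" if "n \<ge> max 1 n0" "r > 0" for n j r
    proof -
      have "measure (P n) {y\<in>space (P n). \<bar>y j\<bar> > r} = measure unifX {x. \<bar>?Y n x j\<bar> > r}"
        unfolding P_def using cl[of r j] by (subst measure_distr[OF Ym]) (auto simp: vimage_def)
      also have "\<dots> \<le> C / r\<^sup>2" by (rule rseq_tail) (use that bound in auto)
      finally show ?thesis .
    qed
    show "measure P0 {y\<in>space P0. \<bar>y j\<bar> > r} \<le> C / r\<^sup>2" if "r > 0" for j r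
    proof -
      have "measure P0 {y\<in>space P0. \<bar>y j\<bar> > r} = noise.P.prob {\<xi>\<in>space noise. \<bar>gseq \<xi> j\<bar> > r}"
        unfolding P0_def using cl[of r j]
        by (subst measure_distr[OF measurable_gseq]) (auto intro!: arg_cong[where f="measure noise"])
      also have "\<dots> \<le> 1 / r\<^sup>2" by (rule gseq_tail[OF that])
      also have "\<dots> \<le> C / r\<^sup>2" using C by (intro divide_right_mono) auto
      finally show ?thesis .
    qed
    fix d \<theta> assume d: "d \<in> fin_rat"
    obtain N where "\<forall>y. lin d y = (\<Sum>j<N. d j * y j)" using fin_rat_lin[OF d] by (elim exE)
    then have N: "\<And>y. lin d y = (\<Sum>j<N. d j * y j)" by (rule spec)
    have cm: "(\<lambda>y. cos (\<theta> + lin d y)) \<in> borel_measurable borel" by measurable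
    have 1: "(LINT y|P n. cos (\<theta> + lin d y)) = Re (cis \<theta> * trig_char (\<lambda>k. zcoef a b k * samp (qpoly d N) n k) n)" for n
    proof -
      have "(LINT y|P n. cos (\<theta> + lin d y)) = (LINT x|unifX. cos (\<theta> + lin d (?Y n x)))"
        unfolding P_def by (rule integral_distr[OF Ym cm])
      also have "\<dots> = Re (cis \<theta> * trig_char (\<lambda>k. zcoef a b k * samp (qpoly d N) n k) n)"
        unfolding N rseq_lin trig_char_def by (rule unifX.expectation_cos_shift) simp
      finally show ?thesis .
    qed
    have gm: "(\<lambda>\<xi>. \<Sum>j<N. d j * gseq \<xi> j) \<in> borel_measurable noise" by measurable
    have 2: "(LINT y|P0. cos (\<theta> + lin d y)) = Re (cis \<theta> * exp (- qform d N / 2))"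
    proof -
      have "(LINT y|P0. cos (\<theta> + lin d y)) = noise.P.expectation (\<lambda>\<xi>. cos (\<theta> + lin d (gseq \<xi>)))"
        unfolding P0_def by (rule integral_distr[OF measurable_gseq cm])
      then show ?thesis unfolding N noise.P.expectation_cos_shift[OF gm] gseq_char .
    qed
    show "(\<lambda>n. LINT y|P n. cos (\<theta> + lin d y)) \<longlonglongrightarrow> (LINT y|P0. cos (\<theta> + lin d y))"
      unfolding 1 2 by (intro tendsto_Re tendsto_mult tendsto_const char d)
  next
    show "continuous_on (cube R) H" for R
      unfolding H_def by (rule continuous_on_compose2[OF F(1) continuous_Phi0]) auto
  qed (use Hm B in \<open>auto simp: H_def\<close>)
  have "integral\<^sup>L P0 H = integral\<^sup>L gauss_mu F"
    unfolding P0_def gauss_mu_def integral_distr[OF measurable_gseq Hm] integral_distr[OF measurable_Phi0_gseq Fm] H_def ..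
  note lim = lim[unfolded this]
  \<comment> \<open>The process is identified with its Taylor series through
    \<open>egf_rseq\<close>, which is stated for \<open>n \<ge> 1\<close>.\<close>
  have ev: "\<forall>\<^sub>F n in sequentially. integral\<^sup>L (P n) H = integral\<^sup>L (distr unifX borel (\<lambda>x. C1emb (G n x))) F"
    using eventually_ge_at_top[of 1]
  proof eventually_elim
    case (elim n)
    have e: "C1emb (G n x) = Phi0 (?Y n x)" for x
    proof -
      have "G n x = egf (?Y n x)" unfolding G egf_rseq[OF elim] fun_eq_iff by simp
      then show ?thesis
        using Phi0_eq[OF rseq_in_cube] Phi_eq_C1emb[OF rseq_in_cube] by metis
    qed
    have "(\<lambda>x. Phi0 (?Y n x)) \<in> borel_measurable unifX"
      by (rule measurable_compose[OF Ym measurable_Phi0])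
    then show ?case
      unfolding P_def integral_distr[OF Ym Hm] e H_def by (simp add: integral_distr)
  qed
  show "(\<lambda>n. integral\<^sup>L (distr unifX borel (\<lambda>x. C1emb (G n x))) F) \<longlonglongrightarrow> integral\<^sup>L gauss_mu F"
    by (rule Lim_transform_eventually[OF lim ev])
qed

theorem theorem3:
  fixes M :: "'a measure" and a b :: "nat \<Rightarrow> 'a \<Rightarrow> real"
  assumes "prob_space M"
    and "\<And>k. k \<ge> 1 \<Longrightarrow> a k \<in> borel_measurable M"
    and "\<And>k. k \<ge> 1 \<Longrightarrow> b k \<in> borel_measurable M"
    and "prob_space.indep_vars M (\<lambda>_. borel)
           (\<lambda>i. case i of Inl k \<Rightarrow> a k | Inr k \<Rightarrow> b k) (Inl ` {1..} \<union> Inr ` {1..})"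
    and "\<And>k. k \<ge> 1 \<Longrightarrow> distr M borel (a k) = distr M borel (a 1)"
    and "\<And>k. k \<ge> 1 \<Longrightarrow> distr M borel (b k) = distr M borel (a 1)"
    and "integrable M (\<lambda>\<omega>. (a 1 \<omega>)\<^sup>2)"
    and "integral\<^sup>L M (a 1) = 0"
    and "integral\<^sup>L M (\<lambda>\<omega>. (a 1 \<omega>)\<^sup>2) = 1"
  shows "\<exists>mu. centered_gaussian_C1_law (\<lambda>t s. sinc_cov (t - s)) mu \<and>
           (AE \<omega> in M. weak_conv_metric
              (\<lambda>n. distr (uniform_measure lborel {0..2*pi}) borel
                      (\<lambda>x. C1emb (\<lambda>t. fn_rand a b n \<omega> (x + t / real n)))) mu)"
proof (intro exI conjI)
  interpret prob_space M by fact
  note ind = assms(4) and dist = assms(5,6) and int2 = assms(7) and mean = assms(8) and var = assms(9)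
  show "centered_gaussian_C1_law (\<lambda>t s. sinc_cov (t - s)) gauss_mu" by (rule gauss_mu_law)
  \<comment> \<open>With second moment 1 and slack 1 the averaging bound reads
    \<open>2 * (1 + 1) = 4\<close> for each family. The two together give \<open>8 = 2 * C\<close>
    with \<open>C = 4\<close>.\<close>
  have bound: "AE \<omega> in M. \<forall>\<^sub>F n in sequentially. (\<Sum>k=1..n. (c k \<omega>)\<^sup>2) \<le> 4 * real n"
    if "indep_vars (\<lambda>_. borel) c {1..}" "\<And>k. k \<ge> 1 \<Longrightarrow> distr M borel (c k) = distr M borel (a 1)" for c
  proof -
    have "AE \<omega> in M. \<forall>\<^sub>F n in sequentially. (\<Sum>k=1..n. (c k \<omega>)\<^sup>2) \<le> 2 * (expectation (\<lambda>\<omega>. (a 1 \<omega>)\<^sup>2) + 1) * real n"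
      by (intro iid_average_bound_comp[where h="\<lambda>x. x\<^sup>2"] that assms(2) int2) auto
    then show ?thesis unfolding var by simp
  qed
  have A: "AE \<omega> in M. \<forall>\<^sub>F n in sequentially. (\<Sum>k=1..n. (a k \<omega>)\<^sup>2) \<le> 4 * real n"
    by (rule bound[OF indep_vars_case_sumD(1)[OF ind] dist(1)])
  have B: "AE \<omega> in M. \<forall>\<^sub>F n in sequentially. (\<Sum>k=1..n. (b k \<omega>)\<^sup>2) \<le> 4 * real n"
    by (rule bound[OF indep_vars_case_sumD(2)[OF ind] dist(2)])
  have C: "AE \<omega> in M. \<forall>d\<in>fin_rat. \<forall>N. (\<lambda>n. trig_char (\<lambda>k. Complex (a k \<omega>) (- b k \<omega>) * samp (qpoly d N) n k) n)
      \<longlonglongrightarrow> exp (- qform d N / 2)"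
    unfolding AE_ball_countable[OF countable_fin_rat] AE_all_countable
  proof (intro ballI allI)
    fix d N
    show "AE \<omega> in M. (\<lambda>n. trig_char (\<lambda>k. Complex (a k \<omega>) (- b k \<omega>) * samp (qpoly d N) n k) n)
      \<longlonglongrightarrow> exp (- qform d N / 2)"
      by (rule trig_char_tendsto[OF ind dist int2 mean var qpoly_bound_Lipschitz qform_riemann])
  qed
  show "AE \<omega> in M. weak_conv_metric
              (\<lambda>n. distr (uniform_measure lborel {0..2*pi}) borel
                      (\<lambda>x. C1emb (\<lambda>t. fn_rand a b n \<omega> (x + t / real n)))) gauss_mu"
    using A B C
  proof eventually_elim
    case (elim \<omega>)
    let ?a = "\<lambda>k. a k \<omega>" and ?b = "\<lambda>k. b k \<omega>"
    have "\<forall>\<^sub>F n in sequentially. (\<Sum>k=1..n. (cmod (zcoef ?a ?b k))\<^sup>2) \<le> 2 * 4 * real n"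
      using elim(1,2) by eventually_elim (simp add: zcoef_def cmod_power2 sum.distrib)
    then obtain n0 where n0: "\<And>n. n \<ge> n0 \<Longrightarrow> (\<Sum>k=1..n. (cmod (zcoef ?a ?b k))\<^sup>2) \<le> 2 * 4 * real n"
      unfolding eventually_sequentially by blast
    show ?case
      unfolding unifX_def[symmetric]
      by (rule weak_conv_of_char[where a="?a" and b="?b" and C=4, OF n0])
        (use elim(3) in \<open>auto simp: zcoef_def fn_rand_def\<close>)
  qed
qed

end
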